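(* Let $n\geq3$ be an integer, $m=1-n$, $\lambda,\mu\in\mathbb{R}$, $\delta=\mu-\lambda$. Put $$I_\delta=\bigcup_{d=0}^{\infty}\Big\{\tfrac{2c-j}{2}: 0\leq j\leq 2d-1,\ 0\leq c\leq d\Big\},\qquad \mathsf{C}=\bigcup_{k\in\mathbb{N}}\Big\{\tfrac{2k-i+m}{2}: i=1,\dots,k\Big\}$$ ($c,j,d$ integers), and let $C_{\delta,\mathrm{crit}}$ be the set of numbers $$\frac{(k-k')(2(k+k')+m-1)-4(kd-k'd')+2(d-d')(2d+2d'+1)}{4(d-d')}$$ with $k,k'\in\mathbb{N}$, $d,d'\in\frac12\mathbb{N}$, $d'\leq k'\leq 2d'$, $d'<d$, $d\leq k\leq 2d$. If $\delta\notin C_{\delta,\mathrm{crit}}$ and $\delta\notin I_\delta\cup\mathsf{C}$, then the fine $\mathfrak{spo}(2|n)$-equivariant quantization $Q=Q^{\mathfrak{sl}}\circ\mathcal{SQ}$ on $\mathcal{P}_\delta(S^{1|n})$ is unique, i.e. it is the only fine $\mathfrak{spo}(2|n)$-equivariant quantization $\mathcal{P}_\delta(S^{1|n})\to\mathcal{D}_{\lambda\mu}(S^{1|n})$. Here $Q^{\mathfrak{sl}}:\mathcal{S}_\delta(S^{1|n})\to\mathcal{D}_{\lambda\mu}(S^{1|n})$ is the $\mathfrak{pgl}(2|n)$-equivariant quantization and $\mathcal{SQ}:\mathcal{P}_\delta(S^{1|n})\to\mathcal{S}_\delta(S^{1|n})$ is the linear map given, on elements $S$ homogeneous of degree $c$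 in $\zeta$, by $$\mathcal{SQ}(S)=\Big(\sum_{a=0}^\infty \Delta^a\frac{1}{2^a a!}\prod_{j=0}^{a-1}\frac{1}{c-\delta-\frac12 j}\Big)S,\qquad \Delta=\sum_{i=1}^n\gamma_i\overline{D}_i\partial_\zeta.$$
   Context: Superfunctions and contact fields. $C^\infty(S^{1|n})$ is the supercommutative superalgebra of $f=\sum_I f_I(x)\theta_I$, with $x$ an even (affine) coordinate, $\theta_1,\dots,\theta_n$ odd anticommuting coordinates; $S^{1|n}$ is identified with $\mathbb{R}^{1|n}$ through the affine coordinate. $\tilde{\ }$ denotes parity, $f'=\partial_x f$. Put $\overline{D}_i=\partial_{\theta_i}-\theta_i\partial_x$. For homogeneous $f$, $X_f=f\partial_x-(-1)^{\tilde f}\frac12\sum_{i}\overline{D}_i(f)\overline{D}_i$. $\mathfrak{spo}(2|n)$ is the Lie superalgebra spanned by the $X_f$ with $f\in\{1,x,x^2,\theta_i,x\theta_i,\theta_i\theta_j\ (i<j)\}$. $\mathfrak{pgl}(2|n)$ is the Lie superalgebra of projective vector fields, spanned by $\partial_{y^j}$, $y^i\partial_{y^j}$ and $y^j\mathcal{E}$, where $(y^1,\dots,y^{n+1})=(x,\theta_1,\dots,\theta_n)$ and $\mathcal{E}=\sum_j y^j\partial_{y^j}$. Densities and operators. $\mathcal{F}_\lambda$ is $C^\infty(S^{1|n})$ with the action $L^\lambda_{X_f}(g)=X_f(g)+\lambda f'g$. For a general vector field $X=f\partial_x+\sum g^i\partial_{\theta_i}$ the action on $\mathcal{F}_\lambda$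 is $L^\lambda_X(g)=X(g)+\frac{2\lambda}{m+1}\mathrm{div}(X)g$, $\mathrm{div}(X)=\partial_xf+\sum_i(-1)^{\widetilde{g^i}}\partial_{\theta_i}g^i$ (this agrees with the previous formula for $X=X_f$). $\mathcal{D}_{\lambda\mu}$ is the space of differential operators $\mathcal{F}_\lambda\to\mathcal{F}_\mu$, with action $\mathcal{L}^{\lambda\mu}_XD=L^\mu_X\circ D-(-1)^{\tilde X\tilde D}D\circ L^\lambda_X$. Each $D\in\mathcal{D}_{\lambda\mu}$ is a unique finite sum $\sum_{c,K}A_{cK}\partial_x^c\overline{D}^K$, $c\in\mathbb{N}$, $K\in\{0,1\}^n$, $\overline{D}^K=\overline{D}_1^{i_1}\cdots\overline{D}_n^{i_n}$. $D$ has order $\leq k$ (space $\mathcal{D}^k_{\lambda\mu}$) if $c+|K|\leq k$ in all terms, and Heisenberg order $\leq d\in\frac12\mathbb{N}$ (space $\mathcal{H}^d_{\lambda\mu}$) if $c+\frac12|K|\leq d$ in all terms. Symbols. $\mathcal{S}_\delta=\bigoplus_k\mathcal{S}^k_\delta$, $\mathcal{S}^k_\delta=\mathcal{D}^k_{\lambda\mu}/\mathcal{D}^{k-1}_{\lambda\mu}$, and $\mathcal{P}_\delta=\bigoplus_{d}\mathcal{P}_\delta^d$, $\mathcal{P}^d_\delta=\mathcal{H}^d_{\lambda\mu}/\mathcal{H}^{d-1/2}_{\lambda\mu}$, with the induced actions; $\sigma_k$ and $\mathrm{h}\sigma^d$ are the canonical projections onto $\mathcal{S}_\delta^k$ and $\mathcal{P}_\delta^d$.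 Both spaces are identified with polynomials $\sum A_{cK}\alpha^\delta\zeta^c\gamma^K$ ($\zeta$ even, $\gamma_1,\dots,\gamma_n$ odd, anticommuting with each other and with odd superfunctions; $\alpha^\delta$ is a formal density symbol): the class of $\sum A_{cK}\partial_x^c\overline{D}^K$ goes to the sum of the terms $A_{cK}\alpha^\delta\zeta^c\gamma^K$ with $c+|K|=k$ (for $\mathcal{S}^k_\delta$), resp. $c+\frac12|K|=d$ (for $\mathcal{P}^d_\delta$). In $\Delta$, $\overline{D}_i$ acts on the coefficients only (with Koszul signs), and the empty product is $1$. $\mathfrak{pgl}(2|n)$-equivariant quantization. It is the unique linear map $Q^{\mathfrak{sl}}:\mathcal{S}_\delta\to\mathcal{D}_{\lambda\mu}$ commuting with the actions of $\mathfrak{pgl}(2|n)$ and such that $\sigma_k(Q^{\mathfrak{sl}}(S))=S$ for $S\in\mathcal{S}^k_\delta$ (it exists and is unique for $\delta\notin\mathsf{C}$, a known result of Mathonet and Radoux). Explicitly, for $S\in\mathcal{S}_\delta^k$, $Q^{\mathfrak{sl}}(S)=\sum_{r=0}^kC_{k,r}Q_{\mathrm{Aff}}(\mathrm{div}^rS)$, $C_{k,0}=1$, $C_{k,r}=\frac{\prod_{j=1}^r(2\lambda+k-j)}{r!\prod_{j=1}^r(m+2k-j-2\delta)}$; here symbols are written in the canonical moments $\zeta,\eta_i$ with $\gamma_i=\eta_i-\theta_i\zeta$, $Q_{\mathrm{Aff}}(A\zeta^c\eta^I)=A\partial_x^c\partial_\theta^I$, and $\mathrm{div}=\partial_x\partial_\zeta-\sum_i\partial_{\eta_i}\partial_{\theta_i}$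 (derivatives in the canonical coordinates $x,\theta,\zeta,\eta$, odd ones with Koszul signs). Fine quantization. A fine $\mathfrak{spo}(2|n)$-equivariant quantization is a linear bijection $Q:\mathcal{P}_\delta\to\mathcal{D}_{\lambda\mu}$ such that, for every $d\in\frac12\mathbb{N}$, $Q(\mathcal{P}^d_\delta)\subset\mathcal{H}^d_{\lambda\mu}$ and $\mathrm{h}\sigma^d\circ Q|_{\mathcal{P}^d_\delta}=\mathrm{Id}$, and such that $\mathcal{L}^{\lambda\mu}_{X}\circ Q=Q\circ L^{\mathcal{P}}_{X}$ for all $X\in\mathfrak{spo}(2|n)$, where $L^{\mathcal{P}}$ is the induced action on $\mathcal{P}_\delta$. *)

theory Defs
  imports "HOL-Analysis.Analysis" "HOL-Library.Poly_Mapping"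
begin

section \<open>Superfunctions on the supercircle in the affine coordinate\<close>

definition smooth :: "(real \<Rightarrow> real) \<Rightarrow> bool" where
  "smooth f \<longleftrightarrow> (\<forall>k x. ((deriv ^^ k) f) field_differentiable (at x))"

primrec differentiable_upto :: "nat \<Rightarrow> (real \<Rightarrow> real) \<Rightarrow> bool" where
  "differentiable_upto 0 f \<longleftrightarrow> True"
| "differentiable_upto (Suc k) f \<longleftrightarrow>
    (\<forall>x. f field_differentiable (at x)) \<and> differentiable_upto k (deriv f)"

lemma differentiable_upto_iff:
  "differentiable_upto k f \<longleftrightarrow> (\<forall>j<k. \<forall>x. ((deriv ^^ j) f) field_differentiable (at x))"
proof (induction k arbitrary: f)
  case (Suc k)
  have "(\<forall>j<Suc k. P j) \<longleftrightarrow> P 0 \<and> (\<forall>j<k. P (Suc j))" for P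
    by (auto simp: less_Suc_eq_0_disj)
  then show ?case
    by (simp add: Suc.IH funpow_Suc_right del: funpow.simps(2))
qed simp

lemma smooth_iff: "smooth f \<longleftrightarrow> (\<forall>k. differentiable_upto k f)"
  unfolding smooth_def differentiable_upto_iff by auto

lemma differentiable_upto_Suc: "differentiable_upto (Suc k) f \<Longrightarrow> differentiable_upto k f"
  unfolding differentiable_upto_iff by auto

lemma smooth_deriv: "smooth f \<Longrightarrow> smooth (deriv f)"
  unfolding smooth_iff by (metis differentiable_upto.simps(2))

lemma smooth_differentiable: "smooth f \<Longrightarrow> f field_differentiable (at x)"
  unfolding smooth_def by (metis funpow_0)

lemma smooth_const: "smooth (\<lambda>x. c)"
proof -
  have "differentiable_upto k (\<lambda>x. c)" for k c
    by (induction k arbitrary: c) (simp_all add: fun_eq_iff)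
  then show ?thesis by (simp add: smooth_iff)
qed

lemma smooth_ident: "smooth (\<lambda>x. x)"
  unfolding smooth_iff
proof
  fix k
  have "deriv (\<lambda>x. x) = (\<lambda>x::real. 1)" by (simp add: fun_eq_iff)
  then show "differentiable_upto k (\<lambda>x. x)"
    using smooth_const[of 1] by (cases k) (simp_all add: smooth_iff)
qed

lemma smooth_add:
  assumes "smooth f" "smooth g" shows "smooth (\<lambda>x. f x + g x)"
proof -
  have "differentiable_upto k (\<lambda>x. f x + g x)"
    if "differentiable_upto k f" "differentiable_upto k g" for k f g
    using that
  proof (induction k arbitrary: f g)
    case (Suc k)
    then have "deriv (\<lambda>x. f x + g x) = (\<lambda>x. deriv f x + deriv g x)"
      by (simp add: fun_eq_iff)
    with Suc show ?case by (auto intro: field_differentiable_add)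
  qed simp
  with assms show ?thesis by (simp add: smooth_iff)
qed

lemma smooth_mult:
  assumes "smooth f" "smooth g" shows "smooth (\<lambda>x. f x * g x)"
proof -
  have add: "differentiable_upto k (\<lambda>x. f x + g x)"
    if "differentiable_upto k f" "differentiable_upto k g" for k f g
    using that
  proof (induction k arbitrary: f g)
    case (Suc k)
    then have "deriv (\<lambda>x. f x + g x) = (\<lambda>x. deriv f x + deriv g x)"
      by (simp add: fun_eq_iff)
    with Suc show ?case by (auto intro: field_differentiable_add)
  qed simp
  have "differentiable_upto k (\<lambda>x. f x * g x)"
    if "differentiable_upto k f" "differentiable_upto k g" for k f g
    using that
  proof (induction k arbitrary: f g)
    case (Suc k)
    then have "deriv (\<lambda>x. f x * g x) = (\<lambda>x. f x * deriv g x + deriv f x * g x)"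
      by (simp add: fun_eq_iff)
    moreover have "differentiable_upto k f" "differentiable_upto k g"
      using Suc.prems differentiable_upto_Suc by blast+
    ultimately show ?case using Suc
      by (auto intro: field_differentiable_mult add)
  qed simp
  with assms show ?thesis by (simp add: smooth_iff)
qed

lemma smooth_uminus: "smooth f \<Longrightarrow> smooth (\<lambda>x. - f x)"
  using smooth_mult[OF smooth_const[of "- 1"]] by simp

lemma smooth_diff: "smooth f \<Longrightarrow> smooth g \<Longrightarrow> smooth (\<lambda>x. f x - g x)"
  using smooth_add[OF _ smooth_uminus, of f g] by simp

lemma smooth_if: "smooth f \<Longrightarrow> smooth g \<Longrightarrow> smooth (\<lambda>x. if P then f x else g x)"
  by (cases P) simp_all

lemma smooth_sum: "(\<And>i. i \<in> A \<Longrightarrow> smooth (f i)) \<Longrightarrow> smooth (\<lambda>x. \<Sum>i\<in>A. f i x)"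
  by (induction A rule: infinite_finite_induct) (auto intro: smooth_const smooth_add)

text \<open>
  The odd coordinates are indexed by a finite linearly ordered type \<open>'n\<close>, so \<open>n = CARD('n)\<close>.
  A superfunction is the family of its coefficients \<open>f\<^sub>I\<close> in front of the increasing monomials
  \<open>\<theta>\<^sub>I\<close>.
\<close>

typedef 'n sfun = "{F :: 'n set \<Rightarrow> real \<Rightarrow> real. \<forall>I. smooth (F I)}"
  morphisms sf_coeff Abs_sfun
  by (rule exI[of _ "\<lambda>_ _. 0"]) (simp add: smooth_const)

setup_lifting type_definition_sfun

text \<open>\<open>\<theta>\<^sub>J \<theta>\<^sub>K = grassmann_sign J K \<theta>\<^bsub>J \<union> K\<^esub>\<close> for disjoint \<open>J\<close> and \<open>K\<close>.\<close>

definition grassmann_sign :: "'n::linorder set \<Rightarrow> 'n set \<Rightarrow> real" where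
  "grassmann_sign J K = (-1) ^ card {(j, k). j \<in> J \<and> k \<in> K \<and> k < j}"

lemma grassmann_sign_empty [simp]: "grassmann_sign {} K = 1" "grassmann_sign J {} = 1"
  by (simp_all add: grassmann_sign_def)

lemma grassmann_sign_Un_left:
  fixes J K L :: "'n::{finite,linorder} set"
  assumes "J \<inter> K = {}"
  shows "grassmann_sign (J \<union> K) L = grassmann_sign J L * grassmann_sign K L"
proof -
  have "{(j, k). j \<in> J \<union> K \<and> k \<in> L \<and> k < j} =
      {(j, k). j \<in> J \<and> k \<in> L \<and> k < j} \<union> {(j, k). j \<in> K \<and> k \<in> L \<and> k < j}" by auto
  moreover have "{(j, k). j \<in> J \<and> k \<in> L \<and> k < j} \<inter> {(j, k). j \<in> K \<and> k \<in> L \<and> k < j} = {}"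
    using assms by auto
  ultimately show ?thesis
    unfolding grassmann_sign_def power_add[symmetric]
    by (subst card_Un_disjoint[symmetric]) auto
qed

lemma grassmann_sign_Un_right:
  fixes J K L :: "'n::{finite,linorder} set"
  assumes "K \<inter> L = {}"
  shows "grassmann_sign J (K \<union> L) = grassmann_sign J K * grassmann_sign J L"
proof -
  have "{(j, k). j \<in> J \<and> k \<in> K \<union> L \<and> k < j} =
      {(j, k). j \<in> J \<and> k \<in> K \<and> k < j} \<union> {(j, k). j \<in> J \<and> k \<in> L \<and> k < j}" by auto
  moreover have "{(j, k). j \<in> J \<and> k \<in> K \<and> k < j} \<inter> {(j, k). j \<in> J \<and> k \<in> L \<and> k < j} = {}"
    using assms by auto
  ultimately show ?thesis
    unfolding grassmann_sign_def power_add[symmetric]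
    by (subst card_Un_disjoint[symmetric]) auto
qed

lemma grassmann_sum_assoc:
  fixes a b c :: "'n::{finite,linorder} set \<Rightarrow> real"
  shows "(\<Sum>J\<in>Pow I. grassmann_sign J (I - J) *
            (\<Sum>L\<in>Pow J. grassmann_sign L (J - L) * a L * b (J - L)) * c (I - J)) =
         (\<Sum>L\<in>Pow I. grassmann_sign L (I - L) * a L *
            (\<Sum>M\<in>Pow (I - L). grassmann_sign M (I - L - M) * b M * c (I - L - M)))"
    (is "?l = ?r")
proof -
  have "?l = (\<Sum>(J, L)\<in>Sigma (Pow I) Pow.
      grassmann_sign J (I - J) * grassmann_sign L (J - L) * a L * b (J - L) * c (I - J))"
    by (subst sum.Sigma[symmetric])
      (auto simp: sum_distrib_left sum_distrib_right algebra_simps intro!: sum.cong)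
  also have "\<dots> = (\<Sum>(L, M)\<in>Sigma (Pow I) (\<lambda>L. Pow (I - L)).
      grassmann_sign L (I - L) * grassmann_sign M (I - L - M) * a L * b M * c (I - L - M))"
  proof (rule sum.reindex_bij_witness[where i = "\<lambda>(L, M). (L \<union> M, L)" and j = "\<lambda>(J, L). (L, J - L)"],
      goal_cases)
    case (5 JL)
    obtain J L where JL: "JL = (J, L)" "L \<subseteq> J" "J \<subseteq> I" using 5 by auto
    have "grassmann_sign J (I - J) = grassmann_sign L (I - J) * grassmann_sign (J - L) (I - J)"
      using grassmann_sign_Un_left[of L "J - L" "I - J"] JL
      by (simp add: Un_absorb1)
    moreover have "grassmann_sign L (I - L) = grassmann_sign L (J - L) * grassmann_sign L (I - J)"
    proof -
      have "I - L = (J - L) \<union> (I - J)" using JL by auto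
      then show ?thesis using grassmann_sign_Un_right[of "J - L" "I - J" L] by auto
    qed
    moreover have "I - L - (J - L) = I - J" using JL by auto
    ultimately show ?case using JL by simp
  qed auto
  also have "\<dots> = ?r"
    by (subst sum.Sigma[symmetric])
      (auto simp: sum_distrib_left sum_distrib_right algebra_simps intro!: sum.cong)
  finally show ?thesis .
qed

instantiation sfun :: ("{finite,linorder}") real_algebra_1
begin

lift_definition zero_sfun :: "'a sfun" is "\<lambda>_ _. 0" by (simp add: smooth_const)

lift_definition one_sfun :: "'a sfun" is "\<lambda>I _. if I = {} then 1 else 0"
  by (simp add: smooth_const)

lift_definition plus_sfun :: "'a sfun \<Rightarrow> 'a sfun \<Rightarrow> 'a sfun" is "\<lambda>F G I x. F I x + G I x"
  by (simp add: smooth_add)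

lift_definition minus_sfun :: "'a sfun \<Rightarrow> 'a sfun \<Rightarrow> 'a sfun" is "\<lambda>F G I x. F I x - G I x"
  by (simp add: smooth_diff)

lift_definition uminus_sfun :: "'a sfun \<Rightarrow> 'a sfun" is "\<lambda>F I x. - F I x"
  by (simp add: smooth_uminus)

lift_definition scaleR_sfun :: "real \<Rightarrow> 'a sfun \<Rightarrow> 'a sfun" is "\<lambda>r F I x. r * F I x"
  by (simp add: smooth_mult smooth_const)

lift_definition times_sfun :: "'a sfun \<Rightarrow> 'a sfun \<Rightarrow> 'a sfun" is
  "\<lambda>F G I x. \<Sum>J\<in>Pow I. grassmann_sign J (I - J) * F J x * G (I - J) x"
  by (intro allI smooth_sum smooth_mult smooth_const) auto

instance
proof
  fix a b c :: "'a sfun" and r s :: real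
  show "a + b + c = a + (b + c)" by transfer (simp add: algebra_simps)
  show "a + b = b + a" by transfer (simp add: algebra_simps)
  show "0 + a = a" by transfer simp
  show "- a + a = 0" by transfer simp
  show "a - b = a + - b" by transfer simp
  show "r *\<^sub>R (a + b) = r *\<^sub>R a + r *\<^sub>R b" by transfer (simp add: algebra_simps)
  show "(r + s) *\<^sub>R a = r *\<^sub>R a + s *\<^sub>R a" by transfer (simp add: algebra_simps)
  show "r *\<^sub>R s *\<^sub>R a = (r * s) *\<^sub>R a" by transfer (simp add: algebra_simps)
  show "1 *\<^sub>R a = a" by transfer simp
  show "a * b * c = a * (b * c)"
    by transfer (intro ext grassmann_sum_assoc)
  show "(a + b) * c = a * c + b * c"
    by transfer (simp add: algebra_simps sum.distrib)
  show "a * (b + c) = a * b + a * c"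
    by transfer (simp add: algebra_simps sum.distrib)
  show "r *\<^sub>R a * b = r *\<^sub>R (a * b)"
    by transfer (simp add: sum_distrib_left mult.assoc mult.left_commute)
  show "a * r *\<^sub>R b = r *\<^sub>R (a * b)"
    by transfer (simp add: sum_distrib_left mult.assoc mult.left_commute)
  show "(0::'a sfun) \<noteq> 1"
    by transfer (auto simp: fun_eq_iff)
  show "1 * a = a"
  proof (transfer, intro ext)
    fix F :: "'a set \<Rightarrow> real \<Rightarrow> real" and I x
    have "(\<Sum>J\<in>Pow I. grassmann_sign J (I - J) * (if J = {} then 1 else 0) * F (I - J) x) =
        (\<Sum>J\<in>{{}}. grassmann_sign J (I - J) * (if J = {} then 1 else 0) * F (I - J) x)"
      by (rule sum.mono_neutral_right) auto
    then show "(\<Sum>J\<in>Pow I. grassmann_sign J (I - J) * (if J = {} then 1 else 0) * F (I - J) x) = F I x"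
      by simp
  qed
  show "a * 1 = a"
  proof (transfer, intro ext)
    fix F :: "'a set \<Rightarrow> real \<Rightarrow> real" and I x
    have "(\<Sum>J\<in>Pow I. grassmann_sign J (I - J) * F J x * (if I - J = {} then 1 else 0)) =
        (\<Sum>J\<in>{I}. grassmann_sign J (I - J) * F J x * (if I - J = {} then 1 else 0))"
      by (rule sum.mono_neutral_right) auto
    then show "(\<Sum>J\<in>Pow I. grassmann_sign J (I - J) * F J x * (if I - J = {} then 1 else 0)) = F I x"
      by simp
  qed
qed

end

lift_definition sf_x :: "'n sfun" is "\<lambda>I x. if I = {} then x else 0"
  by (intro smooth_if smooth_const smooth_ident)

lift_definition sf_theta :: "'n \<Rightarrow> 'n sfun" is "\<lambda>i I x. if I = {i} then 1 else 0"
  by (simp add: smooth_const)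

lift_definition sf_dx :: "'n sfun \<Rightarrow> 'n sfun" is "\<lambda>F I. deriv (F I)"
  by (simp add: smooth_deriv)

text \<open>The left derivative with respect to \<open>\<theta>\<^sub>i\<close>.\<close>

lift_definition sf_dtheta :: "'n::{finite,linorder} \<Rightarrow> 'n sfun \<Rightarrow> 'n sfun" is
  "\<lambda>i F I x. if i \<in> I then 0 else grassmann_sign {i} I * F (insert i I) x"
  by (intro smooth_if smooth_mult smooth_const)

text \<open>
  \<open>sf_part p f\<close> is the component of \<open>f\<close> of parity \<open>p\<close> modulo 2, and \<open>sf_par\<close> is the linear
  extension of \<open>f \<mapsto> (-1)\<^sup>p f\<close> for \<open>f\<close> homogeneous of parity \<open>p\<close>.
\<close>

lift_definition sf_part :: "nat \<Rightarrow> 'n sfun \<Rightarrow> 'n sfun" is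
  "\<lambda>p F I x. if even (card I + p) then F I x else 0"
  by (intro smooth_if smooth_const)

definition sf_par :: "'n::{finite,linorder} sfun \<Rightarrow> 'n sfun" where
  "sf_par f = sf_part 0 f - sf_part 1 f"

definition Dbar :: "'n::{finite,linorder} \<Rightarrow> 'n sfun \<Rightarrow> 'n sfun" where
  "Dbar i f = sf_dtheta i f - sf_theta i * sf_dx f"

definition Dbar_set :: "'n::{finite,linorder} set \<Rightarrow> 'n sfun \<Rightarrow> 'n sfun" where
  "Dbar_set K f = foldr Dbar (sorted_list_of_set K) f"

section \<open>Vector fields\<close>

text \<open>The pair \<open>(f, g)\<close> stands for \<open>f \<partial>\<^sub>x + (\<Sum>i. g\<^sub>i \<partial>\<^bsub>\<theta>\<^sub>i\<^esub>)\<close>.\<close>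

type_synonym 'n vfield = "'n sfun \<times> ('n sfun, 'n) vec"

definition vf_apply :: "'n::{finite,linorder} vfield \<Rightarrow> 'n sfun \<Rightarrow> 'n sfun" where
  "vf_apply X g = fst X * sf_dx g + (\<Sum>i\<in>UNIV. (snd X $ i) * sf_dtheta i g)"

definition vf_div :: "'n::{finite,linorder} vfield \<Rightarrow> 'n sfun" where
  "vf_div X = sf_dx (fst X) + (\<Sum>i\<in>UNIV. sf_dtheta i (sf_par (snd X $ i)))"

definition vf_scale :: "'n::{finite,linorder} sfun \<Rightarrow> 'n vfield \<Rightarrow> 'n vfield" where
  "vf_scale h X = (h * fst X, \<chi> i. h * (snd X $ i))"

definition vf_part :: "nat \<Rightarrow> 'n::{finite,linorder} vfield \<Rightarrow> 'n vfield" where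
  "vf_part p X = (sf_part p (fst X), \<chi> i. sf_part (p + 1) (snd X $ i))"

definition vf_Dbar :: "'n::{finite,linorder} \<Rightarrow> 'n vfield" where
  "vf_Dbar i = (- sf_theta i, axis i 1)"

text \<open>\<open>vf_Dbar i\<close> is \<open>Dbar i\<close> as a vector field; the sign \<open>(-1)\<^sup>p\<close> in \<open>X\<^sub>f\<close> is absorbed in \<open>sf_par f\<close>.\<close>

definition contact_field :: "'n::{finite,linorder} sfun \<Rightarrow> 'n vfield" where
  "contact_field f = (f, 0) - (1/2) *\<^sub>R (\<Sum>i\<in>UNIV. vf_scale (Dbar i (sf_par f)) (vf_Dbar i))"

definition spo_generators :: "'n::{finite,linorder} sfun set" where
  "spo_generators = {1, sf_x, sf_x * sf_x} \<union> range sf_theta \<union> range (\<lambda>i. sf_x * sf_theta i)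
     \<union> {sf_theta i * sf_theta j | i j. i < j}"

definition spo :: "'n::{finite,linorder} vfield set" where
  "spo = span (contact_field ` spo_generators)"

text \<open>\<open>None\<close> is the index of the even coordinate.\<close>

definition coord :: "'n option \<Rightarrow> 'n sfun" where
  "coord j = (case j of None \<Rightarrow> sf_x | Some i \<Rightarrow> sf_theta i)"

definition coord_field :: "'n::{finite,linorder} option \<Rightarrow> 'n vfield" where
  "coord_field j = (case j of None \<Rightarrow> (1, 0) | Some i \<Rightarrow> (0, axis i 1))"

definition euler_field :: "'n::{finite,linorder} vfield" where
  "euler_field = (\<Sum>j\<in>UNIV. vf_scale (coord j) (coord_field j))"

definition pgl :: "'n::{finite,linorder} vfield set" where
  "pgl = span (range coord_field \<union> {vf_scale (coord i) (coord_field j) | i j. True}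
     \<union> range (\<lambda>j. vf_scale (coord j) euler_field))"

section \<open>Densities and differential operators\<close>

text \<open>
  A density is represented by its coefficient, so all the modules of densities have the carrier
  \<open>'n sfun\<close>.  With \<open>m = 1 - n\<close>, the factor below is \<open>2 lam / (m + 1)\<close>.
\<close>

definition dens_action :: "real \<Rightarrow> 'n::{finite,linorder} vfield \<Rightarrow> 'n sfun \<Rightarrow> 'n sfun" where
  "dens_action lam X g = vf_apply X g + (2 * lam / ((1 - real CARD('n)) + 1)) *\<^sub>R (vf_div X * g)"

text \<open>
  For contact fields the action of a general vector field specializes to
  \<open>g \<mapsto> X\<^sub>f(g) + lam f' g\<close>; see \<open>dens_action_contact_field\<close> below.
\<close>

lemma theta_times_coeff:
  "sf_coeff (sf_theta i * h) I x =
     (if i \<in> I then grassmann_sign {i} (I - {i}) * sf_coeff h (I - {i}) x else 0)"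
proof -
  have "(\<Sum>J\<in>Pow I. grassmann_sign J (I - J) * (if J = {i} then 1 else 0) * sf_coeff h (I - J) x)
     = (\<Sum>J\<in>Pow I. if J = {i} then grassmann_sign {i} (I - {i}) * sf_coeff h (I - {i}) x else 0)"
    by (rule sum.cong) auto
  then show ?thesis by (simp add: times_sfun.rep_eq sf_theta.rep_eq)
qed

lemma times_theta_coeff:
  "sf_coeff (h * sf_theta i) I x =
     (if i \<in> I then grassmann_sign (I - {i}) {i} * sf_coeff h (I - {i}) x else 0)"
proof -
  have "(\<Sum>J\<in>Pow I. grassmann_sign J (I - J) * sf_coeff h J x * (if I - J = {i} then 1 else 0))
     = (\<Sum>J\<in>Pow I. if J = I - {i} \<and> i \<in> I then grassmann_sign (I - {i}) {i} * sf_coeff h (I - {i}) x else 0)"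
    by (rule sum.cong) (auto simp: double_diff)
  then show ?thesis by (simp add: times_sfun.rep_eq sf_theta.rep_eq)
qed

lemma grassmann_sign_swap:
  fixes I :: "'n::{finite,linorder} set"
  assumes "i \<notin> I"
  shows "grassmann_sign I {i} = (- 1) ^ card I * grassmann_sign {i} I"
proof -
  have 1: "card {(j, k). j \<in> I \<and> k \<in> {i} \<and> k < j} = card {j\<in>I. i < j}"
    by (rule bij_betw_same_card[where f = fst]) (auto simp: bij_betw_def inj_on_def image_iff)
  have 2: "card {(j, k). j \<in> {i} \<and> k \<in> I \<and> k < j} = card {j\<in>I. j < i}"
    by (rule bij_betw_same_card[where f = snd]) (auto simp: bij_betw_def inj_on_def image_iff)
  have "x \<in> I \<longleftrightarrow> x \<in> {j\<in>I. i < j} \<union> {j\<in>I. j < i}" for x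
    using assms by (cases x i rule: linorder_cases) auto
  then have "I = {j\<in>I. i < j} \<union> {j\<in>I. j < i}" by blast
  then have "card I = card ({j\<in>I. i < j} \<union> {j\<in>I. j < i})"
    by (rule arg_cong)
  also have "\<dots> = card {j\<in>I. i < j} + card {j\<in>I. j < i}"
    by (rule card_Un_disjoint) auto
  finally have "card I = card {j\<in>I. i < j} + card {j\<in>I. j < i}" .
  then show ?thesis unfolding grassmann_sign_def 1 2 by (simp add: power_add)
qed

lemma par_coeff: "sf_coeff (sf_par f) I x = (- 1) ^ card I * sf_coeff f I x"
  by (simp add: sf_par_def minus_sfun.rep_eq sf_part.rep_eq)

lemma sf_eqI: "(\<And>I x. sf_coeff f I x = sf_coeff g I x) \<Longrightarrow> f = g"
  by (simp add: sf_coeff_inject[symmetric] fun_eq_iff)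

lemmas sf_coeff_simps = plus_sfun.rep_eq minus_sfun.rep_eq uminus_sfun.rep_eq scaleR_sfun.rep_eq zero_sfun.rep_eq
  sf_dtheta.rep_eq par_coeff theta_times_coeff times_theta_coeff

lemma times_theta: "h * sf_theta i = sf_theta i * sf_par h"
  by (rule sf_eqI) (simp add: sf_coeff_simps grassmann_sign_swap)

lemma par_par [simp]: "sf_par (sf_par f) = f"
  by (rule sf_eqI) (simp add: sf_coeff_simps flip: mult.assoc power_mult_distrib)

lemma par_dtheta: "sf_par (sf_dtheta i f) = - sf_dtheta i (sf_par f)"
  by (rule sf_eqI) (simp add: sf_coeff_simps)

lemma par_theta: "sf_par (sf_theta i * f) = - (sf_theta i * sf_par f)"
proof (rule sf_eqI)
  fix I x
  have "(- 1 :: real) ^ card I = - ((- 1) ^ card (I - {i}))" if "i \<in> I"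
    using that by (subst card.remove[of I i]) auto
  then show "sf_coeff (sf_par (sf_theta i * f)) I x = sf_coeff (- (sf_theta i * sf_par f)) I x"
    by (simp add: sf_coeff_simps)
qed

lemma dtheta_theta: "sf_dtheta i (sf_theta i * f) = f - sf_theta i * sf_dtheta i f"
  by (rule sf_eqI) (auto simp: sf_coeff_simps grassmann_sign_def insert_absorb simp flip: mult.assoc power_mult_distrib)

lemma dtheta_dtheta: "sf_dtheta i (sf_dtheta i f) = 0"
  by (rule sf_eqI) (auto simp: sf_coeff_simps)

lemma dtheta_lin: "sf_dtheta i (f - g) = sf_dtheta i f - sf_dtheta i g"
  "sf_dtheta i (r *\<^sub>R f) = r *\<^sub>R sf_dtheta i f" "sf_dtheta i (- f) = - sf_dtheta i f"
  by (rule sf_eqI, simp add: sf_coeff_simps algebra_simps)+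

lemma par_lin: "sf_par (f - g) = sf_par f - sf_par g" "sf_par (r *\<^sub>R f) = r *\<^sub>R sf_par f" "sf_par (- f) = - sf_par f"
  by (rule sf_eqI, simp add: sf_coeff_simps algebra_simps)+

lemma sf_coeff_differentiable: "sf_coeff f I field_differentiable at x"
  using sf_coeff smooth_differentiable by auto

lemma dx_lin: "sf_dx (f + g) = sf_dx f + sf_dx g" "sf_dx (r *\<^sub>R f) = r *\<^sub>R sf_dx f"
  by (rule sf_eqI, simp add: sf_dx.rep_eq sf_coeff_simps sf_coeff_differentiable)+

lemma dx_zero: "sf_dx 0 = 0" using dx_lin(2)[of 0 0] by simp

lemma dx_uminus: "sf_dx (- f) = - sf_dx f"
  using dx_lin(2)[of "- 1" f] by simp

lemma dx_sum: "sf_dx (sum f A) = (\<Sum>i\<in>A. sf_dx (f i))"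
  by (induction A rule: infinite_finite_induct) (simp_all add: dx_lin dx_zero)

lemma dx_theta: "sf_dx (sf_theta i * f) = sf_theta i * sf_dx f"
proof -
  have "sf_coeff (sf_theta i * f) I = (\<lambda>x. if i \<in> I then grassmann_sign {i} (I - {i}) * sf_coeff f (I - {i}) x else 0)" for I
    by (simp add: fun_eq_iff theta_times_coeff)
  then show ?thesis
    by (intro sf_eqI) (auto simp: sf_dx.rep_eq theta_times_coeff sf_coeff_differentiable)
qed

lemma dx_dtheta: "sf_dx (sf_dtheta i f) = sf_dtheta i (sf_dx f)"
  by (rule sf_eqI) (auto simp: sf_dx.rep_eq sf_dtheta.rep_eq sf_coeff_differentiable)

lemma par_dx: "sf_par (sf_dx f) = sf_dx (sf_par f)"
proof -
  have "sf_coeff (sf_par f) I = (\<lambda>x. (- 1) ^ card I * sf_coeff f I x)" for I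
    by (simp add: fun_eq_iff par_coeff)
  then show ?thesis
    by (intro sf_eqI) (auto simp: sf_dx.rep_eq par_coeff sf_coeff_differentiable)
qed

lemma theta_theta: "sf_theta i * (sf_theta i * f) = 0"
  by (rule sf_eqI) (auto simp: sf_coeff_simps)

lemma fst_contact: "fst (contact_field f) = f + (1/2) *\<^sub>R (\<Sum>i\<in>UNIV. Dbar i (sf_par f) * sf_theta i)"
  by (simp add: contact_field_def vf_scale_def vf_Dbar_def fst_sum sum_negf)

lemma snd_contact: "snd (contact_field f) $ i = - (1/2) *\<^sub>R Dbar i (sf_par f)"
proof -
  have "(\<Sum>j\<in>UNIV. Dbar j (sf_par f) * (if i = j then 1 else 0)) = (\<Sum>j\<in>UNIV. if i = j then Dbar j (sf_par f) else 0)"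
    by (rule sum.cong) auto
  then show ?thesis
  by (simp add: contact_field_def vf_scale_def vf_Dbar_def snd_sum axis_def)
qed

lemma apply_contact:
  "vf_apply (contact_field f) g
     = f * sf_dx g - (1/2) *\<^sub>R (\<Sum>i\<in>UNIV. Dbar i (sf_par f) * Dbar i g)"
  unfolding vf_apply_def fst_contact snd_contact Dbar_def[of _ g]
  by (simp add: algebra_simps sum_subtractf sum_distrib_left sum_distrib_right scaleR_sum_right
      sum_negf)

lemma par_Dbar_par: "sf_par (Dbar i (sf_par f)) = sf_theta i * sf_dx f - sf_dtheta i f"
  unfolding Dbar_def par_lin par_dtheta par_theta par_dx par_par by simp

lemma div_contact:
  fixes f :: "'n::{finite,linorder} sfun"
  shows "vf_div (contact_field f) = (1 - CARD('n) / 2) *\<^sub>R sf_dx f"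
proof -
  have 1: "sf_dx (Dbar i (sf_par f) * sf_theta i) = - (sf_theta i * sf_dtheta i (sf_dx f))" for i
    unfolding times_theta par_Dbar_par dx_theta right_diff_distrib theta_theta
    by (simp add: dx_uminus dx_theta dx_dtheta)
  have 2: "sf_dtheta i (sf_par (snd (contact_field f) $ i))
      = (1/2) *\<^sub>R (sf_theta i * sf_dtheta i (sf_dx f)) - (1/2) *\<^sub>R sf_dx f" for i
    unfolding snd_contact par_lin par_Dbar_par dtheta_lin dtheta_theta dtheta_dtheta
    by (simp add: algebra_simps)
  show ?thesis
    unfolding vf_div_def 2 fst_contact dx_lin dx_sum 1 sum_subtractf sum_negf
    by (simp add: scaleR_sum_right[symmetric] scaleR_left_diff_distrib sum_constant_scaleR
        del: sum_constant)
qed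

lemma dens_action_contact_field:
  fixes f g :: "'n::{finite,linorder} sfun"
  assumes "CARD('n) \<noteq> 2"
  shows "dens_action lam (contact_field f) g = f * sf_dx g
    - (1/2) *\<^sub>R (\<Sum>i\<in>UNIV. Dbar i (sf_par f) * Dbar i g) + lam *\<^sub>R (sf_dx f * g)"
proof -
  define c where "c = 1 - real CARD('n) / 2"
  have "c \<noteq> 0" using assms by (simp add: c_def)
  moreover have "(1 - real CARD('n)) + 1 = 2 * c" by (simp add: c_def)
  ultimately have "2 * lam / ((1 - real CARD('n)) + 1) * (1 - CARD('n) / 2) = lam"
    by (simp add: c_def[symmetric])
  then show ?thesis
    unfolding dens_action_def apply_contact div_contact mult_scaleR_left scaleR_scaleR by simp
qed

definition op_part :: "nat \<Rightarrow> ('n::{finite,linorder} sfun \<Rightarrow> 'n sfun) \<Rightarrow> 'n sfun \<Rightarrow> 'n sfun" where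
  "op_part q D g = (\<Sum>p\<in>{0,1}. sf_part (p + q) (D (sf_part p g)))"

text \<open>
  The bilinear extension to inhomogeneous \<open>X\<close> and \<open>D\<close> of the supercommutator formula for the
  action of \<open>X\<close> on \<open>D\<close>.
\<close>

definition op_action ::
  "real \<Rightarrow> real \<Rightarrow> 'n::{finite,linorder} vfield \<Rightarrow> ('n sfun \<Rightarrow> 'n sfun) \<Rightarrow> 'n sfun \<Rightarrow> 'n sfun" where
  "op_action lam mu X D g = dens_action mu X (D g)
     - (\<Sum>p\<in>{0,1}. \<Sum>q\<in>{0,1}. (-1) ^ (p * q) *\<^sub>R op_part q D (dens_action lam (vf_part p X) g))"

section \<open>Symbols\<close>

text \<open>
  A polynomial \<open>\<Sum> A\<^bsub>cK\<^esub> \<alpha>\<^sup>\<delta> \<zeta>\<^sup>c \<gamma>\<^sup>K\<close> is represented by its coefficients \<open>A\<^bsub>cK\<^esub>\<close>, with \<open>K\<close> encoded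
  as a set of indices.  This is the carrier of both spaces of symbols, for every weight.
\<close>

type_synonym 'n symb = "(nat \<times> 'n set) \<Rightarrow>\<^sub>0 'n sfun"

instantiation poly_mapping :: (type, real_vector) real_vector
begin

lift_definition scaleR_poly_mapping :: "real \<Rightarrow> ('a \<Rightarrow>\<^sub>0 'b) \<Rightarrow> 'a \<Rightarrow>\<^sub>0 'b" is "\<lambda>r f k. r *\<^sub>R f k"
  by (erule rev_finite_subset) auto

instance
  by standard (transfer; simp add: fun_eq_iff algebra_simps)+

end

definition diffop :: "'n::{finite,linorder} symb \<Rightarrow> 'n sfun \<Rightarrow> 'n sfun" where
  "diffop S g =
     (\<Sum>(c, K)\<in>Poly_Mapping.keys S. Poly_Mapping.lookup S (c, K) * (sf_dx ^^ c) (Dbar_set K g))"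

definition diffops :: "('n::{finite,linorder} sfun \<Rightarrow> 'n sfun) set" where
  "diffops = range diffop"

definition coefficients :: "('n::{finite,linorder} sfun \<Rightarrow> 'n sfun) \<Rightarrow> 'n symb" where
  "coefficients D = (THE S. diffop S = D)"

definition half_nats :: "real set" where
  "half_nats = {real j / 2 | j :: nat. True}"

definition order_weight :: "nat \<times> 'n set \<Rightarrow> real" where
  "order_weight = (\<lambda>(c, K). real c + real (card K))"

definition heis_weight :: "nat \<times> 'n set \<Rightarrow> real" where
  "heis_weight = (\<lambda>(c, K). real c + real (card K) / 2)"

text \<open>
  The filtrations by the order and by the Heisenberg order are treated uniformly: \<open>w\<close> is the
  weight of the monomials.
\<close>

definition op_filtration ::
  "(nat \<times> 'n set \<Rightarrow> real) \<Rightarrow> real \<Rightarrow> ('n::{finite,linorder} sfun \<Rightarrow> 'n sfun) set" where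
  "op_filtration w d = {diffop S | S. \<forall>v\<in>Poly_Mapping.keys S. w v \<le> d}"

definition homogeneous_symbols ::
  "(nat \<times> 'n set \<Rightarrow> real) \<Rightarrow> real \<Rightarrow> 'n::{finite,linorder} symb set" where
  "homogeneous_symbols w d = {S. \<forall>v\<in>Poly_Mapping.keys S. w v = d}"

definition symb_restrict :: "(nat \<times> 'n set) set \<Rightarrow> 'n::{finite,linorder} symb \<Rightarrow> 'n symb" where
  "symb_restrict V S = (\<Sum>v\<in>Poly_Mapping.keys S \<inter> V. Poly_Mapping.single v (Poly_Mapping.lookup S v))"

definition principal_symbol ::
  "(nat \<times> 'n set \<Rightarrow> real) \<Rightarrow> real \<Rightarrow> ('n::{finite,linorder} sfun \<Rightarrow> 'n sfun) \<Rightarrow> 'n symb" where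
  "principal_symbol w d D = symb_restrict {v. w v = d} (coefficients D)"

text \<open>
  The action induced on the graded space: the component of degree \<open>d\<close> is lifted to an operator of
  weight at most \<open>d\<close>, acted upon, and projected back to degree \<open>d\<close>.  It depends on \<open>lam\<close> and \<open>mu\<close>
  only through \<open>mu - lam\<close>.
\<close>

definition symb_action ::
  "(nat \<times> 'n set \<Rightarrow> real) \<Rightarrow> real \<Rightarrow> real \<Rightarrow> 'n::{finite,linorder} vfield \<Rightarrow> 'n symb \<Rightarrow> 'n symb" where
  "symb_action w lam mu X S = (\<Sum>d\<in>w ` Poly_Mapping.keys S.
     principal_symbol w d (op_action lam mu X (diffop (symb_restrict {v. w v = d} S))))"

section \<open>Quantizations\<close>

text \<open>Linearity is stated pointwise, since operators are plain functions.\<close>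

definition pgl_quantization ::
  "real \<Rightarrow> real \<Rightarrow> ('n::{finite,linorder} symb \<Rightarrow> 'n sfun \<Rightarrow> 'n sfun) \<Rightarrow> bool" where
  "pgl_quantization lam mu Q \<longleftrightarrow>
     (\<forall>g. linear (\<lambda>S. Q S g)) \<and>
     range Q \<subseteq> diffops \<and>
     (\<forall>k::nat. \<forall>S\<in>homogeneous_symbols order_weight (real k).
        Q S \<in> op_filtration order_weight (real k) \<and>
        principal_symbol order_weight (real k) (Q S) = S) \<and>
     (\<forall>X\<in>pgl. \<forall>S. op_action lam mu X (Q S) = Q (symb_action order_weight lam mu X S))"

definition Q_sl :: "real \<Rightarrow> real \<Rightarrow> 'n::{finite,linorder} symb \<Rightarrow> 'n sfun \<Rightarrow> 'n sfun" where
  "Q_sl lam mu = (THE Q. pgl_quantization lam mu Q)"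

definition fine_quantization ::
  "real \<Rightarrow> real \<Rightarrow> ('n::{finite,linorder} symb \<Rightarrow> 'n sfun \<Rightarrow> 'n sfun) \<Rightarrow> bool" where
  "fine_quantization lam mu Q \<longleftrightarrow>
     (\<forall>g. linear (\<lambda>S. Q S g)) \<and>
     bij_betw Q UNIV diffops \<and>
     (\<forall>d\<in>half_nats. \<forall>S\<in>homogeneous_symbols heis_weight d.
        Q S \<in> op_filtration heis_weight d \<and>
        principal_symbol heis_weight d (Q S) = S) \<and>
     (\<forall>X\<in>spo. \<forall>S. op_action lam mu X (Q S) = Q (symb_action heis_weight lam mu X S))"

text \<open>Multiplication by \<open>\<gamma>\<^sub>i\<close> from the left; moving it past the coefficient produces \<open>sf_par\<close>.\<close>

definition gamma_mult :: "'n::{finite,linorder} \<Rightarrow> 'n symb \<Rightarrow> 'n symb" where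
  "gamma_mult i S = (\<Sum>(c, K)\<in>Poly_Mapping.keys S. if i \<in> K then 0 else
     Poly_Mapping.single (c, insert i K) (grassmann_sign {i} K *\<^sub>R sf_par (Poly_Mapping.lookup S (c, K))))"

definition symb_Dbar :: "'n::{finite,linorder} \<Rightarrow> 'n symb \<Rightarrow> 'n symb" where
  "symb_Dbar i S = (\<Sum>v\<in>Poly_Mapping.keys S. Poly_Mapping.single v (Dbar i (Poly_Mapping.lookup S v)))"

definition symb_dzeta :: "'n::{finite,linorder} symb \<Rightarrow> 'n symb" where
  "symb_dzeta S = (\<Sum>(c, K)\<in>Poly_Mapping.keys S.
     Poly_Mapping.single (c - 1, K) (real c *\<^sub>R Poly_Mapping.lookup S (c, K)))"

definition Delta :: "'n::{finite,linorder} symb \<Rightarrow> 'n symb" where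
  "Delta S = (\<Sum>i\<in>UNIV. gamma_mult i (symb_Dbar i (symb_dzeta S)))"

text \<open>
  The sum over \<open>a\<close> is finite because \<open>Delta\<close> lowers the degree in \<open>\<zeta>\<close>; \<^const>\<open>Sum_any\<close> is the sum of
  a family of finite support.
\<close>

definition SQ :: "real \<Rightarrow> 'n::{finite,linorder} symb \<Rightarrow> 'n symb" where
  "SQ \<delta> S = (\<Sum>c\<in>fst ` Poly_Mapping.keys S. Sum_any (\<lambda>a.
     (1 / (2 ^ a * fact a) * (\<Prod>j<a. 1 / (real c - \<delta> - real j / 2))) *\<^sub>R
       (Delta ^^ a) (symb_restrict {v. fst v = c} S)))"

section \<open>Exceptional values\<close>

definition I_delta :: "real set" where
  "I_delta = (\<Union>d::nat. {(2 * real_of_int c - real_of_int j) / 2 | c j :: int.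
     0 \<le> j \<and> j \<le> 2 * int d - 1 \<and> 0 \<le> c \<and> c \<le> int d})"

definition C_pgl :: "real \<Rightarrow> real set" where
  "C_pgl m = (\<Union>k::nat. {(2 * real k - real i + m) / 2 | i :: nat. i \<in> {1..k}})"

definition C_delta_crit :: "real \<Rightarrow> real set" where
  "C_delta_crit m =
     {((real k - real k') * (2 * (real k + real k') + m - 1) - 4 * (real k * d - real k' * d')
        + 2 * (d - d') * (2 * d + 2 * d' + 1)) / (4 * (d - d'))
      | (k::nat) (k'::nat) d d'. d \<in> half_nats \<and> d' \<in> half_nats \<and>
          d' \<le> real k' \<and> real k' \<le> 2 * d' \<and> d' < d \<and> d \<le> real k \<and> real k \<le> 2 * d}"

end

theory Submission
  imports Defs
begin

text \<open>
  Both quantizations are recovered from quadratic Casimir operators acting on differential operators.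
  The Casimir of \<open>gl(2|n)\<close> is triangular for the filtration by the order, that of \<open>spo(2|n)\<close> for the
  filtration by the Heisenberg order, with an explicit scalar on each monomial
  \<open>\<partial>\<^sub>x\<^sup>c D\<^sup>K\<close>. The hypotheses \<open>\<delta> \<notin> C_pgl m\<close> and \<open>\<delta> \<notin> C_delta_crit m\<close> say that the scalars belonging to
  different degrees differ. An equivariant quantization has to send a monomial symbol to the
  unique eigenvector of the Casimir with the given principal part; this yields uniqueness, and
  conversely the map to the eigenvectors is equivariant because the Casimir is central.

  Modulo lower order the \<open>spo(2|n)\<close> Casimir acts on symbols as a scalar plus \<open>4 \<Delta>\<close>. The coefficients of
  \<open>SQ\<close> are the ones which turn a monomial into an eigenvector of this operator (here
  \<open>\<delta> \<notin> I_delta\<close> avoids zero denominators), and \<open>Q_sl\<close> commutes with both Casimirs, so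
  \<open>Q_sl \<circ> SQ\<close> is the eigenvector map of the \<open>spo(2|n)\<close> Casimir.
\<close>

section \<open>The ring of linear operators\<close>

text \<open>\<open>Q_sl\<close> is a definite description, so its existence has to be proved as
  well. It comes from a Lagrange polynomial in the \<open>gl(2|n)\<close> Casimir: such a polynomial
  commutes with whatever commutes with the Casimir, \<open>spo_casimir\<close> included, so
  equivariance needs no separate computation.

  Two obstacles shape the setting. The Casimirs are sums over all pairs of generators; in
  homogeneous coordinates every generator is a coordinate times a derivative, and Euler's identity
  contracts these sums. Signs depend on the parity of operators that need not be homogeneous;
  conjugation by the parity operator takes the place of the sign.

  Only leading terms of the Casimirs are computed. The rest stays an unspecified element of a
  filtration, since triangularity is enough for uniqueness and for equivariance.

  \<open>endo\<close> is again a \<open>real_algebra_1\<close>, so the construction can be iterated: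
  operators lie in \<open>sfun endo\<close>, actions on operators and Casimirs in
  \<open>sfun endo endo\<close>, and both levels are handled by ring identities.\<close>

typedef (overloaded) 'a endo = "{f :: 'a::real_algebra_1 \<Rightarrow> 'a. linear f}"
  morphisms app Endo
  by (rule exI[of _ "\<lambda>x. x"]) (simp add: linear_iff)

setup_lifting type_definition_endo

instantiation endo :: (real_algebra_1) real_algebra_1
begin

lift_definition zero_endo :: "'a endo" is "\<lambda>_. 0" by (simp add: linear_iff)
lift_definition one_endo :: "'a endo" is "\<lambda>x. x" by (simp add: linear_iff)
lift_definition plus_endo :: "'a endo \<Rightarrow> 'a endo \<Rightarrow> 'a endo" is "\<lambda>f g x. f x + g x"
  by (simp add: linear_iff algebra_simps)
lift_definition minus_endo :: "'a endo \<Rightarrow> 'a endo \<Rightarrow> 'a endo" is "\<lambda>f g x. f x - g x"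
  by (simp add: linear_iff algebra_simps)
lift_definition uminus_endo :: "'a endo \<Rightarrow> 'a endo" is "\<lambda>f x. - f x"
  by (simp add: linear_iff algebra_simps)
lift_definition scaleR_endo :: "real \<Rightarrow> 'a endo \<Rightarrow> 'a endo" is "\<lambda>r f x. r *\<^sub>R f x"
  by (simp add: linear_iff algebra_simps)
lift_definition times_endo :: "'a endo \<Rightarrow> 'a endo \<Rightarrow> 'a endo" is "\<lambda>f g x. f (g x)"
  by (simp add: linear_iff)

instance
proof
  fix a b c :: "'a endo" and r s :: real
  have lin: "linear (app a)" for a :: "'a endo" using app by auto
  show "(0::'a endo) \<noteq> 1"
  proof
    assume "(0::'a endo) = 1"
    then have "app 0 (1::'a) = app 1 1" by simp
    then show False by transfer simp
  qed
  show "a * (b + c) = a * b + a * c" "a * r *\<^sub>R b = r *\<^sub>R (a * b)"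
    by (transfer, simp add: linear_iff)+
qed (transfer; simp add: algebra_simps fun_eq_iff)+

end

lemma app_simps [simp]:
  "app 0 x = 0" "app 1 x = x" "app (f + g) x = app f x + app g x"
  "app (f - g) x = app f x - app g x" "app (- f) x = - app f x"
  "app (r *\<^sub>R f) x = r *\<^sub>R app f x" "app (f * g) x = app f (app g x)"
  by (transfer, simp)+

lemma linear_app: "linear (app f)" using app by auto

lemma app_Endo: "linear f \<Longrightarrow> app (Endo f) = f" by (simp add: Endo_inverse)

lemma endo_eqI: "(\<And>x. app f x = app g x) \<Longrightarrow> f = g"
  by (metis app_inject ext)

lemma app_arg [simp]:
  "app f 0 = 0" "app f (x + y) = app f x + app f y" "app f (x - y) = app f x - app f y"
  "app f (- x) = - app f x" "app f (r *\<^sub>R x) = r *\<^sub>R app f x"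
  using linear_app[of f]
  by (simp_all add: linear_0 linear_add linear_diff linear_neg linear_cmul)

lemma app_arg_sum: "app f (sum g A) = (\<Sum>x\<in>A. app f (g x))"
  by (rule linear_sum[OF linear_app])

lemma app_sum: "app (sum f A) x = (\<Sum>a\<in>A. app (f a) x)"
  by (induction A rule: infinite_finite_induct) auto

section \<open>Multiplications and derivations of superfunctions\<close>

lemma sf_dx_mult: "sf_dx (f * g) = sf_dx f * g + f * sf_dx g"
proof (rule sf_eqI)
  fix I :: "'a set" and x
  have "sf_coeff (f * g) I =
      (\<lambda>x. \<Sum>J\<in>Pow I. grassmann_sign J (I - J) * sf_coeff f J x * sf_coeff g (I - J) x)"
    by (rule ext) (simp add: times_sfun.rep_eq)
  moreover have "((\<lambda>x. \<Sum>J\<in>Pow I. grassmann_sign J (I - J) * sf_coeff f J x * sf_coeff g (I - J) x)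
      has_field_derivative (\<Sum>J\<in>Pow I. grassmann_sign J (I - J) * deriv (sf_coeff f J) x * sf_coeff g (I - J) x
        + grassmann_sign J (I - J) * sf_coeff f J x * deriv (sf_coeff g (I - J)) x)) (at x)"
    by (rule derivative_eq_intros refl
        DERIV_deriv_iff_field_differentiable[THEN iffD2] sf_coeff_differentiable)+
       (simp add: algebra_simps)
  ultimately show "sf_coeff (sf_dx (f * g)) I x = sf_coeff (sf_dx f * g + f * sf_dx g) I x"
    by (simp add: sf_dx.rep_eq plus_sfun.rep_eq times_sfun.rep_eq sum.distrib DERIV_imp_deriv)
qed

lemma sf_par_mult: "sf_par (f * g) = sf_par f * sf_par g"
proof (rule sf_eqI)
  fix I :: "'a set" and x
  have "(- 1) ^ card I = (- 1 :: real) ^ card J * (- 1) ^ card (I - J)" if "J \<subseteq> I" for J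
    using that
    by (simp add: card_Diff_subset finite_subset power_add[symmetric] card_mono)
  then show "sf_coeff (sf_par (f * g)) I x = sf_coeff (sf_par f * sf_par g) I x"
    by (auto simp: par_coeff times_sfun.rep_eq sum_distrib_left intro!: sum.cong)
qed

lemma grassmann_sign_sq [simp]: "grassmann_sign J K * grassmann_sign J K = 1"
  by (simp add: grassmann_sign_def power_mult_distrib[symmetric])

lemma grassmann_sign_sq_left: "grassmann_sign J K * (grassmann_sign J K * z) = z"
  by (simp add: mult.assoc[symmetric])

lemma sf_dtheta_mult: "sf_dtheta i (f * g) = sf_dtheta i f * g + sf_par f * sf_dtheta i g"
proof (rule sf_eqI)
  fix I :: "'a set" and x
  show "sf_coeff (sf_dtheta i (f * g)) I x =
    sf_coeff (sf_dtheta i f * g + sf_par f * sf_dtheta i g) I x"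
  proof (cases "i \<in> I")
    case True
    \<comment> \<open>As \<open>i\<close> lies in \<open>I\<close>, the left side is 0 and the two
      terms on the right have to cancel. Adding \<open>i\<close> to \<open>J\<close> matches the
      summands of the first with those of the second, with opposite sign.\<close>
    have "(\<Sum>J\<in>Pow I. grassmann_sign J (I - J) * (if i \<in> J then 0 else
            grassmann_sign {i} J * sf_coeff f (insert i J) x) * sf_coeff g (I - J) x)
        = (\<Sum>J\<in>{J \<in> Pow I. i \<notin> J}. grassmann_sign J (I - J) * 
            grassmann_sign {i} J * sf_coeff f (insert i J) x * sf_coeff g (I - J) x)"
      by (subst sum.inter_filter) (auto intro!: sum.cong)
    also have "\<dots> = (\<Sum>J\<in>{J \<in> Pow I. i \<in> J}. grassmann_sign (J - {i}) (I - (J - {i})) * 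
            grassmann_sign {i} (J - {i}) * sf_coeff f J x * sf_coeff g (I - (J - {i})) x)"
      by (rule sum.reindex_bij_witness[where i = "\<lambda>J. J - {i}" and j = "insert i"])
        (use True in \<open>auto simp: insert_absorb\<close>)
    also have "\<dots> = (\<Sum>J\<in>{J \<in> Pow I. i \<in> J}. - (grassmann_sign J (I - J) * (- 1) ^ card J *
            sf_coeff f J x * (grassmann_sign {i} (I - J) * sf_coeff g (insert i (I - J)) x)))"
    proof (rule sum.cong[OF refl], goal_cases)
      case (1 J)
      then have J: "J \<subseteq> I" "i \<in> J" by auto
      define L where "L = J - {i}"
      define M where "M = I - J"
      have e: "I - L = insert i M" "J = insert i L" "i \<notin> L" "i \<notin> M" "L \<inter> M = {}"
        using J True by (auto simp: L_def M_def)
      have s1: "grassmann_sign L (insert i M) = grassmann_sign L {i} * grassmann_sign L M"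
        using grassmann_sign_Un_right[of "{i}" M L] e by simp
      have s2: "grassmann_sign (insert i L) M = grassmann_sign {i} M * grassmann_sign L M"
        using grassmann_sign_Un_left[of "{i}" L M] e by simp
      have c: "card J = Suc (card L)" using e by simp
      have "grassmann_sign L (insert i M) * grassmann_sign {i} L
        = - (grassmann_sign J M * (- 1) ^ card J * grassmann_sign {i} M)"
        unfolding s1 e(2) s2 grassmann_sign_swap[OF e(3)]
        using grassmann_sign_sq[of "{i}" L] grassmann_sign_sq[of "{i}" M] e(3)
        by simp
      then show ?case
        unfolding L_def[symmetric] M_def[symmetric] e(1) by (simp add: mult_ac)
    qed
    also have "\<dots> = - (\<Sum>J\<in>Pow I. grassmann_sign J (I - J) * ((- 1) ^ card J * sf_coeff f J x) *
        (if i \<in> I - J then 0 else grassmann_sign {i} (I - J) * sf_coeff g (insert i (I - J)) x))"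
      unfolding sum_negf using True
      by (subst sum.inter_filter) (auto intro!: sum.cong arg_cong[where f = uminus])
    finally show ?thesis using True
      by (simp add: sf_coeff_simps times_sfun.rep_eq)
  next
    case False
    \<comment> \<open>Subsets of \<open>insert i I\<close> that avoid \<open>i\<close> carry the
      derivative of \<open>g\<close>, those that contain \<open>i\<close> the derivative of
      \<open>f\<close>.\<close>
    have *: "Pow (insert i I) = Pow I \<union> insert i ` Pow I" by (simp add: Pow_insert)
    have inj: "inj_on (insert i) (Pow I)" using False by (auto simp: inj_on_def)
    have d: "Pow I \<inter> insert i ` Pow I = {}" using False by auto
    have "grassmann_sign {i} I * (\<Sum>J\<in>Pow (insert i I). grassmann_sign J (insert i I - J) * sf_coeff f J x *
        sf_coeff g (insert i I - J) x) =
      (\<Sum>J\<in>Pow I. grassmann_sign {i} I * grassmann_sign J (insert i I - J) * sf_coeff f J x *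
        sf_coeff g (insert i I - J) x) +
      (\<Sum>J\<in>Pow I. grassmann_sign {i} I * grassmann_sign (insert i J) (insert i I - insert i J) * sf_coeff f (insert i J) x *
        sf_coeff g (insert i I - insert i J) x)"
      unfolding * by (subst sum.union_disjoint) (use d in \<open>auto simp: sum.reindex[OF inj] sum_distrib_left algebra_simps\<close>)
    also have "(\<Sum>J\<in>Pow I. grassmann_sign {i} I * grassmann_sign J (insert i I - J) * sf_coeff f J x *
        sf_coeff g (insert i I - J) x) =
      (\<Sum>J\<in>Pow I. grassmann_sign J (I - J) * ((- 1) ^ card J * sf_coeff f J x) *
        (grassmann_sign {i} (I - J) * sf_coeff g (insert i (I - J)) x))"
    proof (rule sum.cong[OF refl], goal_cases)
      case (1 J)
      have e: "insert i I - J = insert i (I - J)" "i \<notin> J" using 1 False by auto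
      have "J \<union> (I - J) = I" using 1 by auto
      then have s1: "grassmann_sign {i} I = grassmann_sign {i} J * grassmann_sign {i} (I - J)"
        using grassmann_sign_Un_right[of J "I - J" "{i}"] by simp
      have s2: "grassmann_sign J (insert i (I - J)) = grassmann_sign J {i} * grassmann_sign J (I - J)"
        using grassmann_sign_Un_right[of "{i}" "I - J" J] False by simp
      show ?case unfolding e(1) s1 s2 grassmann_sign_swap[OF e(2)]
        by (simp add: mult_ac grassmann_sign_sq_left)
    qed
    also have "(\<Sum>J\<in>Pow I. grassmann_sign {i} I * grassmann_sign (insert i J) (insert i I - insert i J) * sf_coeff f (insert i J) x *
        sf_coeff g (insert i I - insert i J) x) =
      (\<Sum>J\<in>Pow I. grassmann_sign J (I - J) * (grassmann_sign {i} J * sf_coeff f (insert i J) x) * sf_coeff g (I - J) x)"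
    proof (rule sum.cong[OF refl], goal_cases)
      case (1 J)
      have e: "insert i I - insert i J = I - J" "i \<notin> J" using 1 False by auto
      have "J \<union> (I - J) = I" using 1 by auto
      then have s1: "grassmann_sign {i} I = grassmann_sign {i} J * grassmann_sign {i} (I - J)"
        using grassmann_sign_Un_right[of J "I - J" "{i}"] by simp
      have s2: "grassmann_sign (insert i J) (I - J) = grassmann_sign {i} (I - J) * grassmann_sign J (I - J)"
        using grassmann_sign_Un_left[of "{i}" J "I - J"] e by simp
      show ?case unfolding e(1) s1 s2
        by (simp add: mult_ac grassmann_sign_sq_left)
    qed
    also have "(\<Sum>J\<in>Pow I. grassmann_sign J (I - J) * ((- 1) ^ card J * sf_coeff f J x) *
        (grassmann_sign {i} (I - J) * sf_coeff g (insert i (I - J)) x)) =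
       (\<Sum>J\<in>Pow I. grassmann_sign J (I - J) * ((- 1) ^ card J * sf_coeff f J x) *
        (if i \<in> I - J then 0 else grassmann_sign {i} (I - J) * sf_coeff g (insert i (I - J)) x))"
      by (rule sum.cong) (use False in auto)
    also have "(\<Sum>J\<in>Pow I. grassmann_sign J (I - J) * (grassmann_sign {i} J * sf_coeff f (insert i J) x) * sf_coeff g (I - J) x)
       = (\<Sum>J\<in>Pow I. grassmann_sign J (I - J) * (if i \<in> J then 0 else grassmann_sign {i} J * sf_coeff f (insert i J) x) * sf_coeff g (I - J) x)"
      by (rule sum.cong) (use False in auto)
    finally show ?thesis using False
      by (simp add: sf_coeff_simps times_sfun.rep_eq)
  qed
qed

lemma sf_dtheta_add: "sf_dtheta i (f + g) = sf_dtheta i f + sf_dtheta i g"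
  using dtheta_lin(1)[of i f "- g"] dtheta_lin(3)[of i g] by simp

lemma sf_par_add: "sf_par (f + g) = sf_par f + sf_par g"
  by (rule sf_eqI) (simp add: sf_coeff_simps algebra_simps)

definition fm :: "'n::{finite,linorder} sfun \<Rightarrow> 'n sfun endo" where
  "fm f = Endo (\<lambda>g. f * g)"
definition dX :: "'n::{finite,linorder} sfun endo" where
  "dX = Endo sf_dx"
definition dT :: "'n::{finite,linorder} \<Rightarrow> 'n sfun endo" where
  "dT i = Endo (sf_dtheta i)"
definition PP :: "'n::{finite,linorder} sfun endo" where
  "PP = Endo sf_par"

abbreviation th :: "'n::{finite,linorder} \<Rightarrow> 'n sfun endo" where "th i \<equiv> fm (sf_theta i)"
abbreviation xx :: "'n::{finite,linorder} sfun endo" where "xx \<equiv> fm sf_x"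

definition dB :: "'n::{finite,linorder} \<Rightarrow> 'n sfun endo" where
  "dB i = dT i - th i * dX"

lemma app_fm [simp]: "app (fm f) g = f * g"
  unfolding fm_def by (subst app_Endo) (simp_all add: linear_iff algebra_simps)
lemma app_dX [simp]: "app dX g = sf_dx g"
  unfolding dX_def by (subst app_Endo) (simp_all add: linear_iff dx_lin)
lemma app_dT [simp]: "app (dT i) g = sf_dtheta i g"
  unfolding dT_def by (subst app_Endo) (simp_all add: linear_iff dtheta_lin sf_dtheta_add)
lemma app_PP [simp]: "app PP g = sf_par g"
  unfolding PP_def by (subst app_Endo) (simp_all add: linear_iff par_lin sf_par_add)
lemma app_dB [simp]: "app (dB i) g = Dbar i g" by (simp add: dB_def Dbar_def)

lemma fm_hom: "fm (f * g) = fm f * fm g" "fm (f + g) = fm f + fm g" "fm (f - g) = fm f - fm g"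
  "fm (- f) = - fm f" "fm (r *\<^sub>R f) = r *\<^sub>R fm f" "fm 1 = 1" "fm 0 = 0"
  by (rule endo_eqI; simp add: algebra_simps)+

lemma fm_sum: "fm (sum f A) = (\<Sum>a\<in>A. fm (f a))"
  by (induction A rule: infinite_finite_induct) (auto simp: fm_hom)

lemma Dbar_mult: "Dbar i (f * g) = Dbar i f * g + sf_par f * Dbar i g"
proof -
  have "sf_par f * sf_theta i = sf_theta i * f" using times_theta[of "sf_par f" i] by simp
  then have "sf_par f * (sf_theta i * h) = sf_theta i * (f * h)" for h
    by (simp add: mult.assoc[symmetric])
  then show ?thesis
    by (simp add: Dbar_def sf_dtheta_mult sf_dx_mult distrib_left left_diff_distrib right_diff_distrib
        mult.assoc)
qed

lemma PP_PP: "PP * PP = 1" by (rule endo_eqI) simp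
lemma PP_fm: "PP * fm f = fm (sf_par f) * PP" by (rule endo_eqI) (simp add: sf_par_mult)
lemma PP_dX: "PP * dX = dX * PP" by (rule endo_eqI) (simp add: par_dx)
lemma PP_dT: "PP * dT i = - (dT i * PP)" by (rule endo_eqI) (simp add: par_dtheta)
lemma dX_fm: "dX * fm f = fm f * dX + fm (sf_dx f)"
  by (rule endo_eqI) (simp add: sf_dx_mult algebra_simps)
lemma dT_fm: "dT i * fm f = fm (sf_par f) * dT i + fm (sf_dtheta i f)"
  by (rule endo_eqI) (simp add: sf_dtheta_mult algebra_simps)
lemma dB_fm: "dB i * fm f = fm (sf_par f) * dB i + fm (Dbar i f)"
  by (rule endo_eqI) (simp add: Dbar_mult algebra_simps)
lemma dX_dT: "dX * dT i = dT i * dX" by (rule endo_eqI) (simp add: dx_dtheta)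

lemma sf_one_coeff: "sf_coeff 1 I = (\<lambda>x. if I = {} then 1 else 0)"
  by (rule ext) (simp add: one_sfun.rep_eq)

lemma sf_dx_simps [simp]: "sf_dx 1 = (0 :: 'n::{finite,linorder} sfun)"
  "sf_dx sf_x = (1 :: 'n sfun)" "sf_dx (sf_theta i) = (0 :: 'n sfun)"
proof -
  show 1: "sf_dx 1 = (0 :: 'n sfun)"
    by (rule sf_eqI) (simp add: sf_dx.rep_eq sf_one_coeff zero_sfun.rep_eq)
  show "sf_dx sf_x = (1 :: 'n sfun)"
  proof (rule sf_eqI)
    fix I :: "'n set" and x
    have "sf_coeff sf_x I = (\<lambda>x. if I = {} then x else 0)"
      by (rule ext) (simp add: sf_x.rep_eq)
    then show "sf_coeff (sf_dx sf_x) I x = sf_coeff 1 I x"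
      by (cases "I = {}") (simp_all add: sf_dx.rep_eq sf_one_coeff)
  qed
  show "sf_dx (sf_theta i) = (0 :: 'n sfun)" using dx_theta[of i 1] 1 by simp
qed

lemma sf_par_simps [simp]: "sf_par 1 = 1" "sf_par sf_x = sf_x" "sf_par (sf_theta i) = - sf_theta i"
  by (rule sf_eqI, simp add: sf_coeff_simps one_sfun.rep_eq sf_x.rep_eq sf_theta.rep_eq)+

lemma sf_dtheta_simps [simp]: "sf_dtheta i 1 = 0" "sf_dtheta i sf_x = 0"
  "sf_dtheta i (sf_theta j) = (if i = j then 1 else 0)"
  by (rule sf_eqI, auto simp: sf_coeff_simps one_sfun.rep_eq sf_x.rep_eq sf_theta.rep_eq
      insert_eq_iff grassmann_sign_def)+

lemma Dbar_simps [simp]: "Dbar i 1 = 0" "Dbar i sf_x = - sf_theta i"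
  "Dbar i (sf_theta j) = (if i = j then 1 else 0)"
  by (auto simp: Dbar_def)

lemma sf_x_central: "f * sf_x = sf_x * f"
proof (rule sf_eqI)
  fix I :: "'a set" and x
  have 1: "(\<Sum>J\<in>Pow I. grassmann_sign J (I - J) * (if J = {} then x else 0) * sf_coeff f (I - J) x)
     = (\<Sum>J\<in>{{}}. grassmann_sign J (I - J) * (if J = {} then x else 0) * sf_coeff f (I - J) x)"
    by (rule sum.mono_neutral_right) auto
  have 2: "(\<Sum>J\<in>Pow I. grassmann_sign J (I - J) * sf_coeff f J x * (if I - J = {} then x else 0))
     = (\<Sum>J\<in>{I}. grassmann_sign J (I - J) * sf_coeff f J x * (if I - J = {} then x else 0))"
    by (rule sum.mono_neutral_right) auto
  show "sf_coeff (f * sf_x) I x = sf_coeff (sf_x * f) I x"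
    using 1 2 by (simp add: times_sfun.rep_eq sf_x.rep_eq)
qed

lemma xx_fm: "xx * fm f = fm f * xx" by (simp add: fm_hom[symmetric] sf_x_central)
lemma fm_th: "fm f * th i = th i * fm (sf_par f)"
  by (simp add: fm_hom[symmetric] times_theta)
lemma th_th: "th i * th j = - (th j * th i)" using fm_th[of "sf_theta i" j] by (simp add: fm_hom)
lemma th_sq: "th i * th i = 0" using theta_theta[of i 1] by (simp add: fm_hom[symmetric])

lemma dT_th: "dT i * th j = (if i = j then 1 else 0) - th j * dT i"
  by (simp add: dT_fm fm_hom)
lemma dX_th: "dX * th j = th j * dX" by (simp add: dX_fm fm_hom)
lemma dX_xx: "dX * xx = xx * dX + 1" by (simp add: dX_fm fm_hom)
lemma dT_xx: "dT i * xx = xx * dT i" by (simp add: dT_fm fm_hom)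
lemma PP_th: "PP * th i = - (th i * PP)" by (simp add: PP_fm fm_hom)
lemma dT_dT: "dT i * dT j = - (dT j * dT i)"
proof (cases "i = j")
  case True
  then show ?thesis by (intro endo_eqI) (simp add: dtheta_dtheta)
next
  case False
  show ?thesis
  proof (intro endo_eqI sf_eqI)
    fix f I x
    have e: "insert i (insert j I) = insert j (insert i I)" by auto
    have s: "grassmann_sign {a} (insert b I) = grassmann_sign {a} {b} * grassmann_sign {a} I"
      if "b \<notin> I" for a b :: 'a
      using grassmann_sign_Un_right[of "{b}" I "{a}"] that by simp
    have "grassmann_sign {i} {j} = - grassmann_sign {j} {i}"
      using grassmann_sign_swap[of i "{j}"] False by simp
    then show "sf_coeff (app (dT i * dT j) f) I x = sf_coeff (app (- (dT j * dT i)) f) I x"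
      using False by (simp add: sf_coeff_simps e s)
  qed
qed

lemma PP_dB: "PP * dB i = - (dB i * PP)"
proof -
  have "PP * (th i * dX) = - (th i * dX * PP)"
    unfolding mult.assoc[symmetric] PP_th mult_minus_left by (simp add: mult.assoc PP_dX)
  then show ?thesis by (simp add: dB_def right_diff_distrib left_diff_distrib PP_dT)
qed

lemma dX_dB: "dX * dB i = dB i * dX"
proof -
  have "dX * (th i * dX) = th i * dX * dX" by (simp add: mult.assoc[symmetric] dX_th)
  then show ?thesis by (simp add: dB_def right_diff_distrib left_diff_distrib dX_dT)
qed

text \<open>In the expansion \<open>e\<close> every term is antisymmetric in \<open>i\<close> and
  \<open>j\<close> except the one in which \<open>dT i\<close> hits \<open>th j\<close>; it is
  doubled. That \<open>dB i\<close> is thus a square root of \<open>- dX\<close> is the reason for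
  giving it half the weight of \<open>dX\<close>.\<close>

lemma dB_dB: "dB i * dB j = - (dB j * dB i) - (if i = j then 2 *\<^sub>R dX else 0)"
proof -
  have 1: "dT i * (th j * dX) = (if i = j then dX else 0) - th j * dT i * dX" for i j :: 'a
    by (simp add: mult.assoc[symmetric] dT_th left_diff_distrib)
  have 2: "th i * dX * dT j = th i * dT j * dX" for i j :: 'a
    by (simp add: mult.assoc dX_dT)
  have 3: "th i * dX * (th j * dX) = th i * th j * dX * dX" for i j :: 'a
  proof -
    have "th i * dX * (th j * dX) = th i * (dX * th j) * dX" by (simp only: mult.assoc)
    then show ?thesis by (simp only: dX_th mult.assoc)
  qed
  have e: "dB i * dB j = dT i * dT j - (if i = j then dX else 0) + th j * dT i * dX - th i * dT j * dX
      + th i * th j * dX * dX" for i j :: 'a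
    unfolding dB_def left_diff_distrib right_diff_distrib 1 2 3 by (simp add: algebra_simps)
  show ?thesis
    unfolding e[of i j] e[of j i] dT_dT[of i j] th_th[of i j]
    by (cases "i = j") (simp_all add: scaleR_2)
qed

lemma dB_sq: "dB i * dB i = - dX"
proof -
  have "dB i * dB i = - (dB i * dB i + 2 *\<^sub>R dX)"
    using dB_dB[of i i] by (simp only: if_True simp_thms minus_add_distrib diff_conv_add_uminus)
  then have "dB i * dB i + (dB i * dB i + 2 *\<^sub>R dX) = 0"
    by (simp only: eq_neg_iff_add_eq_0)
  moreover have "2 *\<^sub>R (dB i * dB i + dX) = dB i * dB i + (dB i * dB i + 2 *\<^sub>R dX)"
    by (simp add: scaleR_2 ac_simps)
  ultimately have "2 *\<^sub>R (dB i * dB i + dX) = 0" by (rule trans[rotated])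
  then have "dB i * dB i + dX = 0" by simp
  then show ?thesis by (rule eq_neg_iff_add_eq_0[THEN iffD2])
qed

lemma dB_th: "dB i * th j = (if i = j then 1 else 0) - th j * dB i"
  by (simp add: dB_fm fm_hom)
lemma dB_xx: "dB i * xx = xx * dB i - th i" by (simp add: dB_fm fm_hom)

section \<open>The general linear superalgebra in homogeneous coordinates\<close>

text \<open>
  \<open>gl(2|n)\<close> acts on functions of \<open>y\<^sub>0, x, \<theta>\<^sub>i\<close> homogeneous of degree \<open>- l\<close>, with \<open>l = 2 \<lambda>\<close>, restricted to
  \<open>y\<^sub>0 = 1\<close>. The index \<open>None\<close> stands for \<open>y\<^sub>0\<close>, \<open>Some None\<close> for \<open>x\<close> and \<open>Some (Some i)\<close> for \<open>\<theta>\<^sub>i\<close>;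
  \<open>yy a\<close> and \<open>pp l a\<close> are the multiplication by and the derivative along the \<open>a\<close>-th coordinate.
\<close>

type_synonym 'n idx = "'n option option"

definition od :: "'n idx \<Rightarrow> bool" where
  "od a \<longleftrightarrow> (\<exists>i. a = Some (Some i))"

definition sg :: "'n idx \<Rightarrow> 'n idx \<Rightarrow> real" where
  "sg a b = (if od a \<and> od b then - 1 else 1)"

definition yy :: "'n::{finite,linorder} idx \<Rightarrow> 'n sfun endo" where
  "yy a = (case a of None \<Rightarrow> 1 | Some None \<Rightarrow> xx | Some (Some i) \<Rightarrow> th i)"

definition Eu :: "'n::{finite,linorder} sfun endo" where
  "Eu = xx * dX + (\<Sum>i\<in>UNIV. th i * dT i)"

text \<open>The value at \<open>None\<close> is Euler's identity for degree \<open>- l\<close>,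
  solved for the derivative along \<open>y\<^sub>0\<close> and restricted to
  \<open>y\<^sub>0 = 1\<close>; see \<open>sum_yy_pp\<close>.\<close>

definition pp :: "real \<Rightarrow> 'n::{finite,linorder} idx \<Rightarrow> 'n sfun endo" where
  "pp l a = (case a of None \<Rightarrow> - (Eu + l *\<^sub>R 1) | Some None \<Rightarrow> dX | Some (Some i) \<Rightarrow> dT i)"

text \<open>Conjugation by parity multiplies an even operator by 1 and an odd one by -1. It
  therefore expresses the Koszul sign of passing an odd factor across \<open>D\<close> for every
  \<open>D\<close>, homogeneous or not.\<close>

definition cj :: "bool \<Rightarrow> 'n::{finite,linorder} sfun endo \<Rightarrow> 'n sfun endo" where
  "cj p D = (if p then PP * D * PP else D)"

abbreviation tw :: "'n::{finite,linorder} idx \<Rightarrow> 'n sfun endo \<Rightarrow> 'n sfun endo" where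
  "tw a \<equiv> cj (od a)"

lemma od_simps [simp]: "\<not> od None" "\<not> od (Some None)" "od (Some (Some i))"
  by (auto simp: od_def)

lemma sg_None [simp]: "sg None a = 1" "sg a None = 1" "sg (Some None) a = 1" "sg a (Some None) = 1"
  by (auto simp: sg_def)

lemma sg_odd [simp]: "sg (Some (Some i)) (Some (Some j)) = - 1"
  by (auto simp: sg_def)

lemma sg_commute: "sg a b = sg b a" by (auto simp: sg_def)

lemma sg_sg [simp]: "sg a b * sg a b = 1" "sg a b * (sg a b * r) = r" by (auto simp: sg_def)

lemma sum_option: "sum g (UNIV :: 'n::finite option set) = g None + (\<Sum>i\<in>UNIV. g (Some i))"
  by (simp add: UNIV_option_conv sum.reindex)

lemma sum_idx: "sum f (UNIV :: 'n::finite idx set) = f None + f (Some None) + (\<Sum>i\<in>UNIV. f (Some (Some i)))"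
  by (simp add: sum_option add.assoc)

lemma idx_cases: obtains "a = None" | "a = Some None" | i where "a = Some (Some i)"
  by (metis not_Some_eq)

lemma PP_PP_left: "PP * (PP * D) = D" by (simp add: mult.assoc[symmetric] PP_PP)

lemma cj_simps:
  "cj p (D * E) = cj p D * cj p E" "cj p (D + E) = cj p D + cj p E" "cj p (D - E) = cj p D - cj p E"
  "cj p (- D) = - cj p D" "cj p (r *\<^sub>R D) = r *\<^sub>R cj p D" "cj p 1 = 1" "cj p 0 = 0"
  "cj p (cj q D) = cj (p \<noteq> q) D" "cj False D = D"
  by (auto simp: cj_def mult.assoc PP_PP_left PP_PP algebra_simps)

lemma cj_sum: "cj p (sum f A) = (\<Sum>a\<in>A. cj p (f a))"
  by (induction A rule: infinite_finite_induct) (auto simp: cj_simps)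

lemma cj_fm: "cj p (fm f) = fm (if p then sf_par f else f)"
  by (simp add: cj_def PP_fm mult.assoc PP_PP)
lemma cj_dX [simp]: "cj p dX = dX" by (simp add: cj_def PP_dX mult.assoc PP_PP)
lemma cj_xx [simp]: "cj p xx = xx" by (simp add: cj_fm)
lemma cj_th [simp]: "cj p (th i) = (if p then - th i else th i)" by (simp add: cj_fm fm_hom)
lemma cj_dT [simp]: "cj p (dT i) = (if p then - dT i else dT i)"
  by (simp add: cj_def PP_dT mult.assoc PP_PP)
lemma cj_dB [simp]: "cj p (dB i) = (if p then - dB i else dB i)"
  by (simp add: cj_def PP_dB mult.assoc PP_PP)
lemma cj_Eu [simp]: "cj p Eu = Eu"
  by (cases p) (simp_all add: Eu_def cj_simps cj_sum)

lemma cj_yy: "cj p (yy b) = (if p \<and> od b then - 1 else 1) *\<^sub>R yy b"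
  by (cases b rule: idx_cases) (auto simp: yy_def sg_def cj_simps)

lemma cj_pp: "cj p (pp l b) = (if p \<and> od b then - 1 else 1) *\<^sub>R pp l b"
  by (cases b rule: idx_cases) (auto simp: pp_def sg_def cj_simps)

lemma th_xx: "th i * xx = xx * th i" using xx_fm[of "sf_theta i"] by simp

lemma Eu_th: "Eu * th j = th j * Eu + th j"
proof -
  have 1: "th i * dT i * th j = (if i = j then th j else 0) + th j * (th i * dT i)" for i :: 'a
  proof -
    have "th i * dT i * th j = th i * (if i = j then 1 else 0) - th i * th j * dT i"
      by (simp add: mult.assoc dT_th right_diff_distrib)
    then show ?thesis unfolding th_th[of i j] by (auto simp: mult.assoc)
  qed
  have 2: "xx * dX * th j = th j * (xx * dX)"
    by (simp add: mult.assoc dX_th) (simp add: mult.assoc[symmetric] th_xx)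
  show ?thesis
    unfolding Eu_def distrib_right distrib_left sum_distrib_left sum_distrib_right 1 2
    by (simp add: sum.distrib)
qed

lemma Eu_xx: "Eu * xx = xx * Eu + xx"
proof -
  have 1: "th i * dT i * xx = xx * (th i * dT i)" for i :: 'a
    by (simp add: mult.assoc dT_xx) (simp add: mult.assoc[symmetric] th_xx)
  have 2: "xx * dX * xx = xx * (xx * dX) + xx"
    by (simp add: mult.assoc dX_xx distrib_left)
  show ?thesis
    unfolding Eu_def distrib_right distrib_left sum_distrib_left sum_distrib_right 1 2
    by simp
qed

lemma Eu_dX: "Eu * dX = dX * Eu - dX"
proof -
  have 1: "th i * dT i * dX = dX * (th i * dT i)" for i :: 'a
    by (simp add: mult.assoc[symmetric] dX_th) (simp add: mult.assoc dX_dT)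
  have 2: "xx * dX * dX = dX * (xx * dX) - dX"
    by (simp add: mult.assoc[symmetric] dX_xx distrib_right)
  show ?thesis
    unfolding Eu_def distrib_right distrib_left sum_distrib_left sum_distrib_right 1 2
    by simp
qed

lemma Eu_dT: "Eu * dT j = dT j * Eu - dT j"
proof -
  have 1: "dT j * (th i * dT i) = (if i = j then dT j else 0) + th i * dT i * dT j" for i :: 'a
  proof -
    have "dT j * (th i * dT i) = (if i = j then 1 else 0) * dT i - th i * (dT j * dT i)"
      by (auto simp add: mult.assoc[symmetric] dT_th left_diff_distrib)
    then show ?thesis unfolding dT_dT[of j i] by (auto simp: mult.assoc)
  qed
  have 2: "dT j * (xx * dX) = xx * dX * dT j"
    by (simp add: mult.assoc[symmetric] dT_xx) (simp add: mult.assoc dX_dT)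
  show ?thesis
    unfolding Eu_def distrib_right distrib_left sum_distrib_left sum_distrib_right 1 2
    by (simp add: sum.distrib)
qed

lemma yy_yy: "yy a * yy b = sg a b *\<^sub>R (yy b * yy a)"
  by (cases a rule: idx_cases; cases b rule: idx_cases) (auto simp: yy_def th_xx intro: th_th)

text \<open>The last term arises because a coordinate changes the degree of homogeneity by one,
  whereas the same \<open>l\<close> is used before and after it. Only \<open>pp l None\<close>
  depends on \<open>l\<close>.\<close>

lemma pp_yy: "pp l a * yy b = sg a b *\<^sub>R (yy b * pp l a) + (if a = b then 1 else 0)
    - (if a = None then yy b else 0)"
  by (cases a rule: idx_cases; cases b rule: idx_cases)
    (auto simp: yy_def pp_def Eu_th Eu_xx dX_th dX_xx dT_th dT_xx algebra_simps)

lemma pp_pp: "pp l a * pp l b = sg a b *\<^sub>R (pp l b * pp l a) + (if a = None then pp l b else 0)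
    - (if b = None then pp l a else 0)"
  by (cases a rule: idx_cases; cases b rule: idx_cases)
    (auto simp: yy_def pp_def Eu_dX Eu_dT dX_dT algebra_simps intro: dT_dT)

lemma sum_yy_pp: "(\<Sum>a\<in>UNIV. yy a * pp l a) = - (l *\<^sub>R 1)"
  by (simp add: sum_idx yy_def pp_def Eu_def)

definition EE :: "real \<Rightarrow> 'n::{finite,linorder} idx \<Rightarrow> 'n idx \<Rightarrow> 'n sfun endo" where
  "EE l a b = yy a * pp l b"

definition sgp :: "'n idx \<Rightarrow> 'n idx \<Rightarrow> 'n idx \<Rightarrow> 'n idx \<Rightarrow> real" where
  "sgp a b c d = (if od a \<noteq> od b \<and> od c \<noteq> od d then - 1 else 1)"

text \<open>The relations of the matrix units of \<open>gl(2|n)\<close>. Each \<open>EE\<close>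
  preserves the degree of homogeneity, so the corrections at \<open>None\<close> from
  \<open>pp_yy\<close> and \<open>pp_pp\<close> cancel in the supercommutator.\<close>

lemma EE_EE: "EE l k r * EE l i j = sgp k r i j *\<^sub>R (EE l i j * EE l k r)
   + (if r = i then EE l k j else 0) - sgp k r i j *\<^sub>R (if j = k then EE l i r else 0)"
proof -
  have *: "EE l k r * EE l i j = sg r i *\<^sub>R (yy k * yy i * (pp l r * pp l j)) + (if r = i then EE l k j else 0)
      - (if r = None then yy k * yy i * pp l j else 0)" for k r i j :: "'a idx"
  proof -
    have "EE l k r * EE l i j = yy k * (pp l r * yy i) * pp l j" by (simp add: EE_def mult.assoc)
    also have "\<dots> = sg r i *\<^sub>R (yy k * yy i * (pp l r * pp l j)) + (if r = i then EE l k j else 0)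
      - (if r = None then yy k * yy i * pp l j else 0)"
      unfolding pp_yy left_diff_distrib right_diff_distrib distrib_left distrib_right
      by (simp add: EE_def mult.assoc)
    finally show ?thesis .
  qed
  show ?thesis
    unfolding *[of k r i j] *[of i j k r] yy_yy[of i k] pp_pp[of l j r]
    by (cases r; cases j; cases "od i"; cases "od k"; cases "od j"; cases "od r")
      (simp_all add: sg_def sgp_def algebra_simps split del: if_split)
qed

lemma tw_EE: "tw a (tw b (EE l c d)) = sgp a b c d *\<^sub>R EE l c d"
  by (cases "od a"; cases "od b"; cases "od c"; cases "od d")
   (simp_all add: EE_def cj_simps cj_yy cj_pp sgp_def)

section \<open>Action of fields on operators, and centrality of quadratic expressions\<close>

definition AD :: "bool \<Rightarrow> 'n::{finite,linorder} sfun endo \<Rightarrow> 'n sfun endo \<Rightarrow> 'n sfun endo endo" where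
  "AD p X' X = Endo (\<lambda>D. X' * D - cj p D * X)"

lemma app_AD [simp]: "app (AD p X' X) D = X' * D - cj p D * X"
  unfolding AD_def by (subst app_Endo) (simp_all add: linear_iff cj_simps algebra_simps)

lemma AD_add: "AD p (X' + Y') (X + Y) = AD p X' X + AD p Y' Y"
  by (rule endo_eqI) (simp add: algebra_simps)
lemma AD_diff: "AD p (X' - Y') (X - Y) = AD p X' X - AD p Y' Y"
  by (rule endo_eqI) (simp add: algebra_simps)
lemma AD_scaleR: "AD p (r *\<^sub>R X') (r *\<^sub>R X) = r *\<^sub>R AD p X' X"
  by (rule endo_eqI) (simp add: algebra_simps)
lemma AD_zero: "AD p 0 0 = 0"
  by (rule endo_eqI) simp

text \<open>A super Jacobi identity for operators between two modules, \<open>X'\<close> and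
  \<open>Y'\<close> acting on the target, \<open>X\<close> and \<open>Y\<close> on the source. The
  sign \<open>s\<close> is given by its effect under conjugation, so that the parity of
  \<open>D\<close> never enters.\<close>

lemma AD_AD:
  assumes "cj p Y = s *\<^sub>R Y" "cj p Y' = s *\<^sub>R Y'" "cj q X = s *\<^sub>R X" "cj q X' = s *\<^sub>R X'" "s * s = 1"
  shows "AD p X' X * AD q Y' Y = s *\<^sub>R (AD q Y' Y * AD p X' X)
    + AD (p \<noteq> q) (X' * Y' - s *\<^sub>R (Y' * X')) (X * Y - s *\<^sub>R (Y * X))"
proof (rule endo_eqI)
  fix D
  have [simp]: "s * (s * r) = r" for r using assms(5) by (simp add: mult.assoc[symmetric])
  have "(p \<noteq> q) = (q \<noteq> p)" by blast
  then show "app (AD p X' X * AD q Y' Y) D = app (s *\<^sub>R (AD q Y' Y * AD p X' X)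
    + AD (p \<noteq> q) (X' * Y' - s *\<^sub>R (Y' * X')) (X * Y - s *\<^sub>R (Y * X))) D"
    using assms(5) by (simp add: cj_simps assms(1-4) algebra_simps)
qed

definition ee :: "real \<Rightarrow> real \<Rightarrow> 'n::{finite,linorder} idx \<Rightarrow> 'n idx \<Rightarrow> 'n sfun endo endo" where
  "ee l l' a b = AD (od a \<noteq> od b) (EE l' a b) (EE l a b)"

lemma cj_EE: "cj (od a \<noteq> od b) (EE l c d) = sgp a b c d *\<^sub>R EE l c d"
  using tw_EE[of a b l c d] by (simp add: cj_simps)

lemma sgp_sgp [simp]: "sgp a b c d * sgp a b c d = 1" by (simp add: sgp_def)
lemma sgp_commute: "sgp a b c d = sgp c d a b" by (auto simp: sgp_def)

text \<open>The supercommutator of the matrix units \<open>(k, r)\<close> and \<open>(i, j)\<close>,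
  read in an arbitrary family \<open>M\<close>. This freedom is needed because the orthosymplectic
  generators obey a relation made of two such terms, \<open>mm_mm\<close>.\<close>

definition delta_comm :: "('n idx \<Rightarrow> 'n idx \<Rightarrow> 'r::real_algebra) \<Rightarrow> 'n idx \<Rightarrow> 'n idx \<Rightarrow> 'n idx \<Rightarrow> 'n idx \<Rightarrow> 'r" where
  "delta_comm M k r i j = (if r = i then M k j else 0) - sgp k r i j *\<^sub>R (if j = k then M i r else 0)"

lemma ee_ee: "ee l l' k r * ee l l' i j = sgp k r i j *\<^sub>R (ee l l' i j * ee l l' k r)
   + delta_comm (ee l l') k r i j"
proof -
  have "ee l l' k r * ee l l' i j = sgp k r i j *\<^sub>R (ee l l' i j * ee l l' k r)
    + AD ((od k \<noteq> od r) \<noteq> (od i \<noteq> od j)) (EE l' k r * EE l' i j - sgp k r i j *\<^sub>R (EE l' i j * EE l' k r))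
       (EE l k r * EE l i j - sgp k r i j *\<^sub>R (EE l i j * EE l k r))"
    unfolding ee_def by (rule AD_AD) (simp_all only: cj_EE sgp_sgp sgp_commute[of i j k r])
  also have "AD ((od k \<noteq> od r) \<noteq> (od i \<noteq> od j)) (EE l' k r * EE l' i j - sgp k r i j *\<^sub>R (EE l' i j * EE l' k r))
       (EE l k r * EE l i j - sgp k r i j *\<^sub>R (EE l i j * EE l k r)) =
     AD ((od k \<noteq> od r) \<noteq> (od i \<noteq> od j))
       ((if r = i then EE l' k j else 0) - sgp k r i j *\<^sub>R (if j = k then EE l' i r else 0))
       ((if r = i then EE l k j else 0) - sgp k r i j *\<^sub>R (if j = k then EE l i r else 0))"
    unfolding EE_EE[of _ k r i j] by simp
  also have "\<dots> = delta_comm (ee l l') k r i j"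
    unfolding delta_comm_def AD_diff AD_scaleR ee_def
    by (cases "od i"; cases "od j"; cases "od k"; cases "od r"; cases "r = i"; cases "j = k") (simp_all add: AD_zero)
  finally show ?thesis .
qed

text \<open>The sum is the variation of a supertrace of the square of \<open>M\<close>. Of the four
  contractions, \<open>1\<close> cancels \<open>4\<close> directly and \<open>2\<close> cancels
  \<open>3\<close> by the sign identity \<open>5\<close>.\<close>

lemma casimir_central_aux:
  fixes M :: "'n::finite idx \<Rightarrow> 'n idx \<Rightarrow> 'r::real_algebra"
  shows "(\<Sum>i\<in>UNIV. \<Sum>j\<in>UNIV. sg j j *\<^sub>R (delta_comm M k r i j * M j i
    + sgp k r i j *\<^sub>R (M i j * delta_comm M k r j i))) = 0"
proof -
  have 1: "(\<Sum>i\<in>UNIV. \<Sum>j\<in>UNIV. sg j j *\<^sub>R ((if r = i then M k j else 0) * M j i))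
      = (\<Sum>j\<in>UNIV. sg j j *\<^sub>R (M k j * M j r))"
    by (subst sum.swap) (simp add: if_distrib[of "\<lambda>x. x * _"] if_distrib[of "scaleR _"] cong: if_cong)
  have 2: "(\<Sum>i\<in>UNIV. \<Sum>j\<in>UNIV. sg j j *\<^sub>R (sgp k r i j *\<^sub>R (if j = k then M i r else 0) * M j i))
      = (\<Sum>i\<in>UNIV. (sg k k * sgp k r i k) *\<^sub>R (M i r * M k i))"
    by (simp add: if_distrib[of "\<lambda>x. x * _"] if_distrib[of "scaleR _"] cong: if_cong)
  have 3: "(\<Sum>i\<in>UNIV. \<Sum>j\<in>UNIV. sg j j *\<^sub>R (sgp k r i j *\<^sub>R (M i j * (if r = j then M k i else 0))))
      = (\<Sum>i\<in>UNIV. (sg r r * sgp k r i r) *\<^sub>R (M i r * M k i))"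
    by (simp add: if_distrib[of "\<lambda>x. _ * x"] if_distrib[of "scaleR _"] cong: if_cong)
  have 4: "(\<Sum>i\<in>UNIV. \<Sum>j\<in>UNIV. sg j j *\<^sub>R (sgp k r i j *\<^sub>R (M i j * (sgp k r j i *\<^sub>R (if i = k then M j r else 0)))))
      = (\<Sum>j\<in>UNIV. sg j j *\<^sub>R (M k j * M j r))"
  proof -
    have "sgp k r k j * sgp k r j k = 1" for j by (auto simp: sgp_def)
    then show ?thesis
      by (subst sum.swap) (simp add: if_distrib[of "\<lambda>x. _ * x"] if_distrib[of "scaleR _"] mult.assoc cong: if_cong)
  qed
  have 5: "sg k k * sgp k r i k = sg r r * sgp k r i r" for i
    by (auto simp: sg_def sgp_def)
  show ?thesis
    unfolding delta_comm_def left_diff_distrib right_diff_distrib scaleR_add_right scaleR_diff_right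
      sum.distrib sum_subtractf mult_scaleR_left
    using 1 2 3 4 5 by (simp add: mult_scaleR_left)
qed

text \<open>Passing \<open>K\<close> across \<open>M i j\<close> and then \<open>M j i\<close> costs
  the same sign twice, so no sign is left and only the commutator terms \<open>T\<close> have to
  cancel.\<close>

lemma casimir_central:
  fixes M :: "'n::finite idx \<Rightarrow> 'n idx \<Rightarrow> 'r::real_algebra"
  assumes K: "\<And>i j. K * M i j = sgp k r i j *\<^sub>R (M i j * K) + T i j"
    and T: "(\<Sum>i\<in>UNIV. \<Sum>j\<in>UNIV. sg j j *\<^sub>R (T i j * M j i + sgp k r i j *\<^sub>R (M i j * T j i))) = 0"
  shows "K * (\<Sum>i\<in>UNIV. \<Sum>j\<in>UNIV. sg j j *\<^sub>R (M i j * M j i))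
       = (\<Sum>i\<in>UNIV. \<Sum>j\<in>UNIV. sg j j *\<^sub>R (M i j * M j i)) * K"
proof -
  have s: "sgp k r j i = sgp k r i j" for i j by (auto simp: sgp_def)
  have "K * (M i j * M j i) = M i j * M j i * K + (T i j * M j i + sgp k r i j *\<^sub>R (M i j * T j i))" for i j
    by (simp add: mult.assoc[symmetric] K) (simp add: mult.assoc K s algebra_simps)
  then have "K * (\<Sum>i\<in>UNIV. \<Sum>j\<in>UNIV. sg j j *\<^sub>R (M i j * M j i))
     = (\<Sum>i\<in>UNIV. \<Sum>j\<in>UNIV. sg j j *\<^sub>R (M i j * M j i * K))
       + (\<Sum>i\<in>UNIV. \<Sum>j\<in>UNIV. sg j j *\<^sub>R (T i j * M j i + sgp k r i j *\<^sub>R (M i j * T j i)))"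
    by (simp add: sum_distrib_left sum.distrib[symmetric] scaleR_add_right[symmetric])
  then show ?thesis by (simp add: T sum_distrib_right)
qed

section \<open>The Casimir operators\<close>

text \<open>
  The contact structure comes from the supersymplectic form pairing \<open>y\<^sub>0\<close> with \<open>x\<close> and each \<open>\<theta>\<^sub>i\<close> with
  itself; \<open>os\<close> and \<open>om\<close> give the dual index and the sign of the pairing, and the \<open>mm\<close> span the image of
  \<open>spo(2|n)\<close>.
\<close>

definition os :: "'n idx \<Rightarrow> 'n idx" where
  "os a = (case a of None \<Rightarrow> Some None | Some None \<Rightarrow> None | Some (Some i) \<Rightarrow> Some (Some i))"

definition om :: "'n idx \<Rightarrow> real" where
  "om a = (if a = Some None then - 1 else 1)"

lemma os_simps [simp]: "os None = Some None" "os (Some None) = None" "os (Some (Some i)) = Some (Some i)"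
  by (simp_all add: os_def)

lemma om_simps [simp]: "om None = 1" "om (Some None) = - 1" "om (Some (Some i)) = 1"
  by (simp_all add: om_def)

lemma os_os [simp]: "os (os a) = a" by (cases a rule: idx_cases) simp_all
lemma od_os [simp]: "od (os a) = od a" by (cases a rule: idx_cases) simp_all
lemma sg_os [simp]: "sg (os a) b = sg a b" "sg a (os b) = sg a b" by (auto simp: sg_def)
lemma sgp_os [simp]: "sgp (os a) b c d = sgp a b c d" "sgp a (os b) c d = sgp a b c d"
  "sgp a b (os c) d = sgp a b c d" "sgp a b c (os d) = sgp a b c d" by (auto simp: sgp_def)
lemma sgp_swap: "sgp a b c d = sgp b a c d" by (auto simp: sgp_def)

text \<open>The sign that makes the combination in \<open>mm\<close> a contact field:
  \<open>mm a (os b)\<close> has, up to a factor, the contact Hamiltonian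
  \<open>ys a * ys b\<close>; see \<open>EEf_mm\<close> and \<open>lie_endo_contact\<close>.\<close>

definition cc :: "'n idx \<Rightarrow> 'n idx \<Rightarrow> real" where
  "cc i j = sg i j * om (os j) * om i"

lemma cc_rules:
  "cc k r * cc r j = - (sgp k r r j * cc k j)"
  "cc k r * cc i k = - (sgp k r i k * cc i r)"
  "cc i (os r) = - (cc k r * (sgp k r i r * cc i (os k)))"
  "cc k r * cc (os r) j = - (sgp k r k j * cc (os k) j)"
  by (cases k rule: idx_cases; cases r rule: idx_cases; cases j rule: idx_cases; cases i rule: idx_cases;
      simp add: cc_def sgp_def)+

definition mm :: "real \<Rightarrow> real \<Rightarrow> 'n::{finite,linorder} idx \<Rightarrow> 'n idx \<Rightarrow> 'n sfun endo endo" where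
  "mm l l' i j = ee l l' i j + cc i j *\<^sub>R ee l l' (os j) (os i)"

text \<open>Each of the two halves of \<open>mm l l' k r\<close> acts on the whole family
  \<open>mm\<close> by the rule for matrix units. Keeping the result as two
  \<open>delta_comm\<close> terms allows \<open>casimir_central_aux\<close> to be applied to each of
  them.\<close>

lemma mm_mm: "mm l l' k r * mm l l' i j = sgp k r i j *\<^sub>R (mm l l' i j * mm l l' k r)
   + (delta_comm (mm l l') k r i j + cc k r *\<^sub>R delta_comm (mm l l') (os r) (os k) i j)"
proof -
  let ?e = "ee l l'"
  let ?d = "delta_comm ?e"
  have s: "sgp r k i j = sgp k r i j" "sgp k r j i = sgp k r i j" "sgp r k j i = sgp k r i j" for k r i j :: "'a idx"
    by (auto simp: sgp_def)
  have 1: "mm l l' k r * mm l l' i j = sgp k r i j *\<^sub>R (mm l l' i j * mm l l' k r) +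
     (?d k r i j + cc i j *\<^sub>R ?d k r (os j) (os i) + cc k r *\<^sub>R ?d (os r) (os k) i j
      + (cc k r * cc i j) *\<^sub>R ?d (os r) (os k) (os j) (os i))"
    unfolding mm_def
    apply (simp only: distrib_left distrib_right mult_scaleR_left mult_scaleR_right ee_ee[of l l' k r] ee_ee[of l l' "os r" "os k"])
    apply (simp add: algebra_simps s sgp_swap[of r k])
    done
  \<comment> \<open>Facts \<open>2\<close> to \<open>5\<close> turn the contractions over dual
    indices into the second halves of the \<open>mm\<close> on the right side; the signs are those
    of \<open>cc_rules\<close>.\<close>
  have 2: "(cc k r * cc i j) *\<^sub>R (sgp k r i j *\<^sub>R (if i = r then X else 0)) = - (if r = i then cc k j *\<^sub>R X else 0)"
    for X :: "'a sfun endo endo"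
    using cc_rules(1)[of k r j] by auto
  have 3: "(cc k r * cc i j) *\<^sub>R (if k = j then X else 0) = - (sgp k r i j *\<^sub>R (if j = k then cc i r *\<^sub>R X else 0))"
    for X :: "'a sfun endo endo"
    using cc_rules(2)[of k r i] by auto
  have 4: "cc i j *\<^sub>R (if r = os j then X else 0) = - (cc k r *\<^sub>R (sgp k r i j *\<^sub>R (if j = os r then cc i (os k) *\<^sub>R X else 0)))"
    for X :: "'a sfun endo endo"
    using cc_rules(3)[of i r k] by (auto simp: mult.assoc)
  have 5: "cc i j *\<^sub>R (sgp k r i j *\<^sub>R (if os i = k then X else 0)) = - (cc k r *\<^sub>R (if os k = i then cc (os r) j *\<^sub>R X else 0))"
    for X :: "'a sfun endo endo"
    using cc_rules(4)[of k r j] by (auto simp: mult.commute)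
  have "?d k r i j + cc i j *\<^sub>R ?d k r (os j) (os i) + cc k r *\<^sub>R ?d (os r) (os k) i j
      + (cc k r * cc i j) *\<^sub>R ?d (os r) (os k) (os j) (os i)
    = delta_comm (mm l l') k r i j + cc k r *\<^sub>R delta_comm (mm l l') (os r) (os k) i j"
  proof -
    have i: "(if b then x + y else 0) = (if b then x else 0) + (if b then y else (0::'a sfun endo endo))" for b x y by simp
    have s': "sgp k r (os j) (os i) = sgp k r i j" "sgp (os r) (os k) i j = sgp k r i j" "sgp (os r) (os k) (os j) (os i) = sgp k r i j"
      by (auto simp: sgp_def)
    have q: "(os i = os r) = (i = r)" "(os k = os j) = (k = j)" by (metis os_os)+
    show ?thesis
      unfolding delta_comm_def mm_def s' scaleR_diff_right i scaleR_add_right q 2 3 4 5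
      by (simp add: algebra_simps)
  qed
  with 1 show ?thesis by simp
qed

definition gl_casimir :: "real \<Rightarrow> real \<Rightarrow> 'n::{finite,linorder} sfun endo endo" where
  "gl_casimir l l' = (\<Sum>i\<in>UNIV. \<Sum>j\<in>UNIV. sg j j *\<^sub>R (ee l l' i j * ee l l' j i))"

definition spo_casimir :: "real \<Rightarrow> real \<Rightarrow> 'n::{finite,linorder} sfun endo endo" where
  "spo_casimir l l' = (\<Sum>i\<in>UNIV. \<Sum>j\<in>UNIV. sg j j *\<^sub>R (mm l l' i j * mm l l' j i))"

lemma ee_gl_casimir: "ee l l' k r * gl_casimir l l' = gl_casimir l l' * ee l l' k r"
  unfolding gl_casimir_def
  by (rule casimir_central[where T = "delta_comm (ee l l') k r"]) (rule ee_ee casimir_central_aux)+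

lemma mm_spo_casimir: "mm l l' k r * spo_casimir l l' = spo_casimir l l' * mm l l' k r"
  unfolding spo_casimir_def
proof (rule casimir_central)
  show "mm l l' k r * mm l l' i j = sgp k r i j *\<^sub>R (mm l l' i j * mm l l' k r)
   + (delta_comm (mm l l') k r i j + cc k r *\<^sub>R delta_comm (mm l l') (os r) (os k) i j)" for i j
    by (rule mm_mm)
  let ?d = "delta_comm (mm l l')"
  have s: "sgp (os r) (os k) i j = sgp k r i j" for i j by (auto simp: sgp_def)
  have "(\<Sum>i\<in>UNIV. \<Sum>j\<in>UNIV. sg j j *\<^sub>R ((?d k r i j + cc k r *\<^sub>R ?d (os r) (os k) i j) * mm l l' j i
      + sgp k r i j *\<^sub>R (mm l l' i j * (?d k r j i + cc k r *\<^sub>R ?d (os r) (os k) j i))))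
    = (\<Sum>i\<in>UNIV. \<Sum>j\<in>UNIV. sg j j *\<^sub>R (?d k r i j * mm l l' j i + sgp k r i j *\<^sub>R (mm l l' i j * ?d k r j i)))
    + cc k r *\<^sub>R (\<Sum>i\<in>UNIV. \<Sum>j\<in>UNIV. sg j j *\<^sub>R (?d (os r) (os k) i j * mm l l' j i
        + sgp (os r) (os k) i j *\<^sub>R (mm l l' i j * ?d (os r) (os k) j i)))"
    unfolding scaleR_sum_right sum.distrib[symmetric] s
    by (intro sum.cong refl) (simp add: algebra_simps)
  then show "(\<Sum>i\<in>UNIV. \<Sum>j\<in>UNIV. sg j j *\<^sub>R ((?d k r i j + cc k r *\<^sub>R ?d (os r) (os k) i j) * mm l l' j i
      + sgp k r i j *\<^sub>R (mm l l' i j * (?d k r j i + cc k r *\<^sub>R ?d (os r) (os k) j i)))) = 0"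
    by (simp only: casimir_central_aux) simp
qed

lemma mm_gl_casimir: "mm l l' k r * gl_casimir l l' = gl_casimir l l' * mm l l' k r"
  using ee_gl_casimir[of l l' k r] ee_gl_casimir[of l l' "os r" "os k"]
  by (simp add: mm_def distrib_left distrib_right)

text \<open>As \<open>spo(2|n)\<close> sits inside \<open>gl(2|n)\<close>, the first Casimir
  commutes with every factor of the second. Hence the spectral projections of
  \<open>gl_casimir\<close> preserve the eigenspaces of \<open>spo_casimir\<close>.\<close>

lemma gl_casimir_spo_casimir: "gl_casimir l l' * spo_casimir l l' = spo_casimir l l' * gl_casimir l l'"
proof -
  have "gl_casimir l l' * (mm l l' i j * mm l l' j i) = mm l l' i j * mm l l' j i * gl_casimir l l'" for i j :: "'a idx"
  proof -
    have "gl_casimir l l' * (mm l l' i j * mm l l' j i) = mm l l' i j * (gl_casimir l l' * mm l l' j i)"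
      unfolding mult.assoc[symmetric] mm_gl_casimir ..
    then show ?thesis unfolding mm_gl_casimir[symmetric] mult.assoc .
  qed
  then show ?thesis unfolding spo_casimir_def by (simp add: sum_distrib_left sum_distrib_right)
qed

section \<open>Two-sided expansion of the Casimirs\<close>

definition quad :: "('n::{finite,linorder} idx \<times> 'n idx \<Rightarrow> real) \<Rightarrow> ('n idx \<times> 'n idx \<Rightarrow> 'n idx \<times> 'n idx) \<Rightarrow>
    real \<Rightarrow> real \<Rightarrow> 'n sfun endo \<Rightarrow> 'n sfun endo" where
  "quad \<kappa> h l l' D = (\<Sum>x\<in>UNIV. \<kappa> x *\<^sub>R (EE l' (fst x) (snd x) * cj (od (fst x) \<noteq> od (snd x)) D
      * EE l (fst (h x)) (snd (h x))))"

text \<open>Two successive supercommutators give a left, a right and two mixed terms. The involution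
  \<open>h\<close>, which sends a generator to its partner in the Casimir, exchanges the two mixed
  terms; hence the factor 2. For \<open>gl(2|n)\<close> it is transposition, for the extra part of
  \<open>spo(2|n)\<close> it is \<open>os\<close> on both indices.\<close>

lemma quad_ee:
  assumes "\<And>x. h (h x) = x" "\<And>x. (od (fst (h x)) \<noteq> od (snd (h x))) = (od (fst x) \<noteq> od (snd x))"
    and "\<And>x. \<kappa> (h x) = sgp (fst x) (snd x) (fst x) (snd x) * \<kappa> x"
  shows "app (\<Sum>x\<in>UNIV. \<kappa> x *\<^sub>R (ee l l' (fst x) (snd x) * ee l l' (fst (h x)) (snd (h x)))) D
    = quad \<kappa> h l' l' 1 * D + D * quad \<kappa> h l l 1 - 2 *\<^sub>R quad \<kappa> h l l' D"
proof -
  have bij: "bij h" using assms(1) by (metis bijI' surjI)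
  define E where "E l x = EE l (fst x) (snd x)" for l and x :: "'a idx \<times> 'a idx"
  define p where "p x = (od (fst x) \<noteq> od (snd x))" for x :: "'a idx \<times> 'a idx"
  define s where "s x = sgp (fst x) (snd x) (fst x) (snd x)" for x :: "'a idx \<times> 'a idx"
  have ph: "p (h x) = p x" for x using assms(2) by (auto simp: p_def)
  have cE: "cj (p x) (E l (h x)) = s x *\<^sub>R E l (h x)" for l x
    using cj_EE[of "fst x" "snd x" l "fst (h x)" "snd (h x)"] assms(2)[of x] by (auto simp: E_def p_def s_def sgp_def)
  have "app (\<Sum>x\<in>UNIV. \<kappa> x *\<^sub>R (ee l l' (fst x) (snd x) * ee l l' (fst (h x)) (snd (h x)))) D
     = (\<Sum>x\<in>UNIV. \<kappa> x *\<^sub>R (E l' x * E l' (h x) * D)) - (\<Sum>x\<in>UNIV. \<kappa> x *\<^sub>R (E l' x * cj (p x) D * E l (h x)))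
      - (\<Sum>x\<in>UNIV. (\<kappa> x * s x) *\<^sub>R (E l' (h x) * cj (p x) D * E l x))
      + (\<Sum>x\<in>UNIV. (\<kappa> x * s x) *\<^sub>R (D * E l (h x) * E l x))"
    unfolding app_sum sum_subtractf[symmetric] sum.distrib[symmetric]
  proof (rule sum.cong[OF refl], goal_cases)
    case (1 x)
    have eq: "app (ee l l' (fst x) (snd x) * ee l l' (fst (h x)) (snd (h x))) D
      = E l' x * (E l' (h x) * D - cj (p x) D * E l (h x)) - cj (p x) (E l' (h x) * D - cj (p x) D * E l (h x)) * E l x"
      using ph[of x] by (simp only: ee_def E_def[symmetric] p_def[symmetric] app_simps app_AD)
    show ?case
      unfolding app_simps(6) eq by (simp add: cj_simps cE algebra_simps)
  qed
  also have "(\<Sum>x\<in>UNIV. (\<kappa> x * s x) *\<^sub>R (E l' (h x) * cj (p x) D * E l x))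
     = (\<Sum>x\<in>UNIV. \<kappa> x *\<^sub>R (E l' x * cj (p x) D * E l (h x)))"
    by (rule sum.reindex_bij_witness[where i = h and j = h])
      (auto simp: assms(1,3) s_def ph mult.commute)
  also have "(\<Sum>x\<in>UNIV. (\<kappa> x * s x) *\<^sub>R (D * E l (h x) * E l x)) = (\<Sum>x\<in>UNIV. \<kappa> x *\<^sub>R (D * E l x * E l (h x)))"
    by (rule sum.reindex_bij_witness[where i = h and j = h])
      (auto simp: assms(1,3) s_def ph mult.commute)
  finally show ?thesis
    unfolding quad_def E_def[symmetric] p_def[symmetric]
    by (simp add: cj_simps sum_distrib_left sum_distrib_right scaleR_2 mult.assoc)
qed

text \<open>
  The mixed parts of the Casimirs, with one factor on each side of \<open>D\<close>: \<open>Phi\<close> for \<open>gl(2|n)\<close> and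
  \<open>Phi + Psi\<close> for \<open>spo(2|n)\<close>.
\<close>

definition Phi :: "real \<Rightarrow> real \<Rightarrow> 'n::{finite,linorder} sfun endo \<Rightarrow> 'n sfun endo" where
  "Phi l l' D = (\<Sum>i\<in>UNIV. \<Sum>j\<in>UNIV. sg j j *\<^sub>R (yy i * pp l' j * tw i (tw j D) * yy j * pp l i))"

definition Psi :: "real \<Rightarrow> real \<Rightarrow> 'n::{finite,linorder} sfun endo \<Rightarrow> 'n sfun endo" where
  "Psi l l' D = (\<Sum>i\<in>UNIV. \<Sum>j\<in>UNIV. (sg j j * cc j i) *\<^sub>R
     (yy i * pp l' j * tw i (tw j D) * yy (os i) * pp l (os j)))"

lemma sum_pairs: "(\<Sum>x\<in>(UNIV :: ('a::finite \<times> 'b::finite) set). f x) = (\<Sum>i\<in>UNIV. \<Sum>j\<in>UNIV. f (i, j))"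
  by (simp add: sum.cartesian_product UNIV_Times_UNIV)

lemma gl_casimir_Phi: "app (gl_casimir l l') D = Phi l' l' 1 * D + D * Phi l l 1 - 2 *\<^sub>R Phi l l' D"
proof -
  have "quad (\<lambda>x. sg (snd x) (snd x)) prod.swap l l' D = Phi l l' D" for l l' and D :: "'a sfun endo"
    by (simp add: quad_def sum_pairs Phi_def EE_def cj_simps mult.assoc)
  moreover have "(gl_casimir l l' :: 'a sfun endo endo) = (\<Sum>x\<in>UNIV. sg (snd x) (snd x) *\<^sub>R (ee l l' (fst x) (snd x) *
      ee l l' (fst (prod.swap x)) (snd (prod.swap x))))"
    by (simp add: gl_casimir_def sum_pairs)
  moreover have "app (\<Sum>x\<in>UNIV. sg (snd x) (snd x) *\<^sub>R (ee l l' (fst x) (snd x) *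
      ee l l' (fst (prod.swap x)) (snd (prod.swap x)))) D
    = quad (\<lambda>x. sg (snd x) (snd x)) prod.swap l' l' 1 * D + D * quad (\<lambda>x. sg (snd x) (snd x)) prod.swap l l 1
      - 2 *\<^sub>R quad (\<lambda>x. sg (snd x) (snd x)) prod.swap l l' D"
    by (rule quad_ee) (auto simp: sg_def sgp_def)
  ultimately show ?thesis by (simp only:)
qed

lemma cc_os: "sg i i * cc (os j) (os i) = sg j j * cc j i" 
  by (cases i rule: idx_cases; cases j rule: idx_cases; simp add: cc_def)

lemma cc_cc: "sg j j * cc i j * cc j i = sg i i"
  by (cases i rule: idx_cases; cases j rule: idx_cases; simp add: cc_def)

text \<open>Expanding both \<open>mm\<close> gives four products. Reindexing by \<open>os\<close>
  identifies the fourth with the first and the third with the second.\<close>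

lemma spo_casimir_eq: "spo_casimir l l' = 2 *\<^sub>R gl_casimir l l' + 2 *\<^sub>R (\<Sum>x\<in>UNIV. (sg (snd x) (snd x) * cc (snd x) (fst x)) *\<^sub>R
    (ee l l' (fst x) (snd x) * ee l l' (os (fst x)) (os (snd x))))"
proof -
  let ?e = "ee l l'"
  have "spo_casimir l l' = (\<Sum>i\<in>UNIV. \<Sum>j\<in>UNIV. sg j j *\<^sub>R (?e i j * ?e j i))
     + (\<Sum>i\<in>UNIV. \<Sum>j\<in>UNIV. (sg j j * cc j i) *\<^sub>R (?e i j * ?e (os i) (os j)))
     + (\<Sum>i\<in>UNIV. \<Sum>j\<in>UNIV. (sg j j * cc i j) *\<^sub>R (?e (os j) (os i) * ?e j i))
     + (\<Sum>i\<in>UNIV. \<Sum>j\<in>UNIV. (sg j j * cc i j * cc j i) *\<^sub>R (?e (os j) (os i) * ?e (os i) (os j)))"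
    unfolding spo_casimir_def mm_def sum.distrib[symmetric]
    by (intro sum.cong refl) (simp add: algebra_simps)
  also have "(\<Sum>i\<in>UNIV. \<Sum>j\<in>UNIV. (sg j j * cc i j) *\<^sub>R (?e (os j) (os i) * ?e j i))
     = (\<Sum>i\<in>UNIV. \<Sum>j\<in>UNIV. (sg j j * cc j i) *\<^sub>R (?e i j * ?e (os i) (os j)))"
    by (subst sum.swap, rule sum.reindex_bij_witness[where i = os and j = os], simp, simp, simp, simp,
        rule sum.reindex_bij_witness[where i = os and j = os])
      (auto simp: cc_os[symmetric])
  also have "(\<Sum>i\<in>UNIV. \<Sum>j\<in>UNIV. (sg j j * cc i j * cc j i) *\<^sub>R (?e (os j) (os i) * ?e (os i) (os j)))
     = (\<Sum>i\<in>UNIV. \<Sum>j\<in>UNIV. sg j j *\<^sub>R (?e i j * ?e j i))"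
  proof -
    show ?thesis unfolding cc_cc
      by (subst sum.swap, rule sum.reindex_bij_witness[where i = os and j = os], simp, simp, simp, simp,
        rule sum.reindex_bij_witness[where i = os and j = os], auto)
  qed
  finally show ?thesis
    by (simp add: gl_casimir_def sum_pairs scaleR_2 ac_simps)
qed

lemma spo_casimir_PhiPsi: "app (spo_casimir l l') D = 2 *\<^sub>R ((Phi l' l' 1 + Psi l' l' 1) * D + D * (Phi l l 1 + Psi l l 1))
    - 4 *\<^sub>R (Phi l l' D + Psi l l' D)"
proof -
  let ?h = "\<lambda>x. (os (fst x), os (snd x))"
  let ?k = "\<lambda>x. sg (snd x) (snd x) * cc (snd x) (fst x)"
  have "quad ?k ?h l l' D = Psi l l' D" for l l' and D :: "'a sfun endo"
    by (simp add: quad_def sum_pairs Psi_def EE_def cj_simps mult.assoc)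
  moreover have "?k (?h x) = sgp (fst x) (snd x) (fst x) (snd x) * ?k x" for x :: "'a idx \<times> 'a idx"
    using cc_os[of "fst x" "snd x"] by (auto simp: sg_def sgp_def)
  ultimately have f: "app (\<Sum>x\<in>UNIV. ?k x *\<^sub>R (ee l l' (fst x) (snd x) * ee l l' (os (fst x)) (os (snd x)))) D
    = Psi l' l' 1 * D + D * Psi l l 1 - 2 *\<^sub>R Psi l l' D"
    using quad_ee[of ?h ?k l l' D] by simp
  show ?thesis
    unfolding spo_casimir_eq app_simps(3,6) gl_casimir_Phi f by (simp add: algebra_simps)
qed

text \<open>
  The supercommutator of \<open>D\<close> with a coordinate, up to the order of the factors: it differentiates the
  symbol of \<open>D\<close>, and reduces the Casimirs to Euler type operators in the moments.
\<close>

definition tt :: "'n::{finite,linorder} idx \<Rightarrow> 'n sfun endo \<Rightarrow> 'n sfun endo" where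
  "tt a D = D * yy a - yy a * tw a D"

abbreviation GG :: "'n::{finite,linorder} idx \<Rightarrow> 'n sfun endo \<Rightarrow> 'n sfun endo" where
  "GG a D \<equiv> tt a (tw a D)"

text \<open>On symbols this is the Euler operator in all moments: it multiplies a monomial by its
  order, \<open>NN_mop\<close>. The weight in \<open>pp\<close> is immaterial because
  \<open>tt None\<close> vanishes, \<open>tt_pp\<close>.\<close>

definition NN :: "'n::{finite,linorder} sfun endo \<Rightarrow> 'n sfun endo" where
  "NN D = (\<Sum>a\<in>UNIV. tt a D * pp 0 a)"

text \<open>On monomials this is the derivative with respect to \<open>\<zeta>\<close>,
  \<open>ZZ_mop\<close>. The contraction uses the symplectic pairing, under which products of two
  coordinates sum to 0, \<open>sum_om_yy\<close>.\<close>

definition ZZ :: "'n::{finite,linorder} sfun endo \<Rightarrow> 'n sfun endo" where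
  "ZZ D = (\<Sum>a\<in>UNIV. om (os a) *\<^sub>R (tt a D * yy (os a)))"

lemma yy_simps [simp]: "yy None = 1" "yy (Some None) = xx" "yy (Some (Some i)) = th i"
  by (simp_all add: yy_def)

lemma pp_simps [simp]: "pp l (Some None) = dX" "pp l (Some (Some i)) = dT i"
  by (simp_all add: pp_def)

lemma tt_lin: "tt a (D + E) = tt a D + tt a E" "tt a (D - E) = tt a D - tt a E"
  "tt a (r *\<^sub>R D) = r *\<^sub>R tt a D" "tt a (- D) = - tt a D" "tt a 0 = 0"
  by (simp_all add: tt_def cj_simps algebra_simps)

lemma tt_None [simp]: "tt None D = 0"
  by (simp add: tt_def yy_def cj_simps)

lemma tw_self [simp]: "tw a (tw a D) = D" by (simp add: cj_simps)

lemma tt_tw: "tt b (tw a D) = sg a b *\<^sub>R tw a (tt b D)"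
  by (simp add: tt_def cj_simps cj_yy) (auto simp: sg_def algebra_simps)

lemma yy_tw: "yy a * tw a D = D * yy a - tt a D" by (simp add: tt_def)

lemma tt_pp: "tt a D * pp l a = tt a D * pp 0 a"
  by (cases a rule: idx_cases) (simp_all add: pp_def)

lemma NN_lin: "NN (D + E) = NN D + NN E" "NN (D - E) = NN D - NN E" "NN (r *\<^sub>R D) = r *\<^sub>R NN D" "NN 0 = 0"
  by (simp_all add: NN_def tt_lin algebra_simps sum.distrib sum_subtractf scaleR_sum_right)

lemma ZZ_lin: "ZZ (D + E) = ZZ D + ZZ E" "ZZ (D - E) = ZZ D - ZZ E" "ZZ (r *\<^sub>R D) = r *\<^sub>R ZZ D" "ZZ 0 = 0"
  by (simp_all add: ZZ_def tt_lin algebra_simps sum.distrib sum_subtractf scaleR_sum_right)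

lemma sum_yy_tw_pp: "(\<Sum>a\<in>UNIV. yy a * tw a D * pp l a) = - (l *\<^sub>R D) - NN D"
proof -
  have "(\<Sum>a\<in>UNIV. yy a * tw a D * pp l a) = D * (\<Sum>a\<in>UNIV. yy a * pp l a) - NN D"
    by (simp add: yy_tw left_diff_distrib sum_subtractf tt_pp[of _ D l] NN_def sum_distrib_left mult.assoc)
  then show ?thesis by (simp add: sum_yy_pp)
qed

text \<open>The scalar is the superdimension \<open>2 - n\<close> of the coordinates, less 1 for the
  correction at \<open>None\<close>, less \<open>l\<close> from Euler's identity.\<close>

lemma sum_pp_yy: "(\<Sum>j\<in>UNIV. sg j j *\<^sub>R (pp l j * yy (j :: 'n::{finite,linorder} idx))) = (1 - real CARD('n) - l) *\<^sub>R 1"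
proof -
  have "sg j j *\<^sub>R (pp l j * yy j) = yy j * pp l j + (sg j j - (if j = None then 1 else 0)) *\<^sub>R 1"
    for j :: "'n idx"
    unfolding pp_yy[of l j j] by (cases j) (simp_all add: algebra_simps)
  moreover have "(\<Sum>j\<in>(UNIV :: 'n idx set). (sg j j - (if j = None then 1 else 0)) *\<^sub>R (1 :: 'n sfun endo)) = (1 - real CARD('n)) *\<^sub>R 1"
    unfolding scaleR_sum_left[symmetric] by (simp add: sum_idx)
  ultimately show ?thesis
    by (simp only: sum.distrib sum_yy_pp) (simp add: algebra_simps)
qed

text \<open>Coordinates are moved towards the derivatives with the same index, where Euler's
  identity contracts the sum to a scalar. The supercommutators created on the way are collected in
  \<open>NN\<close> and \<open>GG\<close>.\<close>

lemma Phi_eq: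
  fixes D :: "'n::{finite,linorder} sfun endo"
  shows "Phi l l' D = (1 - real CARD('n) - l') *\<^sub>R (- (l *\<^sub>R D) - NN D) - NN D
    - (\<Sum>j\<in>UNIV. sg j j *\<^sub>R (pp l' j * (l *\<^sub>R GG j D + NN (GG j D))))"
proof -
  have 1: "tw i (tw j D) * yy j = yy j * tw i D + tt j (tw i (tw j D))" for i j :: "'n idx"
  proof -
    have "tw j (tw i (tw j D)) = tw i D" by (cases "od i"; cases "od j"; simp add: cj_simps)
    then show ?thesis by (simp add: tt_def)
  qed
  have 2: "(\<Sum>j\<in>UNIV. sg j j *\<^sub>R (yy i * pp l' j * tw i (tw j D) * yy j * pp l i))
     = (1 - real CARD('n) - l') *\<^sub>R (yy i * tw i D * pp l i)
       + (\<Sum>j\<in>UNIV. sg j j *\<^sub>R (yy i * pp l' j * tt j (tw i (tw j D)) * pp l i))" for i :: "'n idx"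
  proof -
    have "(\<Sum>j\<in>UNIV. sg j j *\<^sub>R (yy i * pp l' j * tw i (tw j D) * yy j * pp l i))
      = yy i * (\<Sum>j\<in>UNIV. sg j j *\<^sub>R (pp l' j * yy j)) * (tw i D * pp l i)
       + (\<Sum>j\<in>UNIV. sg j j *\<^sub>R (yy i * pp l' j * tt j (tw i (tw j D)) * pp l i))"
      unfolding sum_distrib_left sum_distrib_right sum.distrib[symmetric]
    proof (intro sum.cong refl)
      fix j
      have "yy i * pp l' j * tw i (tw j D) * yy j * pp l i = yy i * pp l' j * (tw i (tw j D) * yy j) * pp l i"
        by (simp only: mult.assoc)
      then show "sg j j *\<^sub>R (yy i * pp l' j * tw i (tw j D) * yy j * pp l i) =
        yy i * sg j j *\<^sub>R (pp l' j * yy j) * (tw i D * pp l i) +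
        sg j j *\<^sub>R (yy i * pp l' j * tt j (tw i (tw j D)) * pp l i)"
        unfolding 1 by (simp add: mult.assoc distrib_left distrib_right scaleR_add_right)
    qed
    then show ?thesis by (simp add: sum_pp_yy mult.assoc)
  qed
  have 3: "yy i * pp l' j * tt j (tw i (tw j D)) * pp l i
      = pp l' j * (yy i * tw i (GG j D) * pp l i) - (if i = j then tw i (GG j D) * pp l i else 0)" for i j :: "'n idx"
  proof (cases j)
    case None
    then show ?thesis by (simp add: cj_simps)
  next
    case (Some k)
    have "sg i j *\<^sub>R (yy i * pp l' j) = pp l' j * yy i - (if i = j then 1 else 0)"
      using pp_yy[of l' j i] Some by (auto simp: sg_commute algebra_simps)
    then have "yy i * pp l' j * tt j (tw i (tw j D)) = (pp l' j * yy i - (if i = j then 1 else 0)) * tw i (GG j D)"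
      by (simp add: tt_tw[of j i] sg_commute[of j i] flip: mult_scaleR_left)
    then show ?thesis by (auto simp: left_diff_distrib mult.assoc)
  qed
  have 4: "(\<Sum>i\<in>UNIV. \<Sum>j\<in>UNIV. sg j j *\<^sub>R (yy i * pp l' j * tt j (tw i (tw j D)) * pp l i))
     = (\<Sum>j\<in>UNIV. sg j j *\<^sub>R (pp l' j * (\<Sum>i\<in>UNIV. yy i * tw i (GG j D) * pp l i)))
       - (\<Sum>i\<in>UNIV. sg i i *\<^sub>R (tw i (GG i D) * pp l i))"
  proof -
    have "(\<Sum>i\<in>UNIV. \<Sum>j\<in>UNIV. sg j j *\<^sub>R (yy i * pp l' j * tt j (tw i (tw j D)) * pp l i))
      = (\<Sum>i\<in>UNIV. \<Sum>j\<in>UNIV. sg j j *\<^sub>R (pp l' j * (yy i * tw i (GG j D) * pp l i)))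
       - (\<Sum>i\<in>UNIV. \<Sum>j\<in>UNIV. if i = j then sg j j *\<^sub>R (tw i (GG j D) * pp l i) else 0)"
      unfolding sum_subtractf[symmetric] 3 by (intro sum.cong refl) (auto simp: scaleR_diff_right)
    also have "(\<Sum>i\<in>UNIV. \<Sum>j\<in>UNIV. sg j j *\<^sub>R (pp l' j * (yy i * tw i (GG j D) * pp l i)))
      = (\<Sum>j\<in>UNIV. sg j j *\<^sub>R (pp l' j * (\<Sum>i\<in>UNIV. yy i * tw i (GG j D) * pp l i)))"
      by (subst sum.swap) (simp add: sum_distrib_left scaleR_sum_right)
    finally show ?thesis by simp
  qed
  have 5: "(\<Sum>i\<in>UNIV. sg i i *\<^sub>R (tw i (GG i D) * pp l i)) = NN D"
    by (simp add: NN_def tt_tw[of _ _ D] tt_pp[of _ _ l] cj_simps(5) mult.commute)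
  show ?thesis
    unfolding Phi_def 2 sum.distrib 4 5 scaleR_sum_right[symmetric] sum_yy_tw_pp
    by (simp add: algebra_simps sum.distrib sum_negf sum_subtractf)
qed

lemma sum_om_yy: "(\<Sum>a\<in>UNIV. om (os a) *\<^sub>R (yy a * tw a D * yy (os a))) = - ZZ D"
proof -
  have "(\<Sum>a\<in>UNIV. om (os a) *\<^sub>R (yy a * tw a D * yy (os a)))
    = D * (\<Sum>a\<in>UNIV. om (os a) *\<^sub>R (yy a * yy (os a))) - ZZ D"
    by (simp add: yy_tw left_diff_distrib sum_subtractf ZZ_def sum_distrib_left mult.assoc scaleR_diff_right)
  moreover have "(\<Sum>a\<in>UNIV. om (os a) *\<^sub>R (yy a * yy (os a))) = (0 :: 'a sfun endo)"
    by (simp add: sum_idx yy_def th_sq)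
  ultimately show ?thesis by simp
qed

lemma ZZ_cj: "ZZ (cj p D) = cj p (ZZ D)"
proof -
  have "- ZZ (cj p D) = cj p (- ZZ D)"
    unfolding sum_om_yy[symmetric] cj_sum
    by (intro sum.cong refl) (cases p; auto simp: cj_simps cj_yy)
  then show ?thesis by (simp add: cj_simps)
qed

text \<open>In \<open>Psi\<close> the two coordinates with index \<open>i\<close> and
  \<open>os i\<close> are paired by the symplectic form, so their products cancel and only
  \<open>ZZ D\<close> survives, apart from the scalar \<open>- l\<close>.\<close>

lemma Psi_eq: "Psi l l' D = - (pp l' None * ZZ D * dX - dX * ZZ D * pp l None
     - (\<Sum>i\<in>UNIV. dT i * cj True (ZZ D) * dT i)) - l *\<^sub>R D - ZZ D * dX"
proof -
  have 1: "(sg j j * cc j i) *\<^sub>R (yy i * pp l' j * tw i (tw j D) * yy (os i) * pp l (os j))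
     = (sg j j * om j) *\<^sub>R (pp l' j * (om (os i) *\<^sub>R (yy i * tw i (tw j D) * yy (os i))) * pp l (os j))
      + (if i = j then D * (yy (os j) * pp l (os j)) else 0)
      + (if j = None then (om (os i) *\<^sub>R (yy i * tw i D * yy (os i))) * dX else 0)" for i j :: "'a idx"
  proof -
    have e: "sg j i *\<^sub>R (yy i * pp l' j) = pp l' j * yy i - (if j = i then 1 else 0) + (if j = None then yy i else 0)"
      using pp_yy[of l' j i] by (simp add: algebra_simps)
    have "(sg j j * cc j i) *\<^sub>R (yy i * pp l' j * tw i (tw j D) * yy (os i) * pp l (os j))
      = (sg j j * om j * om (os i)) *\<^sub>R ((sg j i *\<^sub>R (yy i * pp l' j)) * (tw i (tw j D) * yy (os i) * pp l (os j)))"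
      by (simp add: cc_def mult.assoc mult_ac)
    moreover have "sg j j * om j * om (os j) = - 1"
      by (cases j rule: idx_cases) auto
    ultimately show ?thesis
      unfolding e
      by (auto simp: left_diff_distrib right_diff_distrib distrib_left distrib_right scaleR_diff_right
          scaleR_add_right mult.assoc cj_simps)
  qed
  have "Psi l l' D = (\<Sum>j\<in>UNIV. (sg j j * om j) *\<^sub>R (pp l' j * (- ZZ (tw j D)) * pp l (os j)))
     + (\<Sum>j\<in>UNIV. D * (yy (os j) * pp l (os j))) + (- ZZ D) * dX"
  proof -
    have "(\<Sum>i\<in>UNIV. \<Sum>j\<in>UNIV. (sg j j * om j) *\<^sub>R (pp l' j * (om (os i) *\<^sub>R (yy i * tw i (tw j D) * yy (os i))) * pp l (os j)))
       = (\<Sum>j\<in>UNIV. (sg j j * om j) *\<^sub>R (pp l' j * (- ZZ (tw j D)) * pp l (os j)))"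
      unfolding sum_om_yy[symmetric]
      by (subst sum.swap) (simp add: sum_distrib_left sum_distrib_right scaleR_sum_right)
    moreover have "(\<Sum>i\<in>UNIV. \<Sum>j\<in>(UNIV :: 'a idx set). if j = None then (om (os i) *\<^sub>R (yy i * tw i D * yy (os i))) * dX else 0)
       = (- ZZ D) * dX"
      unfolding sum_om_yy[symmetric] by (simp add: sum_distrib_right)
    ultimately show ?thesis
      unfolding Psi_def 1 sum.distrib by simp
  qed
  also have "(\<Sum>j\<in>UNIV. D * (yy (os j) * pp l (os j))) = D * (\<Sum>j\<in>UNIV. yy j * pp l j)"
    unfolding sum_distrib_left by (rule sum.reindex_bij_witness[where i = os and j = os]) auto
  also have "\<dots> = - (l *\<^sub>R D)" by (simp add: sum_yy_pp)
  finally show ?thesis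
    by (simp add: ZZ_cj sum_idx cj_simps sum_negf algebra_simps)
qed

lemma tt_th: "tt (Some (Some i)) F = F * th i - th i * cj True F"
  by (simp add: tt_def)

lemma ZZ_eq: "ZZ F = (F * xx - xx * F) + (\<Sum>i\<in>UNIV. tt (Some (Some i)) F * th i)"
  by (simp add: ZZ_def sum_idx) (simp add: tt_def cj_simps)

text \<open>Passage from the derivatives \<open>dT\<close> to the frame \<open>dB\<close> in which
  monomials are written. In the scalar, 1 comes from moving \<open>dX\<close> past
  \<open>xx\<close>, each of the \<open>n\<close> odd directions contributes -1 by moving
  \<open>dB i\<close> past \<open>th i\<close>, and \<open>l - l'\<close> is the difference of the
  two Euler scalars.\<close>

lemma contact_form:
  fixes F :: "'n::{finite,linorder} sfun endo"
  shows "pp l' None * F * dX - dX * F * pp l None - (\<Sum>i\<in>UNIV. dT i * cj True F * dT i)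
    = (1 + l - l' - real CARD('n)) *\<^sub>R (F * dX) + dX * ZZ F * dX
      + (\<Sum>i\<in>UNIV. dX * tt (Some (Some i)) F * dB i + dB i * cj True (tt (Some (Some i)) F) * dX
          - dB i * cj True F * dB i)
      + l *\<^sub>R (dX * F - F * dX)"
proof -
  define G where "G = cj True F"
  define t where "t i = tt (Some (Some i)) F" for i
  have t: "t i = F * th i - th i * G" for i by (simp add: t_def tt_th G_def)
  have ct: "cj True (t i) = th i * F - G * th i" for i
    unfolding t G_def by (simp add: cj_simps)
  have dTB: "dT i = dB i + th i * dX" for i :: 'n by (simp add: dB_def)
  have i: "dX * F * th i * dT i - th i * dT i * F * dX - dT i * G * dT i
     = - (F * dX) + (dX * t i * dB i + dB i * cj True (t i) * dX - dB i * G * dB i) + dX * (t i * th i) * dX" for i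
  proof -
    have "dB i * th i * (F * dX) = F * dX - th i * dB i * (F * dX)"
      by (simp add: dB_th left_diff_distrib)
    moreover have "th i * dT i * (F * dX) = th i * dB i * (F * dX)"
      by (simp add: dB_def right_diff_distrib mult.assoc[symmetric] th_sq)
    ultimately have 1: "dB i * th i * (F * dX) = F * dX - th i * dT i * (F * dX)" by simp
    have 2: "dX * t i * dB i + dX * (t i * th i) * dX = dX * t i * dT i"
      by (simp add: dTB[of i] algebra_simps)
    have 3: "dX * t i * dT i = dX * F * th i * dT i - th i * dX * G * dT i"
      unfolding t by (simp add: algebra_simps) (simp add: mult.assoc[symmetric] dX_th)
    have 4: "dB i * G * dB i + dB i * G * th i * dX = dB i * G * dT i"
      by (simp add: dTB[of i] algebra_simps)
    have 5: "dB i * G * dT i = dT i * G * dT i - th i * dX * G * dT i"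
      by (simp add: dB_def algebra_simps)
    have 6: "dB i * cj True (t i) * dX = dB i * th i * (F * dX) - dB i * G * th i * dX"
      unfolding ct by (simp add: algebra_simps)
    have "- (F * dX) + (dX * t i * dB i + dB i * cj True (t i) * dX - dB i * G * dB i) + dX * (t i * th i) * dX
       = - (F * dX) + (dX * t i * dB i + dX * (t i * th i) * dX) + dB i * th i * (F * dX)
         - (dB i * G * dB i + dB i * G * th i * dX)"
      unfolding 6 by (simp add: algebra_simps)
    also have "\<dots> = dX * F * th i * dT i - th i * dT i * F * dX - dT i * G * dT i"
      unfolding 1 2 3 4 5 by (simp add: algebra_simps)
    finally show ?thesis ..
  qed
  have e: "pp l' None * F * dX - dX * F * pp l None - (\<Sum>i\<in>UNIV. dT i * cj True F * dT i)
     = (dX * F * xx - xx * dX * F) * dX + (\<Sum>i\<in>UNIV. dX * F * th i * dT i - th i * dT i * F * dX - dT i * G * dT i)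
      + (l *\<^sub>R (dX * F) - l' *\<^sub>R (F * dX))"
    unfolding pp_def G_def Eu_def
    by (simp add: algebra_simps sum_subtractf sum.distrib sum_distrib_left sum_distrib_right)
  have x: "dX * F * xx - xx * dX * F = dX * (F * xx - xx * F) + F"
    by (simp add: right_diff_distrib) (simp add: mult.assoc[symmetric] dX_xx distrib_right)
  have z: "dX * ZZ F * dX = dX * (F * xx - xx * F) * dX + (\<Sum>i\<in>UNIV. dX * (t i * th i) * dX)"
    unfolding ZZ_eq t_def by (simp add: distrib_left distrib_right sum_distrib_left sum_distrib_right)
  have n: "(\<Sum>i\<in>(UNIV :: 'n set). - (F * dX)) = - (real CARD('n) *\<^sub>R (F * dX))"
    by (simp add: sum_constant_scaleR del: sum_constant)
  show ?thesis
    unfolding e unfolding i sum.distrib n x z G_def[symmetric] t_def[symmetric]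
    by (simp add: algebra_simps)
qed

section \<open>Monomial operators\<close>

definition DK :: "'n::{finite,linorder} set \<Rightarrow> 'n sfun endo" where
  "DK K = foldr (\<lambda>i D. dB i * D) (sorted_list_of_set K) 1"

definition mop :: "'n::{finite,linorder} sfun \<Rightarrow> nat \<Rightarrow> 'n set \<Rightarrow> 'n sfun endo" where
  "mop A c K = fm A * dX ^ c * DK K"

lemma DK_empty [simp]: "DK {} = 1" by (simp add: DK_def)

lemma DK_insert_min:
  assumes "\<And>j. j \<in> K \<Longrightarrow> i < j"
  shows "DK (insert i K) = dB i * DK (K :: 'n::{finite,linorder} set)"
proof -
  have "i \<notin> K" using assms by blast
  moreover have "insort i (sorted_list_of_set K) = i # sorted_list_of_set K"
    using assms by (intro insort_is_Cons) (auto intro: less_imp_le)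
  ultimately show ?thesis
    unfolding DK_def by (subst sorted_list_of_set.fold_insort_key.insert) auto
qed

lemma DK_left:
  fixes K :: "'n::{finite,linorder} set"
  assumes "i \<notin> K" shows "dB i * DK K = grassmann_sign {i} K *\<^sub>R DK (insert i K)"
  using finite[of K] assms
proof (induction K rule: finite_linorder_min_induct)
  case empty
  show ?case using DK_insert_min[of "{}" i] by simp
next
  case (insert m L)
  show ?case
  proof (cases "i < m")
    case True
    have "{(j, k). j \<in> {i} \<and> k \<in> insert m L \<and> k < j} = {}"
      using True insert.hyps by (auto dest: less_trans less_asym)
    then have "grassmann_sign {i} (insert m L) = 1"
      by (simp only: grassmann_sign_def card.empty power_0)
    moreover have "DK (insert i (insert m L)) = dB i * DK (insert m L)"
      by (rule DK_insert_min) (use True insert.hyps in auto)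
    ultimately show ?thesis by simp
  next
    case False
    then have mi: "m < i" "i \<noteq> m" using insert.prems by auto
    have m: "\<And>j. j \<in> L \<Longrightarrow> m < j" using insert.hyps by auto
    have "m \<notin> L" using m by blast
    have "{(j, k). j \<in> {i} \<and> k \<in> {m} \<and> k < j} = {(i, m)}" using mi by auto
    then have "grassmann_sign {i} {m} = - 1" by (simp add: grassmann_sign_def)
    then have s: "grassmann_sign {i} (insert m L) = - grassmann_sign {i} L"
      using grassmann_sign_Un_right[of "{m}" L "{i}"] \<open>m \<notin> L\<close> by simp
    have "dB i * DK (insert m L) = (dB i * dB m) * DK L"
      by (simp add: DK_insert_min[OF m] mult.assoc)
    also have "\<dots> = - (dB m * (dB i * DK L))" using mi by (simp add: dB_dB[of i m] mult.assoc)
    also have "\<dots> = - (grassmann_sign {i} L *\<^sub>R (dB m * DK (insert i L)))"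
      using insert.IH insert.prems by simp
    also have "dB m * DK (insert i L) = DK (insert m (insert i L))"
      by (rule DK_insert_min[symmetric]) (use m mi in auto)
    finally show ?thesis by (simp add: s insert_commute)
  qed
qed

lemma DK_swap:
  fixes K :: "'n::{finite,linorder} set"
  assumes "i \<notin> K" shows "DK K * dB i = (- 1) ^ card K *\<^sub>R (dB i * DK K)"
  using finite[of K] assms
proof (induction K rule: finite_linorder_min_induct)
  case (insert m L)
  then have m: "\<And>j. j \<in> L \<Longrightarrow> m < j" "m \<notin> L" and i: "i \<noteq> m" "i \<notin> L" by auto
  have "DK (insert m L) * dB i = (- 1) ^ card L *\<^sub>R ((dB m * dB i) * DK L)"
    using insert.IH[OF i(2)] by (simp add: DK_insert_min[OF m(1)] mult.assoc)
  also have "\<dots> = (- 1) ^ card (insert m L) *\<^sub>R (dB i * DK (insert m L))"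
    using m(2) i by (simp add: DK_insert_min[OF m(1)] mult.assoc dB_dB[of m i])
  finally show ?case .
qed simp

lemma DK_right:
  fixes K :: "'n::{finite,linorder} set"
  assumes "i \<in> K" shows "DK K = grassmann_sign (K - {i}) {i} *\<^sub>R (DK (K - {i}) * dB i)"
proof -
  have "grassmann_sign (K - {i}) {i} *\<^sub>R (DK (K - {i}) * dB i)
    = (grassmann_sign {i} (K - {i}) * ((- 1) ^ card (K - {i}) * (- 1) ^ card (K - {i}))) *\<^sub>R (dB i * DK (K - {i}))"
    by (simp add: DK_swap grassmann_sign_swap mult_ac)
  also have "\<dots> = (grassmann_sign {i} (K - {i}) * grassmann_sign {i} (K - {i})) *\<^sub>R DK K"
    using assms by (simp add: DK_left insert_absorb flip: power_mult_distrib)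
  finally show ?thesis by simp
qed

lemma dX_power_commute: "D * dX = dX * D \<Longrightarrow> D * dX ^ c = dX ^ c * D"
  by (metis power_commuting_commutes)

lemma DK_dX: "DK K * dX = dX * DK (K :: 'n::{finite,linorder} set)"
  using finite[of K]
proof (induction K rule: finite_linorder_min_induct)
  case (insert m L)
  then have m: "\<And>j. j \<in> L \<Longrightarrow> m < j" by auto
  have "DK (insert m L) * dX = (dB m * dX) * DK L"
    using insert.IH by (simp add: DK_insert_min[OF m] mult.assoc)
  then show ?case by (simp only: DK_insert_min[OF m] dX_dB[symmetric] mult.assoc)
qed simp

lemma cj_DK: "cj True (DK K) = (- 1) ^ card K *\<^sub>R DK (K :: 'n::{finite,linorder} set)"
  using finite[of K]
proof (induction K rule: finite_linorder_min_induct)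
  case (insert m L)
  then have m: "\<And>j. j \<in> L \<Longrightarrow> m < j" "m \<notin> L" by auto
  show ?case using insert.IH m(2) by (simp add: DK_insert_min[OF m(1)] cj_simps)
qed (simp add: cj_simps)

lemma cj_dX_power: "cj p (dX ^ c) = dX ^ c"
  by (induction c) (simp_all add: cj_simps)

lemma cj_mop: "cj True (mop A c K) = (- 1) ^ card K *\<^sub>R mop (sf_par A) c K"
  by (simp add: mop_def cj_simps cj_fm cj_dX_power cj_DK)

lemma mop_lin: "mop (A + B) c K = mop A c K + mop B c K" "mop (r *\<^sub>R A) c K = r *\<^sub>R mop A c K"
  "mop 0 c K = 0"
  by (simp_all add: mop_def fm_hom algebra_simps)

lemma fm_mop: "fm f * mop A c K = mop (f * A) c K"
  by (simp add: mop_def fm_hom mult.assoc)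

lemma mop_dX: "mop A c K * dX = mop A (Suc c) K"
  by (simp add: mop_def mult.assoc DK_dX) (simp add: mult.assoc[symmetric] power_commutes)

lemma dX_mop: "dX * mop A c K = mop (sf_dx A) c K + mop A (Suc c) K"
proof -
  have "dX * mop A c K = (dX * fm A) * dX ^ c * DK K" by (simp add: mop_def mult.assoc)
  then show ?thesis by (simp add: dX_fm mop_def distrib_right mult.assoc)
qed

lemma mop_dB: "mop A c K * dB i = (if i \<in> K then - (grassmann_sign (K - {i}) {i} *\<^sub>R mop A (Suc c) (K - {i}))
   else grassmann_sign K {i} *\<^sub>R mop A c (insert i K))"
proof (cases "i \<in> K")
  case True
  have "DK K * dB i = - (grassmann_sign (K - {i}) {i} *\<^sub>R (dX * DK (K - {i})))"
    by (subst DK_right[OF True]) (simp add: mult.assoc dB_sq DK_dX)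
  then show ?thesis using True by (simp add: mop_def mult.assoc) (simp add: mult.assoc[symmetric] power_commutes)
next
  case False
  have "DK K * dB i = grassmann_sign K {i} *\<^sub>R DK (insert i K)"
    using False by (simp add: DK_swap DK_left grassmann_sign_swap)
  then show ?thesis using False by (simp add: mop_def mult.assoc)
qed

lemma dB_dX_power: "dB i * dX ^ c = dX ^ c * dB i"
  by (rule dX_power_commute) (rule dX_dB[symmetric])

lemma dB_mop: "dB i * mop A c K = mop (Dbar i A) c K + fm (sf_par A) * dX ^ c * (dB i * DK K)"
proof -
  have "dB i * mop A c K = (dB i * fm A) * dX ^ c * DK K" by (simp add: mop_def mult.assoc)
  then show ?thesis
    by (simp add: dB_fm mop_def distrib_right mult.assoc) (simp add: mult.assoc[symmetric] dB_dX_power)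
qed

text \<open>For \<open>i\<close> outside \<open>K\<close> the factor \<open>dB i\<close>
  supercommutes with \<open>DK K\<close>, so that only the coefficient is differentiated.\<close>

lemma dB_cj_mop:
  assumes "i \<notin> K"
  shows "dB i * cj True (mop A c K) - mop A c K * dB i = (- 1) ^ card K *\<^sub>R mop (Dbar i (sf_par A)) c K"
proof -
  have "dB i * cj True (mop A c K) = (- 1) ^ card K *\<^sub>R mop (Dbar i (sf_par A)) c K
      + fm A * dX ^ c * ((- 1) ^ card K *\<^sub>R (dB i * DK K))"
    by (simp add: cj_mop dB_mop scaleR_add_right)
  also have "(- 1) ^ card K *\<^sub>R (dB i * DK K) = DK K * dB i"
    using DK_swap[OF assms] by simp
  finally show ?thesis by (simp add: mop_def mult.assoc)
qed

abbreviation tI :: "'n::{finite,linorder} \<Rightarrow> 'n sfun endo \<Rightarrow> 'n sfun endo" where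
  "tI i \<equiv> tt (Some (Some i))"

lemma tI_mult: "tI i (D * E) = D * tI i E + tI i D * cj True E"
  by (simp add: tt_th cj_simps algebra_simps)

text \<open>\<open>ZZ\<close> fails to be a derivation because \<open>dB i\<close> squares to
  \<open>- dX\<close>: for \<open>D = E = dB i\<close> the last sum is -1, which is
  \<open>ZZ\<close> of \<open>- dX\<close>. On products of distinct \<open>dB\<close> it vanishes,
  \<open>ZZ_DK\<close>.\<close>

lemma ZZ_mult: "ZZ (D * E) = D * ZZ E + ZZ D * E + (\<Sum>i\<in>UNIV. tI i D * tI i (cj True E))"
proof -
  have e: "tI i (D * E) * th i = D * (tI i E * th i) + tI i D * th i * E + tI i D * tI i (cj True E)" for i
  proof -
    have "cj True E * th i = th i * E + tI i (cj True E)" by (simp add: tt_th cj_simps)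
    then show ?thesis by (simp add: tI_mult distrib_right mult.assoc) (simp add: distrib_left)
  qed
  show ?thesis
    unfolding ZZ_eq e sum.distrib
    by (simp add: algebra_simps sum_distrib_left sum_distrib_right)
qed

lemma tI_fm: "tI i (fm f) = 0" by (simp add: tt_th cj_fm fm_th)
lemma tI_one: "tI i 1 = 0" by (simp add: tt_th cj_simps)
lemma tI_dX: "tI i dX = 0" by (simp add: tt_th dX_th)
lemma tI_dX_power: "tI i (dX ^ c) = 0" by (induction c) (simp_all add: tI_one tI_mult tI_dX cj_simps)
lemma tI_dB: "tI i (dB j) = (if i = j then 1 else 0)"
  by (simp add: tt_th dB_th)

lemma tI_DK: "tI i (DK K) = (if i \<in> K then grassmann_sign (K - {i}) {i} *\<^sub>R DK (K - {i}) else 0)"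
proof -
  have 1: "tI i (DK K) = 0" if "i \<notin> K" for K :: "'a set"
    using finite[of K] that
  proof (induction K rule: finite_linorder_min_induct)
    case (insert m L)
    then have m: "\<And>j. j \<in> L \<Longrightarrow> m < j" by auto
    show ?case using insert by (simp add: DK_insert_min[OF m] tI_mult tI_dB)
  qed (simp add: tI_one)
  show ?thesis
  proof (cases "i \<in> K")
    case True
    show ?thesis
      by (subst DK_right[OF True]) (simp add: True tt_lin tI_mult tI_dB 1)
  qed (simp add: 1)
qed

lemma tI_mop: "tI i (mop A c K) = (if i \<in> K then grassmann_sign (K - {i}) {i} *\<^sub>R mop A c (K - {i}) else 0)"
  by (simp add: mop_def tI_mult tI_fm tI_dX_power tI_DK)

lemma ZZ_fm: "ZZ (fm f) = 0" by (simp add: ZZ_eq tI_fm xx_fm)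
lemma ZZ_one: "ZZ 1 = 0" by (simp add: ZZ_eq tI_one)
lemma ZZ_dX: "ZZ dX = 1" by (simp add: ZZ_eq tI_dX dX_xx)
lemma ZZ_dB: "ZZ (dB j) = 0"
proof -
  have "(\<Sum>i\<in>UNIV. tI i (dB j) * th i) = (\<Sum>i\<in>UNIV. if i = j then th i else 0)"
    by (intro sum.cong refl) (simp add: tI_dB)
  then show ?thesis by (simp add: ZZ_eq dB_xx)
qed
lemma ZZ_dX_power: "ZZ (dX ^ c) = real c *\<^sub>R dX ^ (c - 1)"
proof (induction c)
  case (Suc c)
  have "dX * (real c *\<^sub>R dX ^ (c - 1)) = real c *\<^sub>R (dX ^ c :: 'a sfun endo)"
    by (cases c) simp_all
  then show ?case by (simp add: ZZ_mult tI_dX Suc ZZ_dX algebra_simps)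
qed (simp add: ZZ_one)

lemma ZZ_DK: "ZZ (DK K) = 0"
  using finite[of K]
proof (induction K rule: finite_linorder_min_induct)
  case (insert m L)
  then have m: "\<And>j. j \<in> L \<Longrightarrow> m < j" "m \<notin> L" by auto
  have "(\<Sum>i\<in>UNIV. tI i (dB m) * tI i (cj True (DK L))) = 0"
    using m(2) by (intro sum.neutral) (auto simp: tI_dB cj_DK tt_lin tI_DK)
  then show ?case by (simp add: DK_insert_min[OF m(1)] ZZ_mult insert.IH ZZ_dB)
qed (simp add: ZZ_one)

lemma ZZ_mop: "ZZ (mop A c K) = real c *\<^sub>R mop A (c - 1) K"
  by (simp add: mop_def ZZ_mult tI_mult tI_fm tI_dX_power ZZ_fm ZZ_dX_power ZZ_DK mult.assoc)

lemma tI_mop_dB: "tI i (mop A c K) * dB i = (if i \<in> K then mop A c K else 0)"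
proof (cases "i \<in> K")
  case True
  have eq: "mop A c K = fm A * dX ^ c * (grassmann_sign (K - {i}) {i} *\<^sub>R (DK (K - {i}) * dB i))"
    by (simp add: mop_def flip: DK_right[OF True])
  show ?thesis
    by (simp only: tI_mop True if_True, subst eq) (simp add: mop_def mult.assoc)
qed (simp add: tI_mop)

lemma NN_eq: "NN D = ZZ D * dX + (\<Sum>i\<in>UNIV. tI i D * dB i)"
proof -
  have "tI i D * dT i = tI i D * dB i + tI i D * th i * dX" for i
    by (simp add: dB_def algebra_simps)
  then have "NN D = tt (Some None) D * dX + (\<Sum>i\<in>UNIV. tI i D * dB i) + (\<Sum>i\<in>UNIV. tI i D * th i) * dX"
    by (simp add: NN_def sum_idx sum.distrib sum_distrib_right)
  then show ?thesis by (simp add: ZZ_eq tt_def cj_simps algebra_simps)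
qed

lemma NN_mop: "NN (mop A c K) = (real c + real (card K)) *\<^sub>R mop A c K"
proof -
  have "ZZ (mop A c K) * dX = real c *\<^sub>R mop A c K"
    by (cases c) (simp_all add: ZZ_mop mop_dX)
  moreover have "(\<Sum>i\<in>UNIV. if i \<in> K then mop A c K else 0) = real (card K) *\<^sub>R mop A c K"
    by (simp add: sum.If_cases sum_constant_scaleR del: sum_constant)
  ultimately show ?thesis by (simp add: NN_eq tI_mop_dB algebra_simps)
qed

section \<open>Spans of monomials and the leading terms of the Casimirs\<close>

definition Sp :: "(nat \<times> 'n set) set \<Rightarrow> 'n::{finite,linorder} sfun endo set" where
  "Sp V = span {mop A c K | A c K. (c, K) \<in> V}"

text \<open>\<open>wt 1 1\<close> is the order and \<open>wt 2 1\<close> twice the Heisenberg order.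
  Leading terms are computed for general weights so that both filtrations are served at
  once.\<close>

definition wt :: "nat \<Rightarrow> nat \<Rightarrow> nat \<times> 'n set \<Rightarrow> nat" where
  "wt a b v = a * fst v + b * card (snd v)"

lemma Sp_mop: "(c, K) \<in> V \<Longrightarrow> mop A c K \<in> Sp V"
  unfolding Sp_def by (rule span_base) auto

lemma Sp_closed:
  "D \<in> Sp V \<Longrightarrow> E \<in> Sp V \<Longrightarrow> D + E \<in> Sp V" "D \<in> Sp V \<Longrightarrow> E \<in> Sp V \<Longrightarrow> D - E \<in> Sp V"
  "D \<in> Sp V \<Longrightarrow> r *\<^sub>R D \<in> Sp V" "0 \<in> Sp V" "D \<in> Sp V \<Longrightarrow> - D \<in> Sp V"
  "(\<And>x. x \<in> X \<Longrightarrow> f x \<in> Sp V) \<Longrightarrow> sum f X \<in> Sp V"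
  unfolding Sp_def by (auto intro: span_add span_diff span_scale span_zero span_neg span_sum)

lemma Sp_mono: "V \<subseteq> W \<Longrightarrow> D \<in> Sp V \<Longrightarrow> D \<in> Sp W"
  unfolding Sp_def by (rule subsetD[OF span_mono]) auto

lemma Sp_induct [consumes 1, case_names mop add scaleR zero]:
  assumes "D \<in> Sp V" "\<And>A c K. (c, K) \<in> V \<Longrightarrow> P (mop A c K)"
    "\<And>D E. D \<in> Sp V \<Longrightarrow> E \<in> Sp V \<Longrightarrow> P D \<Longrightarrow> P E \<Longrightarrow> P (D + E)"
    "\<And>r D. D \<in> Sp V \<Longrightarrow> P D \<Longrightarrow> P (r *\<^sub>R D)" "P 0"
  shows "P D"
proof -
  have "D \<in> Sp V \<and> P D"
    using assms(1) unfolding Sp_def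
  proof (induction rule: span_induct_alt)
    case base
    then show ?case using assms(5) by (simp add: span_zero)
  next
    case (step r x y)
    then obtain A c K where x: "x = mop A c K" "(c, K) \<in> V" by auto
    have x': "r *\<^sub>R x \<in> Sp V" "P (r *\<^sub>R x)"
      using x assms(2) assms(4)[OF Sp_mop] by (auto intro: Sp_closed Sp_mop)
    have y: "y \<in> Sp V" "P y" using step by (auto simp: Sp_def)
    show ?case using assms(3)[OF x'(1) y(1) x'(2) y(2)] Sp_closed(1)[OF x'(1) y(1)] by (simp add: Sp_def)
  qed
  then show ?thesis by blast
qed

lemma Sp_linear_image:
  assumes "D \<in> Sp V" "linear f" "\<And>A c K. (c, K) \<in> V \<Longrightarrow> f (mop A c K) \<in> Sp W"
  shows "f D \<in> Sp W"
  using assms(1)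
  by (induction rule: Sp_induct)
    (auto simp: assms linear_add[OF assms(2)] linear_cmul[OF assms(2)] linear_0[OF assms(2)] Sp_closed)

abbreviation Low :: "nat \<Rightarrow> nat \<Rightarrow> nat \<Rightarrow> 'n::{finite,linorder} sfun endo set" where
  "Low a b n \<equiv> Sp {v. wt a b v < n}"

lemma mop_uminus: "mop (- A) c K = - mop A c K"
  using mop_lin(2)[of "- 1" A c K] by simp

lemma dX_commutator_mop: "dX * mop A c K - mop A c K * dX = mop (sf_dx A) c K"
  by (simp add: dX_mop mop_dX)

lemma card_SucE:
  assumes "i \<in> (K :: 'n::finite set)"
  obtains q where "card K = Suc q" "card (K - {i}) = q"
  using that[OF card.remove[OF finite assms] refl] .

lemma GG_x: "GG (Some None) D = ZZ D - (\<Sum>i\<in>UNIV. th i * cj True (tI i D))"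
proof -
  have "tI i D * th i = th i * cj True (tI i D)" for i
    by (simp add: tt_th cj_simps algebra_simps) (simp add: mult.assoc[symmetric] th_sq)
  then show ?thesis by (simp add: ZZ_eq tt_def cj_simps)
qed

lemma GG_theta: "GG (Some (Some i)) D = - cj True (tI i D)"
  using tt_tw[of "Some (Some i)" "Some (Some i)" D] by simp

lemma NN_Sp:
  assumes "D \<in> Sp {v. real (wt 1 1 v) = q}" shows "NN D = q *\<^sub>R D"
  using assms by (induction rule: Sp_induct) (auto simp: NN_mop NN_lin wt_def algebra_simps)

lemma GG_mop_Sp: "GG j (mop A c K) \<in> Sp {v. real (wt 1 1 v) = real c + real (card K) - 1}"
proof -
  have t: "fm f * cj True (tI i (mop A c K)) \<in> Sp {v. real (wt 1 1 v) = real c + real (card K) - 1}" for f i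
  proof (cases "i \<in> K")
    case True
    then obtain q where q: "card K = Suc q" "card (K - {i}) = q" by (rule card_SucE)
    show ?thesis using True
      by (auto simp: tI_mop cj_simps cj_mop fm_mop q wt_def intro!: Sp_closed Sp_mop)
  qed (simp add: tI_mop cj_simps Sp_closed)
  show ?thesis
  proof (cases j rule: idx_cases)
    case 2
    have "ZZ (mop A c K) \<in> Sp {v. real (wt 1 1 v) = real c + real (card K) - 1}"
      by (cases c) (auto simp: ZZ_mop wt_def intro!: Sp_closed Sp_mop)
    then show ?thesis unfolding 2 GG_x by (intro Sp_closed t)
  next
    case (3 i)
    show ?thesis unfolding 3 GG_theta using t[of 1 i] by (simp add: fm_hom Sp_closed)
  qed (simp add: Sp_closed)
qed

text \<open>With the derivative on the right of \<open>GG\<close> instead of the left, the sum would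
  be \<open>NN\<close>, which gives the order. Exchanging the two factors only differentiates
  coefficients, and \<open>GG\<close> has already removed a moment, so the difference has lower
  weight.\<close>

lemma GG_sum_mop:
  fixes A :: "'n::{finite,linorder} sfun"
  assumes "1 \<le> a" "1 \<le> b"
  shows "(\<Sum>j\<in>UNIV. sg j j *\<^sub>R (pp l j * GG j (mop A c K))) - (real c + real (card K)) *\<^sub>R mop A c K
    \<in> Low a b (wt a b (c, K))"
proof -
  define D where "D = mop A c K"
  have "(\<Sum>j\<in>UNIV. sg j j *\<^sub>R (pp l j * GG j D)) - NN D
    = (dX * GG (Some None) D - GG (Some None) D * dX) + (\<Sum>i\<in>UNIV. dT i * cj True (tI i D) - tI i D * dT i)"
  proof -
    have "tt (Some None) D = GG (Some None) D" by (simp add: cj_simps)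
    then have "NN D = GG (Some None) D * dX + (\<Sum>i\<in>UNIV. tI i D * dT i)"
      by (simp add: NN_def sum_idx)
    moreover have "(\<Sum>j\<in>UNIV. sg j j *\<^sub>R (pp l j * GG j D)) = dX * GG (Some None) D + (\<Sum>i\<in>UNIV. dT i * cj True (tI i D))"
      unfolding sum_idx GG_theta by (simp add: cj_simps tt_lin sum_negf)
    ultimately show ?thesis by (simp add: sum_subtractf algebra_simps)
  qed
  also have "\<dots> \<in> Low a b (wt a b (c, K))"
  proof (intro Sp_closed(1,6))
    have t: "dX * (th i * cj True (tI i D)) - th i * cj True (tI i D) * dX \<in> Low a b (wt a b (c, K))" for i
    proof (cases "i \<in> K")
      case True
      then obtain q where q: "card K = Suc q" "card (K - {i}) = q" by (rule card_SucE)
      show ?thesis using True assms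
        by (auto simp: D_def tI_mop cj_simps cj_mop fm_mop dX_commutator_mop wt_def q
          simp flip: scaleR_diff_right intro!: Sp_closed Sp_mop)
    qed (simp add: D_def tI_mop cj_simps Sp_closed)
    have z: "dX * ZZ D - ZZ D * dX \<in> Low a b (wt a b (c, K))"
      using assms
      by (cases c) (auto simp: D_def ZZ_mop dX_commutator_mop wt_def
          simp flip: scaleR_diff_right intro!: Sp_closed Sp_mop)
    have "dX * GG (Some None) D - GG (Some None) D * dX = (dX * ZZ D - ZZ D * dX)
        - (\<Sum>i\<in>UNIV. dX * (th i * cj True (tI i D)) - th i * cj True (tI i D) * dX)"
      unfolding GG_x by (simp add: right_diff_distrib left_diff_distrib sum_distrib_left sum_distrib_right sum_subtractf)
    then show "dX * GG (Some None) D - GG (Some None) D * dX \<in> Low a b (wt a b (c, K))"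
      using Sp_closed(2)[OF z Sp_closed(6)[OF t]] by simp
    have dT: "dT i * cj True (mop B c (K - {i})) - mop B c (K - {i}) * dT i \<in> Low a b (wt a b (c, K))"
      if "i \<in> K" for i B
    proof -
      obtain q where q: "card K = Suc q" "card (K - {i}) = q" using \<open>i \<in> K\<close> by (rule card_SucE)
      let ?H = "mop B c (K - {i})"
      \<comment> \<open>\<open>?H\<close> contains no \<open>dB i\<close> and therefore
        supercommutes with \<open>th i\<close>.\<close>
      have "?H * th i = th i * cj True ?H" using tI_mop[of i B c "K - {i}"] by (simp add: tt_th)
      then have "?H * (th i * dX) = th i * cj True ?H * dX" by (simp add: mult.assoc[symmetric])
      then have "dT i * cj True ?H - ?H * dT i = (dB i * cj True ?H - ?H * dB i)
          + th i * (dX * cj True ?H - cj True ?H * dX)"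
        by (simp add: dB_def algebra_simps)
      also have "dB i * cj True ?H - ?H * dB i = (- 1) ^ card (K - {i}) *\<^sub>R mop (Dbar i (sf_par B)) c (K - {i})"
        by (rule dB_cj_mop) simp
      also have "(- 1) ^ card (K - {i}) *\<^sub>R mop (Dbar i (sf_par B)) c (K - {i})
          + th i * (dX * cj True ?H - cj True ?H * dX) \<in> Low a b (wt a b (c, K))"
        using that assms
        by (auto simp: cj_mop fm_mop dX_commutator_mop wt_def q
          simp flip: scaleR_diff_right intro!: Sp_closed Sp_mop)
      finally show ?thesis .
    qed
    show "dT i * cj True (tI i D) - tI i D * dT i \<in> Low a b (wt a b (c, K))" for i
    proof (cases "i \<in> K")
      case True
      then have "dT i * cj True (tI i D) - tI i D * dT i = grassmann_sign (K - {i}) {i} *\<^sub>R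
          (dT i * cj True (mop A c (K - {i})) - mop A c (K - {i}) * dT i)"
        by (simp add: D_def tI_mop cj_simps scaleR_diff_right)
      then show ?thesis using Sp_closed(3)[OF dT[OF True]] by simp
    qed (simp add: D_def tI_mop cj_simps Sp_closed)
  qed
  finally show ?thesis by (simp add: D_def NN_mop)
qed

text \<open>
  The scalar by which \<open>Phi\<close> acts on monomials of order \<open>k\<close> modulo lower order, where \<open>n = CARD('n)\<close>.
\<close>

definition al :: "real \<Rightarrow> real \<Rightarrow> real \<Rightarrow> real \<Rightarrow> real" where
  "al n l l' k = - ((1 - n - l') * (l + k)) - k - (l + k - 1) * k"

lemma Phi_mop:
  fixes A :: "'n::{finite,linorder} sfun"
  assumes "1 \<le> a" "1 \<le> b"
  shows "Phi l l' (mop A c K) - al (real CARD('n)) l l' (real c + real (card K)) *\<^sub>R mop A c K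
    \<in> Low a b (wt a b (c, K))"
proof -
  define k where "k = real c + real (card K)"
  define D where "D = mop A c K"
  define T where "T = (\<Sum>j\<in>UNIV. sg j j *\<^sub>R (pp l' j * GG j D))"
  have N: "NN D = k *\<^sub>R D" by (simp add: D_def NN_mop k_def)
  have NG: "NN (GG j D) = (k - 1) *\<^sub>R GG j D" for j
    unfolding D_def k_def by (intro NN_Sp GG_mop_Sp)
  have "Phi l l' D = (1 - real CARD('n) - l') *\<^sub>R (- (l *\<^sub>R D) - k *\<^sub>R D) - k *\<^sub>R D - (l + k - 1) *\<^sub>R T"
    unfolding Phi_eq N NG T_def by (simp add: scaleR_sum_right algebra_simps)
  then have "Phi l l' D - al (real CARD('n)) l l' k *\<^sub>R D = - ((l + k - 1) *\<^sub>R (T - k *\<^sub>R D))"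
    by (simp add: al_def algebra_simps)
  also have "\<dots> \<in> Low a b (wt a b (c, K))"
    using GG_sum_mop[OF assms, of l' A c K] by (intro Sp_closed(3,5)) (simp add: T_def D_def k_def)
  finally show ?thesis by (simp add: D_def k_def)
qed

text \<open>The operator whose symbol is \<open>Delta\<close> of the monomial with coefficient
  \<open>A\<close> and index \<open>(c, K)\<close>; see \<open>dif_Delta_single\<close>.\<close>

definition DD :: "'n::{finite,linorder} sfun \<Rightarrow> nat \<Rightarrow> 'n set \<Rightarrow> 'n sfun endo" where
  "DD A c K = (\<Sum>i\<in>- K. grassmann_sign {i} K *\<^sub>R mop (sf_par (Dbar i (real c *\<^sub>R A))) (c - 1) (insert i K))"

lemma par_Dbar: "sf_par (Dbar i f) = - Dbar i (sf_par f)"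
  using par_Dbar_par[of i "sf_par f"] by (simp add: Dbar_def par_dx)

lemma sf_zero_simps [simp]: "Dbar i 0 = 0" "sf_par 0 = 0" "sf_dx 0 = 0"
  using app_arg(1)[of "dB i"] app_arg(1)[of PP] app_arg(1)[of dX]
  unfolding app_dB app_PP app_dX by auto

text \<open>By \<open>Psi_eq\<close> and \<open>contact_form\<close> everything is expressed through
  \<open>F = ZZ D\<close>, and \<open>F * dX\<close> is \<open>c\<close> times \<open>D\<close>. The
  term \<open>DD\<close> has the same order as \<open>D\<close> but smaller Heisenberg order, so it
  is part of the leading term for the weights \<open>1 1\<close> and negligible for
  \<open>2 1\<close>.\<close>

lemma Psi_mop:
  fixes A :: "'n::{finite,linorder} sfun"
  assumes "1 \<le> b" "b \<le> a"
  shows "Psi l l' (mop A c K) - ((- (real c * (real c + l - l' + 1)) - l) *\<^sub>R mop A c K - DD A c K)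
    \<in> Low a b (wt a b (c, K))"
proof (cases c)
  case 0
  have "ZZ (mop A 0 K) = 0" by (simp add: ZZ_mop)
  moreover have "DD A 0 K = 0" by (simp add: DD_def mop_lin)
  ultimately show ?thesis using 0 by (simp add: Psi_eq cj_simps Sp_closed)
next
  case (Suc e)
  let ?L = "Low a b (wt a b (c, K)) :: 'n sfun endo set"
  define D where "D = mop A c K"
  define B where "B = real c *\<^sub>R A"
  define F where "F = mop B e K"
  have F: "ZZ D = F" using Suc by (simp add: D_def F_def B_def ZZ_mop mop_lin)
  have FX: "F * dX = real c *\<^sub>R D" using Suc by (simp add: D_def F_def B_def mop_dX mop_lin)
  have 1: "dX * ZZ F * dX - real e *\<^sub>R (F * dX) \<in> ?L"
  proof -
    have "dX * ZZ F * dX - real e *\<^sub>R (F * dX) = real e *\<^sub>R mop (sf_dx B) e K"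
      by (cases e) (simp_all add: F_def ZZ_mop dX_mop mop_dX distrib_right scaleR_add_right)
    then show ?thesis using assms Suc by (auto simp: wt_def intro!: Sp_closed Sp_mop)
  qed
  have 2: "dX * F - F * dX \<in> ?L"
    unfolding F_def dX_commutator_mop using assms Suc by (auto simp: wt_def intro!: Sp_mop)
  define R where "R i = (dX * tI i F * dB i + dB i * cj True (tI i F) * dX - dB i * cj True F * dB i)" for i
  define E where "E i = (if i \<in> K then 0 else
      grassmann_sign {i} K *\<^sub>R mop (sf_par (Dbar i B)) e (insert i K))" for i
  \<comment> \<open>Each of the \<open>n\<close> indices contributes \<open>F * dX\<close>, which
    compensates the \<open>- n\<close> in \<open>contact_form\<close>. Only the indices outside
    \<open>K\<close> leave a further leading term, the summand \<open>E i\<close> of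
    \<open>DD\<close>.\<close>
  have R: "R i - (F * dX + E i) \<in> ?L" for i
  proof (cases "i \<in> K")
    case True
    \<comment> \<open>For \<open>i\<close> in \<open>K\<close> the operator \<open>F\<close> factors
      as \<open>H * dB i\<close>, so that a product \<open>dB i * dB i\<close> appears and can be
      replaced by \<open>- dX\<close>.\<close>
    define H where "H = tI i F"
    have H: "H * dB i = F" using tI_mop_dB[of i B e K] True by (simp add: H_def F_def)
    have Hm: "H = grassmann_sign (K - {i}) {i} *\<^sub>R mop B e (K - {i})"
      using True by (simp add: H_def F_def tI_mop)
    define l1 where "l1 = dB i * cj True H - H * dB i"
    have l1: "l1 = (grassmann_sign (K - {i}) {i} * (- 1) ^ card (K - {i})) *\<^sub>R mop (Dbar i (sf_par B)) e (K - {i})"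
      using dB_cj_mop[of i "K - {i}" B e] by (simp add: l1_def Hm cj_simps flip: scaleR_diff_right)
    have a: "dX * H * dB i = F * dX + (dX * F - F * dX)" by (simp add: mult.assoc H)
    have b: "dB i * cj True H = F + l1" by (simp add: l1_def H)
    have "cj True F = - (cj True H * dB i)" by (simp add: H[symmetric] cj_simps)
    then have "dB i * cj True F * dB i = - ((dB i * cj True H) * (dB i * dB i))" by (simp add: mult.assoc)
    then have c: "dB i * cj True F * dB i = F * dX + l1 * dX" unfolding b dB_sq by (simp add: algebra_simps)
    have eq: "R i - (F * dX + E i) = (dX * F - F * dX)"
      unfolding R_def H_def[symmetric] a b c using True by (simp add: E_def algebra_simps)
    show ?thesis unfolding eq by (rule 2)
  next
    case False
    then have t: "tI i F = 0" by (simp add: F_def tI_mop)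
    have s: "(- 1) ^ card K * grassmann_sign K {i} = grassmann_sign {i} K"
      by (simp add: grassmann_sign_swap[OF False] mult.assoc[symmetric] flip: power_mult_distrib)
    have "dB i * cj True F = F * dB i + (- 1) ^ card K *\<^sub>R mop (Dbar i (sf_par B)) e K"
      using dB_cj_mop[OF False, of B e] by (simp add: F_def algebra_simps)
    then have "dB i * cj True F * dB i = F * (dB i * dB i) + (- 1) ^ card K *\<^sub>R (mop (Dbar i (sf_par B)) e K * dB i)"
      by (simp add: distrib_right mult.assoc)
    also have "\<dots> = - (F * dX) - E i"
      using False s by (simp add: dB_sq mop_dB E_def par_Dbar mop_uminus)
    finally have "dB i * cj True F * dB i = - (F * dX) - E i" .
    then show ?thesis by (simp add: R_def t cj_simps Sp_closed)
  qed
  have EE: "(\<Sum>i\<in>UNIV. E i) = DD A c K"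
    unfolding DD_def using Suc
    by (subst sum.inter_restrict[of UNIV _ "- K", simplified]) (auto simp: E_def B_def intro!: sum.cong)
  have "Psi l l' D - ((- (real c * (real c + l - l' + 1)) - l) *\<^sub>R D - DD A c K)
    = - ((dX * ZZ F * dX - real e *\<^sub>R (F * dX)) + (\<Sum>i\<in>UNIV. R i - (F * dX + E i)) + l *\<^sub>R (dX * F - F * dX))"
  proof -
    have n: "(\<Sum>i\<in>UNIV. R i - (F * dX + E i)) = (\<Sum>i\<in>UNIV. R i) - real CARD('n) *\<^sub>R (F * dX) - DD A c K"
      by (simp add: sum_subtractf sum.distrib EE sum_constant_scaleR del: sum_constant)
    have P: "Psi l l' D = - ((1 + l - l' - real CARD('n)) *\<^sub>R (F * dX) + dX * ZZ F * dX
      + (\<Sum>i\<in>UNIV. R i) + l *\<^sub>R (dX * F - F * dX)) - l *\<^sub>R D - F * dX"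
      unfolding Psi_eq F contact_form R_def ..
    have cc: "real c = real e + 1" using Suc by simp
    have "(r * 3) *\<^sub>R D = r *\<^sub>R D + r *\<^sub>R D + r *\<^sub>R D" "(r * 2) *\<^sub>R D = r *\<^sub>R D + r *\<^sub>R D" for r
      by (simp_all flip: scaleR_add_left)
    then show ?thesis
      unfolding n P unfolding FX cc by (simp add: algebra_simps scaleR_2)
  qed
  also have "\<dots> \<in> ?L"
    by (intro Sp_closed 1 2 R)
  finally show ?thesis by (simp add: D_def)
qed

section \<open>Filtrations\<close>

abbreviation Fil :: "nat \<Rightarrow> nat \<Rightarrow> nat \<Rightarrow> 'n::{finite,linorder} sfun endo set" where
  "Fil a b n \<equiv> Sp {v. wt a b v \<le> n}"

lemma Fil_mono: "m \<le> n \<Longrightarrow> D \<in> Fil a b m \<Longrightarrow> D \<in> Fil a b n"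
  by (rule Sp_mono) auto

lemma linear_mult_left: "linear (\<lambda>E. D * (E :: 'r::real_algebra))"
  and linear_mult_right: "linear (\<lambda>E. E * (D :: 'r::real_algebra))"
  by (simp_all add: linear_iff algebra_simps)

lemma Fil_fm: "D \<in> Sp V \<Longrightarrow> fm f * D \<in> Sp V"
  by (erule Sp_linear_image[OF _ linear_mult_left]) (simp add: fm_mop Sp_mop)

lemma Fil_cj: "D \<in> Sp V \<Longrightarrow> cj p D \<in> Sp V"
proof (erule Sp_linear_image)
  show "linear (cj p)" by (simp add: linear_iff cj_simps)
  show "(c, K) \<in> V \<Longrightarrow> cj p (mop A c K) \<in> Sp V" for A c K
    by (cases p) (auto simp: cj_mop cj_simps intro!: Sp_closed Sp_mop)
qed

lemma Fil_dX: "D \<in> Fil a b n \<Longrightarrow> dX * D \<in> Fil a b (n + a)"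
  by (erule Sp_linear_image[OF _ linear_mult_left])
    (auto simp: dX_mop wt_def intro!: Sp_closed Sp_mop)

text \<open>When \<open>i\<close> already lies in \<open>K\<close>, the pair of factors
  \<open>dB i\<close> of weight \<open>2 * b\<close> becomes \<open>- dX\<close> of weight
  \<open>a\<close>; this is where \<open>a \<le> 2 * b\<close> enters.\<close>

lemma Fil_dB:
  assumes "D \<in> Fil a b n" "b \<le> a" "a \<le> 2 * b"
  shows "dB i * D \<in> Fil a b (n + b)"
  using assms(1)
proof (rule Sp_linear_image[OF _ linear_mult_left])
  fix A c and K :: "'a set"
  assume v: "(c, K) \<in> {v. wt a b v \<le> n}"
  have "fm (sf_par A) * dX ^ c * (dB i * DK K) \<in> Fil a b (n + b)"
  proof (cases "i \<in> K")
    case True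
    then obtain q where q: "card K = Suc q" "card (K - {i}) = q" by (rule card_SucE)
    have "dB i * DK K = - (grassmann_sign {i} (K - {i}) *\<^sub>R (dX * DK (K - {i})))"
    proof -
      have "grassmann_sign {i} (K - {i}) *\<^sub>R (dB i * DK (K - {i})) = DK K"
        using True by (simp add: DK_left insert_absorb)
      then have "dB i * DK K = dB i * (grassmann_sign {i} (K - {i}) *\<^sub>R (dB i * DK (K - {i})))" by simp
      also have "\<dots> = grassmann_sign {i} (K - {i}) *\<^sub>R ((dB i * dB i) * DK (K - {i}))"
        by (simp add: mult.assoc)
      finally show ?thesis by (simp add: dB_sq)
    qed
    then have "fm (sf_par A) * dX ^ c * (dB i * DK K) = - (grassmann_sign {i} (K - {i}) *\<^sub>R mop (sf_par A) (Suc c) (K - {i}))"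
      by (simp add: mop_def mult.assoc) (simp add: mult.assoc[symmetric] power_commutes)
    then show ?thesis using v assms True by (auto simp: q wt_def intro!: Sp_closed Sp_mop)
  next
    case False
    then have "fm (sf_par A) * dX ^ c * (dB i * DK K) = grassmann_sign {i} K *\<^sub>R mop (sf_par A) c (insert i K)"
      by (simp add: DK_left mop_def)
    then show ?thesis using v assms False by (auto simp: wt_def intro!: Sp_closed Sp_mop)
  qed
  then show "dB i * mop A c K \<in> Fil a b (n + b)"
    using v by (auto simp: dB_mop wt_def intro!: Sp_closed Sp_mop)
qed

lemma fm_eq_mop: "fm f = mop f 0 {}" and dX_eq_mop: "dX = mop 1 1 {}" and dB_eq_mop: "dB i = mop 1 0 {i}"
  using DK_left[of i "{}"] by (simp_all add: mop_def fm_hom)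

lemma Fil_gens: "fm f \<in> Fil a b 0" "dX \<in> Fil a b a" "dB i \<in> Fil a b b"
  unfolding fm_eq_mop dX_eq_mop dB_eq_mop by (rule Sp_mop; simp add: wt_def)+

lemma DK_induct [case_names empty insert]:
  fixes K :: "'n::{finite,linorder} set"
  assumes "P {} 1" "\<And>i K. i \<notin> K \<Longrightarrow> P K (DK K) \<Longrightarrow> P (insert i K) (dB i * DK K)"
  shows "P K (DK K)"
  using finite[of K]
proof (induction K rule: finite_linorder_min_induct)
  case (insert m L)
  then have m: "\<And>j. j \<in> L \<Longrightarrow> m < j" "m \<notin> L" by auto
  show ?case using assms(2)[OF m(2) insert.IH] by (simp only: DK_insert_min[OF m(1)])
qed (simp add: assms(1))

lemma Fil_mult:
  assumes "D \<in> Fil a b m" "E \<in> Fil a b n" "b \<le> a" "a \<le> 2 * b"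
  shows "D * E \<in> Fil a b (m + n)"
  using assms(1)
proof (rule Sp_linear_image[OF _ linear_mult_right])
  fix A c and K :: "'a set"
  assume v: "(c, K) \<in> {v. wt a b v \<le> m}"
  have 1: "DK K * E \<in> Fil a b (n + b * card K)"
  proof (induction K rule: DK_induct)
    case (insert i K)
    have "dB i * (DK K * E) \<in> Fil a b ((n + b * card K) + b)" by (rule Fil_dB[OF insert(2) assms(3,4)])
    then show ?case using insert(1) by (simp add: mult.assoc algebra_simps)
  qed (use assms in simp)
  have 2: "dX ^ c * (DK K * E) \<in> Fil a b (n + b * card K + a * c)"
  proof (induction c)
    case (Suc c)
    show ?case using Fil_dX[OF Suc] by (simp add: mult.assoc algebra_simps)
  qed (use 1 in simp)
  have "fm A * (dX ^ c * (DK K * E)) \<in> Fil a b (m + n)"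
    by (rule Fil_fm[OF Fil_mono[OF _ 2]]) (use v in \<open>simp add: wt_def\<close>)
  then show "mop A c K * E \<in> Fil a b (m + n)" by (simp add: mop_def mult.assoc)
qed

text \<open>Supercommutation with all superfunctions is carried along with the parity. Both
  properties pass to products, so they have to be verified only for the coordinates.\<close>

definition homogeneous_sf :: "bool \<Rightarrow> 'n::{finite,linorder} sfun \<Rightarrow> bool" where
  "homogeneous_sf p f \<longleftrightarrow> sf_par f = (if p then - f else f) \<and> (\<forall>A. f * A = (if p then sf_par A else A) * f)"

lemma par_simps: "sf_par (f + g) = sf_par f + sf_par g" "sf_par (- f) = - sf_par f" "sf_par (r *\<^sub>R f) = r *\<^sub>R sf_par f"
  "sf_par 0 = 0" "sf_par (f * g) = sf_par f * sf_par g"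
  using par_lin(2)[of 0 0] by (simp_all add: sf_par_mult sf_par_add par_lin)

lemma hpI: "sf_par f = (if p then - f else f) \<Longrightarrow> (\<And>A. f * A = (if p then sf_par A else A) * f) \<Longrightarrow> homogeneous_sf p f"
  by (simp add: homogeneous_sf_def)

lemma hpD: "homogeneous_sf p f \<Longrightarrow> sf_par f = (if p then - f else f)" "homogeneous_sf p f \<Longrightarrow> f * A = (if p then sf_par A else A) * f"
  by (simp_all add: homogeneous_sf_def)

lemma homogeneous_sf_mult:
  assumes f: "homogeneous_sf p f" and g: "homogeneous_sf q g" shows "homogeneous_sf (p \<noteq> q) (f * g)"
proof (rule hpI)
  show "sf_par (f * g) = (if p \<noteq> q then - (f * g) else f * g)"
    using hpD(1)[OF f] hpD(1)[OF g] by (auto simp: par_simps)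
  fix A :: "'a sfun"
  let ?B = "if q then sf_par A else A"
  have "f * g * A = f * (?B * g)" by (simp only: mult.assoc hpD(2)[OF g, of A])
  also have "\<dots> = (if p then sf_par ?B else ?B) * f * g"
    by (simp only: mult.assoc[symmetric] hpD(2)[OF f, of ?B])
  finally show "f * g * A = (if p \<noteq> q then sf_par A else A) * (f * g)" by (auto simp: mult.assoc)
qed

lemma homogeneous_sf_lin: "homogeneous_sf p f \<Longrightarrow> homogeneous_sf p g \<Longrightarrow> homogeneous_sf p (f + g)" "homogeneous_sf p f \<Longrightarrow> homogeneous_sf p (r *\<^sub>R f)" "homogeneous_sf p 0"
proof -
  assume f: "homogeneous_sf p f"
  show "homogeneous_sf p (r *\<^sub>R f)"
  proof (rule hpI)
    fix A :: "'a sfun" show "r *\<^sub>R f * A = (if p then sf_par A else A) * r *\<^sub>R f"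
      unfolding mult_scaleR_left hpD(2)[OF f, of A] by simp
  qed (simp add: par_simps hpD(1)[OF f])
  assume g: "homogeneous_sf p g"
  show "homogeneous_sf p (f + g)"
  proof (rule hpI)
    fix A :: "'a sfun" show "(f + g) * A = (if p then sf_par A else A) * (f + g)"
      unfolding distrib_right hpD(2)[OF f, of A] hpD(2)[OF g, of A] by (simp only: distrib_left)
  qed (simp add: par_simps hpD(1)[OF f] hpD(1)[OF g])
qed (rule hpI; simp)

lemma homogeneous_sf_gens: "homogeneous_sf False 1" "homogeneous_sf False sf_x" "homogeneous_sf True (sf_theta i)"
proof -
  have "sf_theta i * A = sf_par A * sf_theta i" for A using times_theta[of "sf_par A" i] by simp
  then show "homogeneous_sf False 1" "homogeneous_sf False sf_x" "homogeneous_sf True (sf_theta i)"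
    by (auto simp: homogeneous_sf_def sf_x_central)
qed

section \<open>First-order operators in the contact frame\<close>

definition VF :: "'n::{finite,linorder} sfun \<Rightarrow> ('n \<Rightarrow> 'n sfun) \<Rightarrow> 'n sfun \<Rightarrow> 'n sfun endo" where
  "VF f g h = fm f * dX + (\<Sum>i\<in>UNIV. fm (g i) * dB i) + fm h"

definition vf_hom :: "bool \<Rightarrow> 'n::{finite,linorder} sfun \<Rightarrow> ('n \<Rightarrow> 'n sfun) \<Rightarrow> 'n sfun \<Rightarrow> bool" where
  "vf_hom p f g h \<longleftrightarrow> homogeneous_sf p f \<and> (\<forall>i. homogeneous_sf (\<not> p) (g i)) \<and> homogeneous_sf p h"

text \<open>The vanishing of the coefficient of \<open>dX\<close> in the supercommutator with
  \<open>dB j\<close>, \<open>VF_dB\<close>: the field preserves the contact distribution spanned by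
  the \<open>dB\<close>.\<close>

definition is_contact :: "bool \<Rightarrow> 'n::{finite,linorder} sfun \<Rightarrow> ('n \<Rightarrow> 'n sfun) \<Rightarrow> bool" where
  "is_contact p f g \<longleftrightarrow> (\<forall>j. 2 *\<^sub>R g j + (if p then - 1 else 1) *\<^sub>R Dbar j f = 0)"

lemma VF_fm:
  assumes "vf_hom p f g h"
  shows "VF f g h * fm A - cj p (fm A) * VF f g h = fm (f * sf_dx A + (\<Sum>i\<in>UNIV. g i * Dbar i A))"
proof -
  define B where "B = (if p then sf_par A else A)"
  have 1: "f * A = B * f" "h * A = B * h" using assms by (auto simp: vf_hom_def homogeneous_sf_def B_def)
  have 2: "g i * sf_par A = B * g i" for i
    using assms by (auto simp: vf_hom_def homogeneous_sf_def B_def)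
  have fmh: "fm f * fm A = fm B * fm f" "fm h * fm A = fm B * fm h" "fm (g i) * fm (sf_par A) = fm B * fm (g i)" for i
    by (simp_all add: fm_hom[symmetric] 1 2)
  have "VF f g h * fm A = fm f * (dX * fm A) + (\<Sum>i\<in>UNIV. fm (g i) * (dB i * fm A)) + fm h * fm A"
    by (simp add: VF_def distrib_right sum_distrib_right mult.assoc)
  also have "\<dots> = (fm f * fm A) * dX + fm f * fm (sf_dx A) + (\<Sum>i\<in>UNIV. (fm (g i) * fm (sf_par A)) * dB i + fm (g i) * fm (Dbar i A)) + fm h * fm A"
    by (simp add: dX_fm dB_fm distrib_left mult.assoc)
  also have "\<dots> = fm B * VF f g h + fm (f * sf_dx A + (\<Sum>i\<in>UNIV. g i * Dbar i A))"
    unfolding fmh by (simp add: VF_def distrib_left sum_distrib_left sum.distrib fm_hom fm_sum mult.assoc)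
  finally show ?thesis by (simp add: cj_fm B_def)
qed

lemma VF_dX: "VF f g h * dX - dX * VF f g h = - VF (sf_dx f) (\<lambda>i. sf_dx (g i)) (sf_dx h)"
proof -
  have 1: "dX * (fm f * dX) = fm f * dX * dX + fm (sf_dx f) * dX" for f
    by (simp add: mult.assoc[symmetric] dX_fm distrib_right)
  have 2: "dX * (fm f * dB i) = fm f * dB i * dX + fm (sf_dx f) * dB i" for f i
    by (simp add: mult.assoc[symmetric] dX_fm distrib_right) (simp add: mult.assoc dX_dB)
  show ?thesis
    unfolding VF_def distrib_left distrib_right sum_distrib_left sum_distrib_right 1 2 dX_fm sum.distrib
    by (simp add: algebra_simps)
qed

lemma VF_dB:
  assumes "vf_hom p f g h"
  shows "VF f g h * dB j - cj p (dB j) * VF f g h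
    = - (fm (2 *\<^sub>R g j + (if p then - 1 else 1) *\<^sub>R Dbar j f) * dX)
      - (if p then - 1 else 1) *\<^sub>R ((\<Sum>i\<in>UNIV. fm (Dbar j (g i)) * dB i) + fm (Dbar j h))"
proof -
  define s where "s = (if p then - 1 else 1 :: real)"
  have ss: "s * s = 1" "s * (s * r) = r" for r by (auto simp: s_def)
  have par: "sf_par f = s *\<^sub>R f" "sf_par h = s *\<^sub>R h" "sf_par (g i) = - (s *\<^sub>R g i)" for i
    using assms hpD(1)[of p f] hpD(1)[of p h] hpD(1)[of "\<not> p" "g i"]
    unfolding vf_hom_def s_def by auto
  have c: "cj p (dB j) = s *\<^sub>R dB j" by (simp add: s_def)
  have 1: "dB j * (fm f * dX) = s *\<^sub>R (fm f * dX * dB j) + fm (Dbar j f) * dX"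
  proof -
    have "dB j * (fm f * dX) = (dB j * fm f) * dX" by (simp add: mult.assoc)
    then show ?thesis by (simp add: dB_fm par fm_hom distrib_right mult.assoc dX_dB)
  qed
  have 2: "dB j * (fm (g i) * dB i) = s *\<^sub>R (fm (g i) * dB i * dB j + (if i = j then 2 *\<^sub>R (fm (g j) * dX) else 0))
      + fm (Dbar j (g i)) * dB i" for i
  proof -
    have "dB j * (fm (g i) * dB i) = (dB j * fm (g i)) * dB i" by (simp add: mult.assoc)
    also have "\<dots> = - (s *\<^sub>R (fm (g i) * (dB j * dB i))) + fm (Dbar j (g i)) * dB i"
      by (simp add: dB_fm par fm_hom distrib_right left_diff_distrib mult.assoc)
    also have "fm (g i) * (dB j * dB i) = - (fm (g i) * dB i * dB j) - (if i = j then 2 *\<^sub>R (fm (g j) * dX) else 0)"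
      unfolding dB_dB[of j i] by (auto simp: algebra_simps)
    finally show ?thesis by (simp add: algebra_simps)
  qed
  have 3: "dB j * fm h = s *\<^sub>R (fm h * dB j) + fm (Dbar j h)"
    by (simp add: dB_fm par fm_hom)
  have "cj p (dB j) * VF f g h = s *\<^sub>R (dB j * (fm f * dX) + (\<Sum>i\<in>UNIV. dB j * (fm (g i) * dB i)) + dB j * fm h)"
    unfolding c VF_def by (simp add: distrib_left sum_distrib_left scaleR_sum_right scaleR_add_right)
  also have "\<dots> = VF f g h * dB j + 2 *\<^sub>R (fm (g j) * dX) + s *\<^sub>R (fm (Dbar j f) * dX
      + (\<Sum>i\<in>UNIV. fm (Dbar j (g i)) * dB i) + fm (Dbar j h))"
    unfolding 1 2 3 sum.distrib
    by (simp add: VF_def scaleR_add_right scaleR_sum_right[symmetric] ss sum.distrib sum_distrib_right distrib_right algebra_simps)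
  finally show ?thesis
    by (simp add: s_def[symmetric] fm_hom algebra_simps)
qed

text \<open>The supercommutator is a superderivation, so it suffices to treat the generators
  \<open>fm A\<close>, \<open>dX\<close> and \<open>dB j\<close>. Critical is \<open>dB j\<close>,
  where a \<open>dX\<close> may appear: harmless if \<open>a = b\<close>, absent for a contact
  field. Replacing \<open>X\<close> by \<open>X'\<close> adds only a multiplication by a
  function.\<close>

lemma AD_Fil:
  assumes hom: "vf_hom p f g h" and ab: "b \<le> a" "a \<le> 2 * b" and cont: "a = b \<or> is_contact p f g"
    and X: "X = VF f g h" "X' = X + fm u" and D: "D \<in> Fil a b n"
  shows "app (AD p X' X) D \<in> Fil a b n"
proof -
  define d where "d D = X * D - cj p D * X" for D
  have dm: "d (D * E) = d D * E + cj p D * d E" for D E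
    by (simp add: d_def cj_simps algebra_simps)
  define G where "G n D \<longleftrightarrow> D \<in> Fil a b n \<and> d D \<in> Fil a b n" for n D
  have Gm: "G (m + n) (D * E)" if "G m D" "G n E" for m n D E
    using that unfolding G_def dm by (auto intro!: Fil_mult ab Sp_closed Fil_cj)
  have VFF: "VF f g h \<in> Fil a b a" for f g h
    unfolding VF_def
    by (intro Sp_closed Fil_fm Fil_gens Fil_mono[OF ab(1)] Fil_mono[OF le0])
  have G1: "G 0 (fm A)" for A
    unfolding G_def d_def X VF_fm[OF hom] by (intro conjI Fil_gens)
  have G2: "G a dX"
    unfolding G_def d_def X using VF_dX[of f g h] VFF by (auto simp: Fil_gens intro!: Sp_closed)
  have G3: "G b (dB j)" for j
  proof -
    have "fm (2 *\<^sub>R g j + (if p then - 1 else 1) *\<^sub>R Dbar j f) * dX \<in> Fil a b b"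
      using cont
    proof
      assume "a = b"
      show ?thesis unfolding \<open>a = b\<close> by (intro Fil_fm Fil_gens)
    qed (simp add: is_contact_def fm_hom Sp_closed)
    moreover have "(\<Sum>i\<in>UNIV. fm (Dbar j (g i)) * dB i) + fm (Dbar j h) \<in> Fil a b b"
      by (intro Sp_closed Fil_fm Fil_gens Fil_mono[OF le0])
    ultimately show ?thesis
      unfolding G_def d_def X VF_dB[OF hom]
      using Sp_closed(2)[OF Sp_closed(5) Sp_closed(3)] Fil_gens(3) by blast
  qed
  have GD: "G (b * card K) (DK K)" for K :: "'a set"
  proof (induction K rule: DK_induct)
    case empty
    then show ?case using G1[of 1] by (simp add: fm_hom)
  next
    case (insert i K)
    then show ?case using Gm[OF G3 insert(2)] by simp
  qed
  have GX: "G (a * c) (dX ^ c)" for c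
  proof (induction c)
    case (Suc c)
    then show ?case using Gm[OF G2 Suc] by simp
  qed (use G1[of 1] in \<open>simp add: fm_hom\<close>)
  have "d D \<in> Fil a b n"
    using D
  proof (rule Sp_linear_image)
    show "linear d" unfolding d_def by (simp add: linear_iff cj_simps algebra_simps)
    fix A c and K :: "'a set"
    assume v: "(c, K) \<in> {v. wt a b v \<le> n}"
    have "d (mop A c K) \<in> Fil a b (0 + a * c + b * card K)"
      using Gm[OF Gm[OF G1[of A] GX[of c]] GD[of K]] unfolding G_def mop_def by blast
    then show "d (mop A c K) \<in> Fil a b n" by (rule Fil_mono[rotated]) (use v in \<open>simp add: wt_def\<close>)
  qed
  moreover have "app (AD p X' X) D = d D + fm u * D" by (simp add: d_def X algebra_simps)
  ultimately show ?thesis using D by (simp add: Sp_closed Fil_fm)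
qed

definition ys :: "'n::{finite,linorder} idx \<Rightarrow> 'n sfun" where
  "ys a = (case a of None \<Rightarrow> 1 | Some None \<Rightarrow> sf_x | Some (Some i) \<Rightarrow> sf_theta i)"

lemma ys_simps [simp]: "ys None = 1" "ys (Some None) = sf_x" "ys (Some (Some i)) = sf_theta i"
  by (simp_all add: ys_def)

lemma yy_ys: "yy a = fm (ys a)" by (cases a rule: idx_cases) (simp_all add: fm_hom)

lemma homogeneous_sf_ys: "homogeneous_sf (od a) (ys a)" by (cases a rule: idx_cases) (simp_all add: homogeneous_sf_gens)

lemma homogeneous_sf_uminus: "homogeneous_sf p f \<Longrightarrow> homogeneous_sf p (- f)" using homogeneous_sf_lin(2)[of p f "- 1"] by simp

lemma homogeneous_sf_Dbar_ys: "homogeneous_sf (\<not> od a) (Dbar k (ys a))"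
  by (cases a rule: idx_cases) (auto simp: homogeneous_sf_gens homogeneous_sf_lin homogeneous_sf_uminus)

text \<open>\<open>EEf\<close>, \<open>EEg\<close> and \<open>EEh\<close> are the components of
  \<open>EE\<close> along \<open>dX\<close>, the \<open>dB\<close> and the identity,
  \<open>EE_VF\<close>. In this frame the derivative index \<open>b\<close> enters
  \<open>EEf\<close> and \<open>EEg\<close> only through the dual coordinate
  \<open>ys (os b)\<close>.\<close>

definition EEf :: "'n::{finite,linorder} idx \<Rightarrow> 'n idx \<Rightarrow> 'n sfun" where
  "EEf a b = om (os b) *\<^sub>R (ys a * ys (os b))"
definition EEg :: "'n::{finite,linorder} idx \<Rightarrow> 'n idx \<Rightarrow> 'n \<Rightarrow> 'n sfun" where
  "EEg a b k = ys a * Dbar k (ys (os b))"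
definition EEh :: "real \<Rightarrow> 'n::{finite,linorder} idx \<Rightarrow> 'n idx \<Rightarrow> 'n sfun" where
  "EEh l a b = (if b = None then - (l *\<^sub>R ys a) else 0)"

lemma EE_VF: "EE l a b = VF (EEf a b) (EEg a b) (EEh l a b)"
proof -
  have dT: "dT i = dB i + th i * dX" for i :: 'a by (simp add: dB_def)
  have th: "th i * dT i = th i * dB i" for i :: 'a
    by (simp add: dT distrib_left) (simp add: mult.assoc[symmetric] th_sq)
  show ?thesis
  proof (cases b rule: idx_cases)
    case 1
    then show ?thesis
      by (simp add: EE_def VF_def EEf_def EEg_def EEh_def yy_ys pp_def Eu_def th fm_hom algebra_simps
          sum_distrib_left sum_negf)
  next
    case 2
    then show ?thesis
      by (simp add: EE_def VF_def EEf_def EEg_def EEh_def yy_ys fm_hom)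
  next
    case (3 i)
    have "(\<Sum>k\<in>UNIV. fm (EEg a b k) * dB k) = (\<Sum>k\<in>UNIV. if k = i then fm (ys a) * dB i else 0)"
      using 3 by (intro sum.cong refl) (auto simp: EEg_def fm_hom)
    then show ?thesis using 3
      by (simp add: EE_def VF_def EEf_def EEh_def yy_ys fm_hom dT algebra_simps)
  qed
qed

lemma vf_hom_EE: "vf_hom (od a \<noteq> od b) (EEf a b) (EEg a b) (EEh l a b)"
proof -
  have "homogeneous_sf (od a \<noteq> od b) (EEf a b)" unfolding EEf_def
    using homogeneous_sf_lin(2)[OF homogeneous_sf_mult[OF homogeneous_sf_ys[of a] homogeneous_sf_ys[of "os b"]]] by simp
  moreover have "homogeneous_sf (\<not> (od a \<noteq> od b)) (EEg a b k)" for k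
  proof -
    have "(od a \<noteq> (\<not> od (os b))) = (\<not> (od a \<noteq> od b))" by auto
    then show ?thesis unfolding EEg_def using homogeneous_sf_mult[OF homogeneous_sf_ys[of a] homogeneous_sf_Dbar_ys[of "os b" k]] by simp
  qed
  moreover have "homogeneous_sf (od a \<noteq> od b) (EEh l a b)"
    unfolding EEh_def using homogeneous_sf_ys[of a] by (auto intro!: homogeneous_sf_uminus homogeneous_sf_lin)
  ultimately show ?thesis unfolding vf_hom_def by blast
qed

lemma VF_add: "VF f g h + VF f' g' h' = VF (f + f') (\<lambda>i. g i + g' i) (h + h')"
  by (simp add: VF_def fm_hom algebra_simps sum.distrib)
lemma VF_scaleR: "r *\<^sub>R VF f g h = VF (r *\<^sub>R f) (\<lambda>i. r *\<^sub>R g i) (r *\<^sub>R h)"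
  by (simp add: VF_def fm_hom algebra_simps scaleR_sum_right)

lemma EE_diff: "\<exists>u. EE l' a b = EE l a b + fm u"
  by (rule exI[of _ "EEh l' a b - EEh l a b"]) (simp add: EE_VF VF_def fm_hom)

lemma ee_Fil: "D \<in> Fil 1 1 n \<Longrightarrow> app (ee l l' i j) D \<in> Fil 1 1 n"
proof -
  assume D: "D \<in> Fil 1 1 n"
  obtain u where "EE l' i j = EE l i j + fm u" using EE_diff by blast
  then show ?thesis
    unfolding ee_def
    by (intro AD_Fil[OF vf_hom_EE[of i j l] _ _ _ EE_VF _ D]) auto
qed

lemma mm_AD: "mm l l' i j = AD (od i \<noteq> od j) (EE l' i j + cc i j *\<^sub>R EE l' (os j) (os i))
    (EE l i j + cc i j *\<^sub>R EE l (os j) (os i))"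
proof -
  have "(od (os j) \<noteq> od (os i)) = (od i \<noteq> od j)" by auto
  then show ?thesis unfolding mm_def ee_def by (simp only: AD_add AD_scaleR)
qed

lemma theta_comm: "sf_theta i * sf_theta j = - (sf_theta j * sf_theta i)"
  using times_theta[of "sf_theta i" j] by simp

text \<open>The second half of \<open>mm\<close> is what cancels the \<open>dX\<close> term in the
  supercommutators with the \<open>dB k\<close>; through \<open>AD_Fil\<close> this yields the
  invariance of the Heisenberg filtration.\<close>

lemma mm_contact: "is_contact (od i \<noteq> od j) (EEf i j + cc i j *\<^sub>R EEf (os j) (os i))
    (\<lambda>k. EEg i j k + cc i j *\<^sub>R EEg (os j) (os i) k)"
  unfolding is_contact_def
proof
  fix k :: 'a
  have D: "Dbar k (f + g) = Dbar k f + Dbar k g" "Dbar k (r *\<^sub>R f) = r *\<^sub>R Dbar k f"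
    "Dbar k (- f) = - Dbar k f" "Dbar k (f - g) = Dbar k f - Dbar k g" for f g :: "'a sfun" and r :: real
    using app_arg[of "dB k"] unfolding app_dB by auto
  have D2: "Dbar k 2 = 0" using D(1)[of 1 1] by simp
  have c: "sf_theta k * sf_x = sf_x * sf_theta k" by (rule sf_x_central)
  have t2: "sf_theta a * sf_theta k + sf_theta k * sf_theta a = 0" for a :: 'a
    by (simp add: theta_comm[of a k])
  have t3: "sf_theta a * sf_theta a = 0" for a :: 'a using theta_theta[of a 1] by simp
  have t: "sf_theta k * sf_theta a = - (sf_theta a * sf_theta k)" for a :: 'a by (rule theta_comm)
  show "2 *\<^sub>R (EEg i j k + cc i j *\<^sub>R EEg (os j) (os i) k)
      + (if od i \<noteq> od j then - 1 else 1) *\<^sub>R Dbar k (EEf i j + cc i j *\<^sub>R EEf (os j) (os i)) = 0"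
  proof (cases i rule: idx_cases)
    case 1
    then show ?thesis
      by (cases j rule: idx_cases) (simp_all add: EEf_def EEg_def cc_def D D2 Dbar_mult c scaleR_2)
  next
    case 2
    show ?thesis
      by (cases j rule: idx_cases) (simp_all add: 2 EEf_def EEg_def cc_def D D2 Dbar_mult c scaleR_2 t2 t3)
  next
    case (3 a)
    show ?thesis
      by (cases j rule: idx_cases) (simp_all add: 3 EEf_def EEg_def cc_def D D2 Dbar_mult c scaleR_2 t[of a])
  qed
qed

lemma mm_Fil:
  assumes ab: "b \<le> a" "a \<le> 2 * b" and D: "D \<in> Fil a b n"
  shows "app (mm l l' i j) D \<in> Fil a b n"
proof -
  let ?p = "od i \<noteq> od j"
  have p: "(od (os j) \<noteq> od (os i)) = ?p" by auto
  obtain u u' where u: "EE l' i j = EE l i j + fm u" "EE l' (os j) (os i) = EE l (os j) (os i) + fm u'"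
    using EE_diff by metis
  have h: "vf_hom ?p (EEf i j + cc i j *\<^sub>R EEf (os j) (os i)) (\<lambda>k. EEg i j k + cc i j *\<^sub>R EEg (os j) (os i) k)
    (EEh l i j + cc i j *\<^sub>R EEh l (os j) (os i))"
    using vf_hom_EE[of i j l] vf_hom_EE[of "os j" "os i" l] unfolding p vf_hom_def by (auto intro: homogeneous_sf_lin)
  have X: "EE l i j + cc i j *\<^sub>R EE l (os j) (os i) = VF (EEf i j + cc i j *\<^sub>R EEf (os j) (os i))
      (\<lambda>k. EEg i j k + cc i j *\<^sub>R EEg (os j) (os i) k) (EEh l i j + cc i j *\<^sub>R EEh l (os j) (os i))"
    unfolding EE_VF VF_scaleR VF_add ..
  have X': "EE l' i j + cc i j *\<^sub>R EE l' (os j) (os i) = (EE l i j + cc i j *\<^sub>R EE l (os j) (os i)) + fm (u + cc i j *\<^sub>R u')"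
    unfolding u by (simp add: fm_hom algebra_simps)
  show ?thesis unfolding mm_AD
    by (rule AD_Fil[OF h ab disjI2[OF mm_contact] X X' D])
qed

section \<open>Uniqueness of the coefficients\<close>

abbreviation lk :: "'n symb \<Rightarrow> nat \<times> 'n set \<Rightarrow> 'n::{finite,linorder} sfun" where
  "lk \<equiv> Poly_Mapping.lookup"

abbreviation mopv :: "'n::{finite,linorder} sfun \<Rightarrow> nat \<times> 'n set \<Rightarrow> 'n sfun endo" where
  "mopv A v \<equiv> mop A (fst v) (snd v)"

definition dif :: "'n::{finite,linorder} symb \<Rightarrow> 'n sfun endo" where
  "dif S = (\<Sum>v\<in>Poly_Mapping.keys S. mopv (lk S v) v)"

lemma app_dX_power: "app (dX ^ c) g = (sf_dx ^^ c) g"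
  by (induction c) simp_all

lemma app_DK: "app (DK K) g = Dbar_set K g"
proof -
  have "app (foldr (\<lambda>i D. dB i * D) xs 1) g = foldr Dbar xs g" for xs :: "'a list"
    by (induction xs) simp_all
  then show ?thesis by (simp add: DK_def Dbar_set_def)
qed

lemma app_dif: "app (dif S) = diffop S"
  by (rule ext) (simp add: dif_def diffop_def app_sum mop_def app_DK app_dX_power case_prod_beta)

lemma dif_superset:
  assumes "finite X" "Poly_Mapping.keys S \<subseteq> X" shows "dif S = (\<Sum>v\<in>X. mopv (lk S v) v)"
  unfolding dif_def using assms
  by (intro sum.mono_neutral_left) (auto simp: in_keys_iff mop_lin)

lemma lookup_scaleR [simp]: "lk (r *\<^sub>R S) v = r *\<^sub>R lk S v"
  by transfer simp

lemma dif_lin: "dif (S + T) = dif S + dif T" "dif (r *\<^sub>R S) = r *\<^sub>R dif S" "dif 0 = 0"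
proof -
  let ?X = "Poly_Mapping.keys S \<union> Poly_Mapping.keys T"
  have "Poly_Mapping.keys (S + T) \<subseteq> ?X" by (rule keys_add)
  then show "dif (S + T) = dif S + dif T"
    by (simp add: dif_superset[of ?X] lookup_add mop_lin sum.distrib)
  have "Poly_Mapping.keys (r *\<^sub>R S) \<subseteq> Poly_Mapping.keys S" by (auto simp: in_keys_iff)
  then show "dif (r *\<^sub>R S) = r *\<^sub>R dif S"
    by (simp add: dif_superset[of "Poly_Mapping.keys S"] mop_lin scaleR_sum_right)
qed (simp add: dif_def)

lemma linear_dif: "linear dif"
  by (simp add: linear_iff dif_lin)

lemma dif_single: "dif (Poly_Mapping.single v A) = mopv A v"
  by (subst dif_superset[of "{v}"]) auto

definition tL :: "'n::{finite,linorder} list \<Rightarrow> 'n sfun endo \<Rightarrow> 'n sfun endo" where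
  "tL xs D = foldr tI xs D"

lemma tL_mop: "distinct xs \<Longrightarrow> set xs \<subseteq> K \<Longrightarrow> \<exists>r. r \<noteq> 0 \<and> (\<forall>A c. tL xs (mop A c K) = r *\<^sub>R mop A c (K - set xs))"
proof (induction xs)
  case (Cons i xs)
  then obtain r where r: "r \<noteq> 0" "\<And>A c. tL xs (mop A c K) = r *\<^sub>R mop A c (K - set xs)" by auto
  have i: "i \<in> K - set xs" using Cons.prems by auto
  have e: "K - set xs - {i} = K - set (i # xs)" by auto
  have "tL (i # xs) (mop A c K) = (r * grassmann_sign (K - set (i # xs)) {i}) *\<^sub>R mop A c (K - set (i # xs))" for A c
    using r(2)[of A c] i e by (simp add: tL_def tt_lin tI_mop)
  moreover have "r * grassmann_sign (K - set (i # xs)) {i} \<noteq> 0" using r(1) by (simp add: grassmann_sign_def)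
  ultimately show ?case by blast
qed (auto simp: tL_def intro!: exI[of _ 1])

lemma tL_mop_zero: "\<not> set xs \<subseteq> K \<Longrightarrow> tL xs (mop A c K) = 0"
proof (induction xs)
  case (Cons i xs)
  show ?case
  proof (cases "set xs \<subseteq> K \<and> distinct xs")
    case True
    then obtain r where "tL xs (mop A c K) = r *\<^sub>R mop A c (K - set xs)" using tL_mop by blast
    moreover have "i \<notin> K" using True Cons.prems by auto
    ultimately show ?thesis by (simp add: tL_def tt_lin tI_mop)
  next
    case False
    show ?thesis
    proof (cases "set xs \<subseteq> K")
      case True
      have "tL ys (mop A c K) \<in> Sp {(c, L) | L. L \<subseteq> K}" for ys
      proof (induction ys)
        case Nil
        then show ?case by (auto simp: tL_def intro!: Sp_mop)
      next
        case (Cons j ys)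
        have "tI j D \<in> Sp {(c, L) | L. L \<subseteq> K}" if "D \<in> Sp {(c, L) | L. L \<subseteq> K}" for D
          using that by (rule Sp_linear_image) (auto simp: linear_iff tt_lin tI_mop intro!: Sp_closed Sp_mop)
        with Cons show ?case by (simp add: tL_def)
      qed
      moreover have "i \<notin> K" using True Cons.prems by auto
      moreover have "tI i D = 0" if "D \<in> Sp {(c, L) | L. L \<subseteq> K}" "i \<notin> K" for D
        using that(1) by (induction rule: Sp_induct) (use that(2) in \<open>auto simp: tt_lin tI_mop\<close>)
      ultimately show ?thesis by (simp add: tL_def)
    qed (use Cons.IH in \<open>simp add: tL_def tt_lin\<close>)
  qed
qed simp

lemma ZZ_power_mop: "(ZZ ^^ q) (mop A c K) = (if q \<le> c then (fact c / fact (c - q)) *\<^sub>R mop A (c - q) K else 0)"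
proof (induction q)
  case (Suc q)
  show ?case
  proof (cases "Suc q \<le> c")
    case True
    then obtain e where e: "c - q = Suc e" "c - Suc q = e" by (metis Suc_diff_Suc Suc_le_lessD)
    have "(fact c / fact (Suc e)) * real (Suc e) = fact c / (fact e :: real)"
      by (simp del: of_nat_Suc)
    then show ?thesis using Suc True by (simp add: ZZ_lin ZZ_mop e del: fact_Suc of_nat_Suc)
  next
    case False
    then show ?thesis using Suc by (cases "q \<le> c") (simp_all add: ZZ_lin ZZ_mop)
  qed
qed simp

lemma app_mop_one: "app (mop A c K) 1 = (if c = 0 \<and> K = {} then A else 0)"
proof (cases "K = {}")
  case True
  have "c \<noteq> 0 \<Longrightarrow> app (dX ^ c) 1 = (0 :: 'a sfun)"
    by (cases c) (simp_all add: power_Suc2 del: power_Suc)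
  then show ?thesis using True by (simp add: mop_def)
next
  case False
  then obtain i where "i \<in> K" by auto
  then have "app (DK K) 1 = 0" by (subst DK_right) auto
  then show ?thesis using False by (simp add: mop_def)
qed

text \<open>A single coefficient is read off by applying \<open>ZZ\<close> \<open>c0\<close> times,
  then \<open>tI\<close> for all indices of \<open>K0\<close>, and evaluating at the function 1.
  Monomials lacking one of these factors are killed beforehand, those with further derivatives
  vanish at 1.\<close>

lemma dif_inj:
  fixes S T :: "'n::{finite,linorder} symb"
  assumes "dif S = dif T" shows "S = T"
proof (rule poly_mapping_eqI)
  fix v :: "nat \<times> 'n set"
  obtain c0 K0 where v: "v = (c0, K0)" by force
  define xs where "xs = sorted_list_of_set K0"
  have xs: "distinct xs" "set xs = K0" by (auto simp: xs_def)
  define L where "L D = app (tL xs ((ZZ ^^ c0) D)) 1" for D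
  have "linear ((ZZ ^^ q) :: 'n sfun endo \<Rightarrow> _)" for q by (induction q) (auto simp: linear_iff ZZ_lin)
  moreover have "linear (tL ys)" for ys :: "'n list"
    by (induction ys) (auto simp: linear_iff tL_def tt_lin)
  ultimately have L: "linear L" unfolding L_def by (simp add: linear_iff)
  obtain r where r: "r \<noteq> 0" "\<And>A c. tL xs (mop A c K0) = r *\<^sub>R mop A c (K0 - K0)"
    using tL_mop[of xs K0] xs by auto
  have Lm: "L (mop A c K) = (if (c, K) = v then (r * fact c0) *\<^sub>R A else 0)" for A c K
  proof (cases "c0 \<le> c \<and> K0 \<subseteq> K")
    case True
    then obtain s where s: "tL xs (mop A (c - c0) K) = s *\<^sub>R mop A (c - c0) (K - K0)"
      using tL_mop[of xs K] xs by auto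
    have lin: "tL xs (q *\<^sub>R D) = q *\<^sub>R tL xs D" for q D
      unfolding tL_def by (induction xs) (auto simp: tt_lin)
    show ?thesis
    proof (cases "(c, K) = v")
      case True
      then show ?thesis using r(2)[of A 0] by (simp add: L_def ZZ_power_mop v lin app_mop_one)
    next
      case False
      then have "\<not> (c - c0 = 0 \<and> K - K0 = {})" using True v by auto
      then have "app (mop A (c - c0) (K - K0)) 1 = 0" by (simp only: app_mop_one if_False)
      then show ?thesis using True False s by (simp add: L_def ZZ_power_mop lin)
    qed
  next
    case False
    have z: "tL xs 0 = 0" by (induction xs) (simp_all add: tL_def tt_lin)
    have lin: "tL xs (q *\<^sub>R D) = q *\<^sub>R tL xs D" for q D
      unfolding tL_def by (induction xs) (auto simp: tt_lin)
    from False show ?thesis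
      using v tL_mop_zero[of xs K A "c - c0"] xs by (auto simp: L_def ZZ_power_mop z lin)
  qed
  have LS: "L (dif S) = (r * fact c0) *\<^sub>R lk S v" for S
  proof -
    have "L (dif S) = (\<Sum>u\<in>insert v (Poly_Mapping.keys S). L (mopv (lk S u) u))"
      by (subst dif_superset[of "insert v (Poly_Mapping.keys S)"]) (auto simp: linear_sum[OF L])
    also have "\<dots> = (\<Sum>u\<in>insert v (Poly_Mapping.keys S). if u = v then (r * fact c0) *\<^sub>R lk S v else 0)"
      by (intro sum.cong refl) (auto simp: Lm)
    finally show ?thesis by simp
  qed
  have "(r * fact c0) *\<^sub>R lk S v = (r * fact c0) *\<^sub>R lk T v"
    by (metis LS assms)
  then show "lk S v = lk T v" using r(1) by simp
qed

lemma diffop_inj: "diffop S = diffop T \<Longrightarrow> S = T"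
  by (metis app_dif app_inject dif_inj)

lemma coefficients_diffop [simp]: "coefficients (diffop S) = S"
  unfolding coefficients_def by (rule the_equality) (auto dest: diffop_inj)

lemma lookup_symb_restrict: "lk (symb_restrict V S) v = (if v \<in> V then lk S v else 0)"
proof -
  have "lk (symb_restrict V S) v = (\<Sum>u\<in>Poly_Mapping.keys S \<inter> V. if u = v then lk S v else 0)"
    unfolding symb_restrict_def lookup_sum by (intro sum.cong refl) (auto simp: lookup_single)
  then show ?thesis by (auto simp: in_keys_iff)
qed

lemma symb_restrict_lin: "symb_restrict V (S + T) = symb_restrict V S + symb_restrict V T"
  "symb_restrict V (r *\<^sub>R S) = r *\<^sub>R symb_restrict V S" "symb_restrict V 0 = 0"
  by (rule poly_mapping_eqI; simp add: lookup_symb_restrict lookup_add)+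

lemma Sp_dif: "Sp V = dif ` {S. Poly_Mapping.keys S \<subseteq> V}"
proof
  show "Sp V \<subseteq> dif ` {S. Poly_Mapping.keys S \<subseteq> V}"
  proof
    fix D assume "D \<in> Sp V"
    then show "D \<in> dif ` {S. Poly_Mapping.keys S \<subseteq> V}"
    proof (induction rule: Sp_induct)
      case (mop A c K)
      have "Poly_Mapping.keys (Poly_Mapping.single (c, K) A) \<subseteq> V" using mop by simp
      then show ?case using dif_single[of "(c, K)" A] by (metis (mono_tags) fst_conv image_eqI mem_Collect_eq snd_conv)
    next
      case (add D E)
      then obtain S T where "D = dif S" "E = dif T" "Poly_Mapping.keys S \<subseteq> V" "Poly_Mapping.keys T \<subseteq> V" by auto
      then show ?case using keys_add[of S T] by (intro image_eqI[of _ _ "S + T"]) (auto simp: dif_lin)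
    next
      case (scaleR r D)
      then obtain S where "D = dif S" "Poly_Mapping.keys S \<subseteq> V" by auto
      then show ?case by (intro image_eqI[of _ _ "r *\<^sub>R S"]) (auto simp: dif_lin in_keys_iff)
    next
      case zero
      then show ?case by (intro image_eqI[of _ _ 0]) (auto simp: dif_lin)
    qed
  qed
  show "dif ` {S. Poly_Mapping.keys S \<subseteq> V} \<subseteq> Sp V"
    unfolding dif_def by (auto intro!: Sp_closed Sp_mop)
qed

lemma dif_in_Sp: "dif S \<in> Sp V \<longleftrightarrow> Poly_Mapping.keys S \<subseteq> V"
  unfolding Sp_dif by (auto dest: dif_inj)

definition coeffs_of :: "'n::{finite,linorder} sfun endo \<Rightarrow> 'n symb" where
  "coeffs_of D = coefficients (app D)"

lemma coeffs_of_dif [simp]: "coeffs_of (dif S) = S"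
  by (simp add: coeffs_of_def app_dif)

lemma dif_coeffs_of: "D \<in> Sp V \<Longrightarrow> dif (coeffs_of D) = D"
  unfolding Sp_dif by auto

lemma op_filtration_iff: "app D \<in> op_filtration w d \<longleftrightarrow> D \<in> Sp {v. w v \<le> d}"
proof -
  have "app D \<in> op_filtration w d \<longleftrightarrow> (\<exists>S. D = dif S \<and> (\<forall>v\<in>Poly_Mapping.keys S. w v \<le> d))"
    unfolding op_filtration_def mem_Collect_eq app_dif[symmetric] app_inject ..
  then show ?thesis unfolding Sp_dif by auto
qed

lemma app_in_diffops: "app D \<in> diffops \<longleftrightarrow> D \<in> Sp UNIV"
  unfolding diffops_def Sp_dif by (auto simp: app_dif[symmetric] app_inject)

lemma principal_symbol_app: "principal_symbol w d (app D) = symb_restrict {v. w v = d} (coeffs_of D)"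
  by (simp add: principal_symbol_def coeffs_of_def)

section \<open>The action of vector fields on operators\<close>

definition LL :: "real \<Rightarrow> 'n::{finite,linorder} vfield \<Rightarrow> 'n sfun endo" where
  "LL lam X = fm (fst X) * dX + (\<Sum>i\<in>UNIV. fm (snd X $ i) * dT i)
     + (2 * lam / ((1 - real CARD('n)) + 1)) *\<^sub>R fm (vf_div X)"

lemma app_LL: "app (LL lam X) = dens_action lam X"
  by (rule ext) (simp add: LL_def dens_action_def vf_apply_def app_sum)

lemma sf_dtheta_zero [simp]: "sf_dtheta i 0 = 0"
  using app_arg(1)[of "dT i"] unfolding app_dT .

lemma vf_div_lin: "vf_div (X + Y) = vf_div X + vf_div Y" "vf_div (r *\<^sub>R X) = r *\<^sub>R vf_div X" "vf_div 0 = 0"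
  by (simp_all add: vf_div_def dx_lin par_simps sf_dtheta_add dtheta_lin sum.distrib scaleR_sum_right algebra_simps)

lemma LL_lin: "LL lam (X + Y) = LL lam X + LL lam Y" "LL lam (r *\<^sub>R X) = r *\<^sub>R LL lam X" "LL lam 0 = 0"
  by (simp_all add: LL_def vf_div_lin fm_hom algebra_simps sum.distrib scaleR_sum_right)

definition PT :: "nat \<Rightarrow> 'n::{finite,linorder} sfun endo" where
  "PT p = (1 / 2) *\<^sub>R (1 + (- 1) ^ p *\<^sub>R PP)"

lemma app_PT: "app (PT p) f = sf_part p f"
  by (rule sf_eqI)
    (simp add: PT_def sf_coeff_simps sf_part.rep_eq distrib_left power_add[symmetric] uminus_power_if
      flip: mult.assoc)

definition opp :: "nat \<Rightarrow> 'n::{finite,linorder} sfun endo \<Rightarrow> 'n sfun endo" where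
  "opp q D = PT q * D * PT 0 + PT (1 + q) * D * PT 1"

lemma app_opp: "app (opp q D) = op_part q (app D)"
  by (rule ext) (simp add: opp_def op_part_def app_PT)

definition lie_endo :: "real \<Rightarrow> real \<Rightarrow> 'n::{finite,linorder} vfield \<Rightarrow> 'n sfun endo endo" where
  "lie_endo lam mu X = Endo (\<lambda>D. LL mu X * D - (\<Sum>p\<in>{0,1}. \<Sum>q\<in>{0,1}.
      (-1) ^ (p * q) *\<^sub>R (opp q D * LL lam (vf_part p X))))"

lemma opp_lin: "opp q (D + E) = opp q D + opp q E" "opp q (r *\<^sub>R D) = r *\<^sub>R opp q D"
  by (simp_all add: opp_def algebra_simps)

lemma app_lie_endo: "app (lie_endo lam mu X) D = LL mu X * D - (\<Sum>p\<in>{0,1}. \<Sum>q\<in>{0,1}.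
      (-1) ^ (p * q) *\<^sub>R (opp q D * LL lam (vf_part p X)))"
  unfolding lie_endo_def by (subst app_Endo) (simp_all add: linear_iff opp_lin algebra_simps)

lemma app_app_lie_endo: "app (app (lie_endo lam mu X) D) = op_action lam mu X (app D)"
  by (rule ext) (simp add: app_lie_endo op_action_def app_LL app_opp)

lemma sf_part_lin: "sf_part p (f + g) = sf_part p f + sf_part p g" "sf_part p (r *\<^sub>R f) = r *\<^sub>R sf_part p f"
  "sf_part p 0 = 0"
  by (simp_all flip: app_PT)

lemma vf_part_lin: "vf_part p (X + Y) = vf_part p X + vf_part p Y" "vf_part p (r *\<^sub>R X) = r *\<^sub>R vf_part p X"
  "vf_part p 0 = 0"
  by (simp_all add: vf_part_def sf_part_lin vec_eq_iff prod_eq_iff)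

lemma lie_endo_lin: "lie_endo lam mu (X + Y) = lie_endo lam mu X + lie_endo lam mu Y" "lie_endo lam mu (r *\<^sub>R X) = r *\<^sub>R lie_endo lam mu X"
  "lie_endo lam mu 0 = 0"
  by (rule endo_eqI; simp add: app_lie_endo LL_lin vf_part_lin algebra_simps)+

definition homogeneous_vf :: "bool \<Rightarrow> 'n::{finite,linorder} vfield \<Rightarrow> bool" where
  "homogeneous_vf p X \<longleftrightarrow> sf_par (fst X) = (if p then - fst X else fst X) \<and>
     (\<forall>i. sf_par (snd X $ i) = (if p then snd X $ i else - (snd X $ i)))"

text \<open>Only one parity component of \<open>X\<close> survives, and the even and odd parts of
  \<open>D\<close> recombine: their sum is \<open>D\<close>, their difference is \<open>D\<close>
  conjugated by parity. The four terms thus become one supercommutator.\<close>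

lemma lie_endo_homogeneous_vf:
  assumes "homogeneous_vf p X"
  shows "lie_endo lam mu X = AD p (LL mu X) (LL lam X)"
proof (rule endo_eqI)
  fix D :: "'a sfun endo"
  have sp: "sf_part q f = (1/2) *\<^sub>R (f + (- 1) ^ q *\<^sub>R sf_par f)" for q and f :: "'a sfun"
    by (simp add: PT_def flip: app_PT)
  have h: "f = (1/2) *\<^sub>R (f + f)" for f :: "'a sfun" by (simp flip: scaleR_2)
  have v: "vf_part 0 X = (if p then 0 else X)" "vf_part 1 X = (if p then X else 0)"
    using assms by (auto simp: homogeneous_vf_def vf_part_def sp vec_eq_iff prod_eq_iff simp flip: h)
  have o0: "opp 0 D + opp 1 D = D" 
    by (simp add: opp_def PT_def algebra_simps) (simp add: mult.assoc PP_PP algebra_simps flip: scaleR_2)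
  have o1: "opp 0 D - opp 1 D = PP * D * PP"
    by (simp add: opp_def PT_def algebra_simps) (simp add: mult.assoc PP_PP algebra_simps flip: scaleR_2)
  show "app (lie_endo lam mu X) D = app (AD p (LL mu X) (LL lam X)) D"
  proof (cases p)
    case True
    have "(\<Sum>p\<in>{0,1}. \<Sum>q\<in>{0,1}. (-1) ^ (p * q) *\<^sub>R (opp q D * LL lam (vf_part p X))) = (opp 0 D - opp 1 D) * LL lam X"
      using True by (simp add: v v(2)[simplified] LL_lin left_diff_distrib)
    then show ?thesis using True by (simp add: app_lie_endo o1[unfolded One_nat_def] cj_def)
  next
    case False
    have "(\<Sum>p\<in>{0,1}. \<Sum>q\<in>{0,1}. (-1) ^ (p * q) *\<^sub>R (opp q D * LL lam (vf_part p X))) = (opp 0 D + opp 1 D) * LL lam X"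
      using False by (simp add: v v(2)[simplified] LL_lin distrib_right)
    then show ?thesis using False by (simp add: app_lie_endo o0[unfolded One_nat_def] cj_def)
  qed
qed

lemma homogeneous_vf_coord_field: "homogeneous_vf (od (Some j)) (coord_field j)"
  by (cases j) (auto simp: homogeneous_vf_def coord_field_def axis_def par_simps)

lemma coord_ys: "coord j = ys (Some j)"
  by (cases j) (simp_all add: coord_def)

lemma homogeneous_vf_scale: "homogeneous_sf p h \<Longrightarrow> homogeneous_vf q X \<Longrightarrow> homogeneous_vf (p \<noteq> q) (vf_scale h X)"
  by (auto simp: homogeneous_vf_def vf_scale_def par_simps hpD(1))

lemma euler_field_eq: "euler_field = (sf_x, \<chi> i. sf_theta i)"
proof -
  have *: "(\<Sum>j\<in>UNIV. snd (vf_scale (coord j) (coord_field j)) $ i) = sf_theta i" for i :: 'a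
  proof -
    have "(\<Sum>j\<in>UNIV. snd (vf_scale (coord j) (coord_field j)) $ i) = (\<Sum>k\<in>UNIV. if k = i then sf_theta i else 0)"
      by (simp add: sum_option coord_def coord_field_def vf_scale_def axis_def if_distrib[of "\<lambda>x. _ * x"] cong: if_cong)
    then show ?thesis by simp
  qed
  have "(\<Sum>j\<in>UNIV. fst (vf_scale (coord j) (coord_field j))) = sf_x"
    by (simp add: sum_option coord_def coord_field_def vf_scale_def)
  with * show ?thesis
    unfolding euler_field_def prod_eq_iff vec_eq_iff by (simp add: fst_sum snd_sum)
qed

lemma homogeneous_vf_euler: "homogeneous_vf False euler_field"
  by (simp add: euler_field_eq homogeneous_vf_def)

lemma AD_one: "AD False (r *\<^sub>R 1) (s *\<^sub>R 1) = (r - s) *\<^sub>R 1"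
  by (rule endo_eqI) (simp add: cj_simps algebra_simps)

lemma lie_endo_coord_field:
  "lie_endo lam mu (coord_field j) = ee (2 * lam) (2 * mu) None (Some (j :: 'n::{finite,linorder} option))"
proof -
  have "vf_div (coord_field j) = 0"
    by (cases j) (auto simp: vf_div_def coord_field_def axis_def intro!: sum.neutral)
  moreover have "(\<Sum>i\<in>UNIV. fm (if i = k then 1 else 0) * dT i) = (\<Sum>i\<in>UNIV. if i = k then dT k else 0)" for k :: 'n
    by (intro sum.cong) (auto simp: fm_hom)
  ultimately have e: "LL lam (coord_field j) = EE l None (Some j)" for lam l
    by (cases j) (simp_all add: LL_def coord_field_def axis_def fm_hom EE_def)
  then show ?thesis
    unfolding ee_def lie_endo_homogeneous_vf[OF homogeneous_vf_coord_field] e[of lam "2 * lam"] e[of mu "2 * mu"] by simp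
qed

text \<open>A linear field has constant divergence, so its two actions differ by a scalar. Scalars
  are equivariant for every quantization and do no harm.\<close>

lemma lie_endo_linear_field:
  "\<exists>r. lie_endo lam mu (vf_scale (coord i) (coord_field (j :: 'n::{finite,linorder} option)))
     = ee (2 * lam) (2 * mu) (Some i) (Some j) + r *\<^sub>R 1"
proof -
  let ?X = "vf_scale (coord i) (coord_field j)"
  have "\<exists>c. vf_div ?X = c *\<^sub>R 1 \<and> (c \<noteq> 0 \<longrightarrow> od (Some i) = od (Some j))"
  proof (cases j)
    case None
    have "vf_div ?X = sf_dx (coord i)"
      by (simp add: vf_div_def vf_scale_def coord_field_def None)
    then show ?thesis
      by (intro exI[of _ "if i = None then 1 else 0"]) (cases i; simp add: coord_def None)
  next
    case (Some k)
    have "sf_dtheta q (sf_par (snd ?X $ q)) = (if q = k then sf_dtheta k (sf_par (coord i)) else 0)" for q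
      by (auto simp: vf_scale_def coord_field_def Some axis_def)
    moreover have "fst ?X = 0" by (simp add: vf_scale_def coord_field_def Some)
    ultimately have d: "vf_div ?X = sf_dtheta k (sf_par (coord i))" by (simp add: vf_div_def)
    show ?thesis
      unfolding d by (intro exI[of _ "if i = Some k then - 1 else 0"]) (cases i; auto simp: coord_def Some dtheta_lin)
  qed
  then obtain c where c: "vf_div ?X = c *\<^sub>R 1" "c \<noteq> 0 \<longrightarrow> od (Some i) = od (Some j)" by auto
  have s: "(\<Sum>q\<in>UNIV. fm (coord i * (if q = k then 1 else 0)) * dT q) = (\<Sum>q\<in>UNIV. if q = k then fm (coord i) * dT k else 0)" for k :: 'n
    by (intro sum.cong) (auto simp: fm_hom)
  have LL: "LL lam ?X = EE l (Some i) (Some j) + ((2 * lam / ((1 - real CARD('n)) + 1)) * c) *\<^sub>R 1" for lam l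
    unfolding LL_def c using s by (cases j) (simp_all add: vf_scale_def coord_field_def axis_def fm_hom EE_def yy_ys coord_ys)
  have h: "homogeneous_vf (od (Some i) \<noteq> od (Some j)) ?X"
    unfolding coord_ys by (intro homogeneous_vf_scale homogeneous_sf_ys homogeneous_vf_coord_field)
  let ?k = "\<lambda>lam. (2 * lam / ((1 - real CARD('n)) + 1)) * c"
  have "lie_endo lam mu ?X = ee (2 * lam) (2 * mu) (Some i) (Some j) + AD (od (Some i) \<noteq> od (Some j)) (?k mu *\<^sub>R 1) (?k lam *\<^sub>R 1)"
    unfolding lie_endo_homogeneous_vf[OF h] LL[of mu "2 * mu"] LL[of lam "2 * lam"] AD_add ee_def ..
  also have "AD (od (Some i) \<noteq> od (Some j)) (?k mu *\<^sub>R 1) (?k lam *\<^sub>R 1) = (?k mu - ?k lam) *\<^sub>R (1 :: 'n sfun endo endo)"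
    using c(2) by (cases "c = 0") (auto simp: AD_zero AD_one)
  finally show ?thesis by blast
qed

text \<open>The divergence of \<open>y\<^sub>j\<close> times the Euler field is
  \<open>(2 - n) y\<^sub>j\<close>. The factor \<open>2 - n = m + 1\<close> cancels the denominator
  in the density action, which leaves exactly \<open>l = 2 \<lambda>\<close>.\<close>

lemma lie_endo_quadratic_field:
  assumes "CARD('n) \<noteq> 2"
  shows "lie_endo lam mu (vf_scale (coord j) (euler_field :: 'n::{finite,linorder} vfield))
     = - ee (2 * lam) (2 * mu) (Some j) None"
proof -
  let ?X = "vf_scale (coord j) (euler_field :: 'n vfield)"
  have d: "vf_div ?X = (2 - real CARD('n)) *\<^sub>R coord j"
  proof (cases j)
    case None
    then show ?thesis
      by (simp add: vf_div_def vf_scale_def euler_field_eq coord_def sf_dx_mult par_simps dtheta_lin sf_dtheta_mult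
          sum_negf sum_constant_scaleR algebra_simps scaleR_2 del: sum_constant)
  next
    case (Some k)
    have "(\<Sum>i\<in>UNIV. sf_dtheta i (sf_theta k * sf_theta i)) = (\<Sum>i\<in>UNIV. (if i = k then sf_theta k else 0) - sf_theta k)"
      by (intro sum.cong) (auto simp: sf_dtheta_mult)
    also have "\<dots> = sf_theta k - real CARD('n) *\<^sub>R sf_theta k"
      by (simp add: sum_subtractf sum_constant_scaleR del: sum_constant)
    finally show ?thesis using Some
      by (simp add: vf_div_def vf_scale_def euler_field_eq coord_def sf_dx_mult par_simps algebra_simps scaleR_2)
  qed
  have e: "(2 * lam / ((1 - real CARD('n)) + 1)) * (2 - real CARD('n)) = 2 * lam" for lam
    using assms by (simp add: field_simps)
  have LL: "LL lam ?X = - EE (2 * lam) (Some j) None" for lam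
  proof -
    have "LL lam ?X = fm (coord j) * Eu + ((2 * lam / ((1 - real CARD('n)) + 1)) * (2 - real CARD('n))) *\<^sub>R fm (coord j)"
      unfolding LL_def d by (simp add: vf_scale_def euler_field_eq fm_hom Eu_def distrib_left sum_distrib_left mult.assoc)
    then show ?thesis unfolding e by (simp add: EE_def pp_def yy_ys coord_ys algebra_simps)
  qed
  have h: "homogeneous_vf (od (Some j) \<noteq> od None) ?X"
    unfolding coord_ys using homogeneous_vf_scale[OF homogeneous_sf_ys homogeneous_vf_euler] by simp
  show ?thesis
  proof -
    have "lie_endo lam mu ?X = AD (od (Some j) \<noteq> od None) (LL mu ?X) (LL lam ?X)" by (rule lie_endo_homogeneous_vf[OF h])
    then show ?thesis unfolding LL ee_def by (intro endo_eqI) simp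
  qed
qed

lemma Dbar_scaleR: "Dbar i (r *\<^sub>R f) = r *\<^sub>R Dbar i f"
  using app_arg(5)[of "dB i"] unfolding app_dB .

lemma homogeneous_vf_contact:
  assumes "sf_par f = (if p then - f else f)"
  shows "homogeneous_vf p (contact_field f)"
proof -
  define s where "s = (if p then - 1 else 1 :: real)"
  have s: "sf_par f = s *\<^sub>R f" "s * s = 1" using assms by (auto simp: s_def)
  have D: "sf_par (Dbar i (sf_par f)) = - Dbar i f" for i using par_Dbar[of i "sf_par f"] by simp
  have t: "sf_par (Dbar i (sf_par f) * sf_theta i) = s *\<^sub>R (Dbar i (sf_par f) * sf_theta i)" for i
    using s(2) by (simp add: par_simps D) (simp add: s(1) Dbar_scaleR)
  have "sf_par (\<Sum>i\<in>X. Dbar i (sf_par f) * sf_theta i) = s *\<^sub>R (\<Sum>i\<in>X. Dbar i (sf_par f) * sf_theta i)" for X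
    using app_arg_sum[of PP "\<lambda>i. Dbar i (sf_par f) * sf_theta i" X] unfolding app_PP t scaleR_sum_right .
  then have "sf_par (fst (contact_field f)) = s *\<^sub>R fst (contact_field f)"
    by (simp add: fst_contact par_simps s(1) algebra_simps)
  moreover have "sf_par (snd (contact_field f) $ i) = - (s *\<^sub>R snd (contact_field f) $ i)" for i
    using s(2) by (simp add: snd_contact par_simps D) (simp add: s(1) Dbar_scaleR)
  ultimately show ?thesis by (auto simp: homogeneous_vf_def s_def)
qed

lemma LL_contact:
  fixes f :: "'n::{finite,linorder} sfun"
  assumes "CARD('n) \<noteq> 2"
  shows "LL lam (contact_field f) = VF f (\<lambda>i. - (1/2) *\<^sub>R Dbar i (sf_par f)) (lam *\<^sub>R sf_dx f)"
  by (rule endo_eqI)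
    (simp add: app_LL dens_action_contact_field[OF assms] VF_def app_sum scaleR_sum_right sum_negf)

lemma EEf_mm: "EEf a (os b) + cc a (os b) *\<^sub>R EEf b (os a) = (2 * om b) *\<^sub>R (ys a * ys b)"
proof -
  have "ys b * ys a = sg a b *\<^sub>R (ys a * ys b)"
    using hpD(2)[OF homogeneous_sf_ys[of b], of "ys a"] hpD(1)[OF homogeneous_sf_ys[of a]] by (auto simp: sg_def)
  moreover have "cc a (os b) * (om a * sg a b) = om b"
    by (auto simp: cc_def om_def sg_def)
  ultimately show ?thesis by (simp add: EEf_def flip: scaleR_add_left)
qed

text \<open>Quadratic Hamiltonians in the homogeneous coordinates are the generators of
  \<open>spo(2|n)\<close>. The odd components need no separate calculation:
  \<open>mm_contact\<close> determines them from the \<open>dX\<close> component.\<close>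

lemma lie_endo_contact:
  fixes a b :: "'n::{finite,linorder} idx"
  assumes "CARD('n) \<noteq> 2"
  shows "mm (2 * lam) (2 * mu) a (os b) = (2 * om b) *\<^sub>R lie_endo lam mu (contact_field (ys a * ys b))"
proof -
  let ?f = "ys a * ys b" and ?p = "od a \<noteq> od b"
  define s where "s = (if ?p then - 1 else 1 :: real)"
  have par: "sf_par ?f = (if ?p then - ?f else ?f)" using hpD(1)[OF homogeneous_sf_mult[OF homogeneous_sf_ys homogeneous_sf_ys]] .
  have pars: "sf_par ?f = s *\<^sub>R ?f" using par by (simp add: s_def)
  have g: "EEg a (os b) k + cc a (os b) *\<^sub>R EEg b (os a) k = (2 * om b) *\<^sub>R (- (1/2) *\<^sub>R Dbar k (sf_par ?f))" for k
  proof -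
    have "2 *\<^sub>R (EEg a (os b) k + cc a (os b) *\<^sub>R EEg b (os a) k) + s *\<^sub>R Dbar k ((2 * om b) *\<^sub>R ?f) = 0"
      using mm_contact[of a "os b"] unfolding is_contact_def os_os EEf_mm od_os s_def by blast
    then have "2 *\<^sub>R (EEg a (os b) k + cc a (os b) *\<^sub>R EEg b (os a) k) = 2 *\<^sub>R ((2 * om b) *\<^sub>R (- (1/2) *\<^sub>R Dbar k (sf_par ?f)))"
      by (simp add: pars Dbar_scaleR eq_neg_iff_add_eq_0 mult_ac)
    then show ?thesis by (metis scaleR_left_imp_eq zero_neq_numeral)
  qed
  have h: "EEh (2 * lam) a (os b) + cc a (os b) *\<^sub>R EEh (2 * lam) b (os a) = (2 * om b) *\<^sub>R (lam *\<^sub>R sf_dx ?f)" for lam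
    by (cases a rule: idx_cases; cases b rule: idx_cases)
      (simp_all add: EEh_def cc_def sf_dx_mult scaleR_2 mult_2 algebra_simps)
  have "EE (2 * lam) a (os b) + cc a (os b) *\<^sub>R EE (2 * lam) b (os a) = (2 * om b) *\<^sub>R LL lam (contact_field ?f)" for lam
    unfolding EE_VF VF_scaleR VF_add EEf_mm g h LL_contact[OF assms] ..
  then show ?thesis
    unfolding mm_AD os_os lie_endo_homogeneous_vf[OF homogeneous_vf_contact[OF par]] by (simp add: AD_scaleR)
qed

section \<open>Equivariant maps on graded symbols\<close>

type_synonym 'n weight = "nat \<times> 'n set \<Rightarrow> nat"

definition Hom :: "'n weight \<Rightarrow> nat \<Rightarrow> 'n::{finite,linorder} symb set" where
  "Hom w d = {S. \<forall>v\<in>Poly_Mapping.keys S. w v = d}"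

abbreviation res :: "'n weight \<Rightarrow> nat \<Rightarrow> 'n::{finite,linorder} symb \<Rightarrow> 'n symb" where
  "res w d \<equiv> symb_restrict {v. w v = d}"

definition preserves :: "'n::{finite,linorder} weight \<Rightarrow> 'n sfun endo endo \<Rightarrow> bool" where
  "preserves w \<A> \<longleftrightarrow> (\<forall>n. \<forall>D\<in>Sp {v. w v \<le> n}. app \<A> D \<in> Sp {v. w v \<le> n})"

definition graded_action :: "'n::{finite,linorder} weight \<Rightarrow> 'n sfun endo endo \<Rightarrow> nat \<Rightarrow> 'n symb \<Rightarrow> 'n symb" where
  "graded_action w \<A> d S = res w d (coeffs_of (app \<A> (dif S)))"

text \<open>Formulated for an arbitrary endomorphism, not only for the action of a field, so that
  equivariance can be extended from generators to polynomials in them, in particular to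
  Casimirs.\<close>

definition equivariant_wrt :: "'n::{finite,linorder} weight \<Rightarrow> ('n symb \<Rightarrow> 'n sfun endo) \<Rightarrow> 'n sfun endo endo \<Rightarrow> bool" where
  "equivariant_wrt w q \<A> \<longleftrightarrow> (\<forall>d. \<forall>S\<in>Hom w d. app \<A> (q S) = q (graded_action w \<A> d S))"

text \<open>The conditions on filtration and principal symbol say that \<open>q\<close> differs from
  the standard ordering \<open>dif\<close> by lower weight, so \<open>q\<close> is unitriangular
  with respect to it.\<close>

definition quantization_map :: "'n::{finite,linorder} weight \<Rightarrow> ('n symb \<Rightarrow> 'n sfun endo) \<Rightarrow> bool" where
  "quantization_map w q \<longleftrightarrow> linear q \<and> (\<forall>d. \<forall>S\<in>Hom w d. q S - dif S \<in> Sp {v. w v < d})"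

lemma HomD: "S \<in> Hom w d \<Longrightarrow> lk S v \<noteq> 0 \<Longrightarrow> w v = d"
  by (auto simp: Hom_def in_keys_iff)

lemma Hom_dif: "S \<in> Hom w d \<Longrightarrow> dif S \<in> Sp {v. w v = d}"
  by (auto simp: Hom_def dif_in_Sp)

lemma res_Hom: "res w d S \<in> Hom w d"
  by (auto simp: Hom_def in_keys_iff lookup_symb_restrict split: if_splits)

lemma res_id: "S \<in> Hom w d \<Longrightarrow> res w d S = S"
  by (rule poly_mapping_eqI) (auto simp: lookup_symb_restrict dest: HomD)

lemma graded_action_Hom: "graded_action w \<A> d S \<in> Hom w d" by (simp add: graded_action_def res_Hom)

lemma Hom_single: "w v = d \<Longrightarrow> Poly_Mapping.single v A \<in> Hom w d"
  by (auto simp: Hom_def)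

lemma Hom_scaleR: "S \<in> Hom w d \<Longrightarrow> r *\<^sub>R S \<in> Hom w d"
  by (auto simp: Hom_def in_keys_iff)

lemma Sp_UNIV: "D \<in> Sp V \<Longrightarrow> D \<in> Sp UNIV" by (rule Sp_mono) auto

lemma coeffs_of_lin: "D \<in> Sp UNIV \<Longrightarrow> E \<in> Sp UNIV \<Longrightarrow> coeffs_of (D + E) = coeffs_of D + coeffs_of E"
  "D \<in> Sp UNIV \<Longrightarrow> E \<in> Sp UNIV \<Longrightarrow> coeffs_of (D - E) = coeffs_of D - coeffs_of E"
  "D \<in> Sp UNIV \<Longrightarrow> coeffs_of (r *\<^sub>R D) = r *\<^sub>R coeffs_of D"
proof -
  assume "D \<in> Sp UNIV"
  then obtain S where S: "D = dif S" by (auto simp: Sp_dif)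
  show "coeffs_of (r *\<^sub>R D) = r *\<^sub>R coeffs_of D" unfolding S by (metis dif_lin(2) coeffs_of_dif)
  assume "E \<in> Sp UNIV"
  then obtain T where T: "E = dif T" by (auto simp: Sp_dif)
  show "coeffs_of (D + E) = coeffs_of D + coeffs_of E" unfolding S T by (metis dif_lin(1) coeffs_of_dif)
  show "coeffs_of (D - E) = coeffs_of D - coeffs_of E" unfolding S T by (metis linear_diff[OF linear_dif] coeffs_of_dif)
qed

lemma coeffs_of_zero [simp]: "coeffs_of 0 = 0"
  using coeffs_of_dif[of 0] by (simp add: dif_lin)

lemma coeffs_of_keys: "D \<in> Sp V \<Longrightarrow> v \<notin> V \<Longrightarrow> lk (coeffs_of D) v = 0"
  using dif_in_Sp[of "coeffs_of D" V] dif_coeffs_of[of D V] by (auto simp: in_keys_iff)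

lemma coeffs_of_top:
  assumes "D \<in> Sp {v. w v \<le> d}" shows "D - dif (res w d (coeffs_of D)) \<in> Sp {v. w v < d}"
proof -
  obtain S where S: "D = dif S" "Poly_Mapping.keys S \<subseteq> {v. w v \<le> d}" using assms by (auto simp: Sp_dif)
  have "Poly_Mapping.keys (S - res w d S) \<subseteq> {v. w v < d}"
    using S(2) by (auto simp: in_keys_iff lookup_minus lookup_symb_restrict less_le split: if_splits)
  then show ?thesis unfolding S(1) by (simp add: linear_diff[OF linear_dif, symmetric] dif_in_Sp)
qed

lemma res_low: "D \<in> Sp {v. w v < d} \<Longrightarrow> res w d (coeffs_of D) = 0"
  by (rule poly_mapping_eqI) (auto simp: lookup_symb_restrict coeffs_of_keys)

lemma res_coeffs_of_unique:
  assumes "S \<in> Hom w d" "D - dif S \<in> Sp {v. w v < d}"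
  shows "res w d (coeffs_of D) = S"
proof -
  have "D = dif S + (D - dif S)" by simp
  then have "coeffs_of D = S + coeffs_of (D - dif S)"
    using coeffs_of_lin(1)[of "dif S" "D - dif S"] Hom_dif[OF assms(1)] assms(2) Sp_UNIV by (metis coeffs_of_dif)
  then show ?thesis by (simp add: symb_restrict_lin res_low[OF assms(2)] res_id[OF assms(1)])
qed

lemma preserves_less: "preserves w \<A> \<Longrightarrow> D \<in> Sp {v. w v < d} \<Longrightarrow> app \<A> D \<in> Sp {v. w v < d}"
proof (cases d)
  case 0
  assume "D \<in> Sp {v. w v < d}"
  then have "D = 0" using 0 by (simp add: Sp_def)
  then show ?thesis by (simp add: Sp_closed)
next
  case (Suc m)
  then show "preserves w \<A> \<Longrightarrow> D \<in> Sp {v. w v < d} \<Longrightarrow> app \<A> D \<in> Sp {v. w v < d}"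
    by (simp add: preserves_def less_Suc_eq_le)
qed

lemma Sp_eq_le: "D \<in> Sp {v. w v = (d :: nat)} \<Longrightarrow> D \<in> Sp {v. w v \<le> d}"
  by (rule Sp_mono) auto
lemma Sp_less_le: "D \<in> Sp {v. w v < (d :: nat)} \<Longrightarrow> D \<in> Sp {v. w v \<le> d}"
  by (rule Sp_mono) auto

lemma preserves_Hom: "preserves w \<A> \<Longrightarrow> S \<in> Hom w d \<Longrightarrow> app \<A> (dif S) \<in> Sp {v. w v \<le> d}"
  unfolding preserves_def using Sp_eq_le[OF Hom_dif] by blast

lemma graded_action_low: "preserves w \<A> \<Longrightarrow> S \<in> Hom w d \<Longrightarrow> app \<A> (dif S) - dif (graded_action w \<A> d S) \<in> Sp {v. w v < d}"
  unfolding graded_action_def by (rule coeffs_of_top[OF preserves_Hom])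

lemma preserves_closed: "preserves w \<A> \<Longrightarrow> preserves w \<B> \<Longrightarrow> preserves w (\<A> + \<B>)" "preserves w \<A> \<Longrightarrow> preserves w (r *\<^sub>R \<A>)"
  "preserves w \<A> \<Longrightarrow> preserves w \<B> \<Longrightarrow> preserves w (\<A> * \<B>)" "preserves w 0" "preserves w 1"
  by (auto simp: preserves_def intro: Sp_closed)

lemma preserves_sum: "(\<And>x. x \<in> X \<Longrightarrow> preserves w (f x)) \<Longrightarrow> preserves w (sum f X)"
  by (induction X rule: infinite_finite_induct) (auto intro: preserves_closed)

context
  fixes w :: "'n::{finite,linorder} weight" and q :: "'n symb \<Rightarrow> 'n sfun endo"
  assumes q: "quantization_map w q"
begin

lemma quantization_map_linear: "linear q" using q by (simp add: quantization_map_def)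
lemma quantization_map_low: "S \<in> Hom w d \<Longrightarrow> q S - dif S \<in> Sp {v. w v < d}" using q by (simp add: quantization_map_def)

lemma equivariant_wrt_add:
  assumes "preserves w \<A>" "preserves w \<B>" "equivariant_wrt w q \<A>" "equivariant_wrt w q \<B>" shows "equivariant_wrt w q (\<A> + \<B>)"
  unfolding equivariant_wrt_def
proof (intro allI ballI)
  fix d S assume S: "S \<in> Hom w d"
  have "graded_action w (\<A> + \<B>) d S = graded_action w \<A> d S + graded_action w \<B> d S"
    using preserves_Hom[OF assms(1) S] preserves_Hom[OF assms(2) S]
    by (simp add: graded_action_def coeffs_of_lin Sp_UNIV symb_restrict_lin)
  then show "app (\<A> + \<B>) (q S) = q (graded_action w (\<A> + \<B>) d S)"
    using assms S by (simp add: equivariant_wrt_def linear_add[OF quantization_map_linear])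
qed

lemma equivariant_wrt_scaleR:
  assumes "preserves w \<A>" "equivariant_wrt w q \<A>" shows "equivariant_wrt w q (r *\<^sub>R \<A>)"
  unfolding equivariant_wrt_def
proof (intro allI ballI)
  fix d S assume S: "S \<in> Hom w d"
  have "graded_action w (r *\<^sub>R \<A>) d S = r *\<^sub>R graded_action w \<A> d S"
    using preserves_Hom[OF assms(1) S] by (simp add: graded_action_def coeffs_of_lin Sp_UNIV symb_restrict_lin)
  then show "app (r *\<^sub>R \<A>) (q S) = q (graded_action w (r *\<^sub>R \<A>) d S)"
    using assms S by (simp add: equivariant_wrt_def linear_cmul[OF quantization_map_linear])
qed

lemma equivariant_wrt_one: "equivariant_wrt w q 1" and equivariant_wrt_zero: "equivariant_wrt w q 0"
  by (auto simp: equivariant_wrt_def graded_action_def res_id linear_0[OF quantization_map_linear] symb_restrict_lin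
      coeffs_of_zero)

text \<open>Replacing the image under the second factor by its top part makes an error of lower
  weight, which the first factor keeps below the top. Hence the graded action is
  multiplicative.\<close>

lemma equivariant_wrt_mult:
  assumes "preserves w \<A>" "preserves w \<B>" "equivariant_wrt w q \<A>" "equivariant_wrt w q \<B>" shows "equivariant_wrt w q (\<A> * \<B>)"
  unfolding equivariant_wrt_def
proof (intro allI ballI)
  fix d S assume S: "S \<in> Hom w d"
  let ?T = "graded_action w \<B> d S"
  have "app \<A> (app \<B> (dif S) - dif ?T) \<in> Sp {v. w v < d}"
    by (rule preserves_less[OF assms(1) graded_action_low[OF assms(2) S]])
  moreover have "app \<A> (dif ?T) - dif (graded_action w \<A> d ?T) \<in> Sp {v. w v < d}"
    by (rule graded_action_low[OF assms(1) graded_action_Hom])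
  ultimately have "app \<A> (app \<B> (dif S)) - dif (graded_action w \<A> d ?T) \<in> Sp {v. w v < d}"
    using Sp_closed(1)[of "app \<A> (app \<B> (dif S) - dif ?T)" _ "app \<A> (dif ?T) - dif (graded_action w \<A> d ?T)"] by simp
  then have "graded_action w (\<A> * \<B>) d S = graded_action w \<A> d ?T"
    unfolding graded_action_def[of w "\<A> * \<B>"] by (intro res_coeffs_of_unique graded_action_Hom) simp
  then show "app (\<A> * \<B>) (q S) = q (graded_action w (\<A> * \<B>) d S)"
    using assms(3,4) S graded_action_Hom[of w \<B> d S] by (simp add: equivariant_wrt_def)
qed

lemma equivariant_wrt_sum:
  assumes "\<And>x. x \<in> X \<Longrightarrow> preserves w (f x)" "\<And>x. x \<in> X \<Longrightarrow> equivariant_wrt w q (f x)"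
  shows "equivariant_wrt w q (sum f X)"
  using assms
  by (induction X rule: infinite_finite_induct) (auto intro: equivariant_wrt_add preserves_sum simp: equivariant_wrt_zero)

end

section \<open>Triangular operators and their eigenvectors\<close>

definition eigenop :: "'n::{finite,linorder} weight \<Rightarrow> 'n sfun endo endo \<Rightarrow> (nat \<times> 'n set \<Rightarrow> real) \<Rightarrow> bool" where
  "eigenop w \<C> g \<longleftrightarrow> (\<forall>v A. app \<C> (mopv A v) - g v *\<^sub>R mopv A v \<in> Sp {u. w u < w v})"

lemma eigenopD: "eigenop w \<C> g \<Longrightarrow> app \<C> (mopv A v) - g v *\<^sub>R mopv A v \<in> Sp {u. w u < w v}"
  unfolding eigenop_def by blast

lemma symb_decomp: "S = (\<Sum>v\<in>Poly_Mapping.keys S. Poly_Mapping.single v (lk S v))"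
proof (rule poly_mapping_eqI)
  fix u
  have "lk (\<Sum>v\<in>Poly_Mapping.keys S. Poly_Mapping.single v (lk S v)) u = (\<Sum>v\<in>Poly_Mapping.keys S. if v = u then lk S u else 0)"
    unfolding lookup_sum by (intro sum.cong) (auto simp: lookup_single)
  then show "lk S u = lk (\<Sum>v\<in>Poly_Mapping.keys S. Poly_Mapping.single v (lk S v)) u"
    by (auto simp: in_keys_iff)
qed

lemma linear_symb_sum:
  assumes "linear f" shows "f S = (\<Sum>v\<in>Poly_Mapping.keys S. f (Poly_Mapping.single v (lk S v)))"
  using arg_cong[OF symb_decomp[of S], of f] unfolding linear_sum[OF assms] .

lemma linear_symb_eqI:
  fixes S :: "'n::{finite,linorder} symb"
  assumes "linear f" "linear g" "\<And>v A. f (Poly_Mapping.single v A) = g (Poly_Mapping.single v A)"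
  shows "f S = (g S :: 'b::real_vector)"
  unfolding linear_symb_sum[OF assms(1), of S] linear_symb_sum[OF assms(2), of S] assms(3) ..

text \<open>At a monomial \<open>v\<close> of maximal weight in \<open>T\<close> the operator acts
  by \<open>g v\<close> alone, so a nonzero coefficient there would force
  \<open>g v = x\<close>.\<close>

lemma eigen_zero:
  assumes e: "eigenop w \<C> g" and T: "T \<in> Sp V" "app \<C> T = x *\<^sub>R T" and g: "\<And>u. u \<in> V \<Longrightarrow> g u \<noteq> x"
  shows "T = 0"
proof (rule ccontr)
  assume "T \<noteq> 0"
  obtain U where U: "T = dif U" "Poly_Mapping.keys U \<subseteq> V" using T(1) by (auto simp: Sp_dif)
  then have "U \<noteq> 0" using \<open>T \<noteq> 0\<close> by (auto simp: dif_lin)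
  then have ne: "w ` Poly_Mapping.keys U \<noteq> {}" by simp
  then have "Max (w ` Poly_Mapping.keys U) \<in> w ` Poly_Mapping.keys U" by (intro Max_in) auto
  then obtain v where v: "v \<in> Poly_Mapping.keys U" "w v = Max (w ` Poly_Mapping.keys U)" by auto
  have le: "w u \<le> w v" if "u \<in> Poly_Mapping.keys U" for u unfolding v(2) using that by (intro Max_ge) auto
  define G where "G = (\<Sum>u\<in>Poly_Mapping.keys U. Poly_Mapping.single u (g u *\<^sub>R lk U u))"
  have dG: "dif G = (\<Sum>u\<in>Poly_Mapping.keys U. g u *\<^sub>R mopv (lk U u) u)"
    unfolding G_def by (simp add: linear_sum[OF linear_dif] dif_single mop_lin)
  have "app \<C> T - dif G = (\<Sum>u\<in>Poly_Mapping.keys U. app \<C> (mopv (lk U u) u) - g u *\<^sub>R mopv (lk U u) u)"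
    unfolding U(1) dG by (simp add: dif_def app_arg_sum sum_subtractf)
  also have "\<dots> \<in> Sp {u. w u < w v}"
  proof (rule Sp_closed(6))
    fix u assume "u \<in> Poly_Mapping.keys U"
    then have "{t. w t < w u} \<subseteq> {t. w t < w v}" using le[of u] by auto
    then show "app \<C> (mopv (lk U u) u) - g u *\<^sub>R mopv (lk U u) u \<in> Sp {u. w u < w v}"
      by (rule Sp_mono[OF _ eigenopD[OF e]])
  qed
  finally have "dif (x *\<^sub>R U - G) \<in> Sp {u. w u < w v}"
    by (simp add: T(2) linear_diff[OF linear_dif] dif_lin flip: U(1))
  then have "lk (x *\<^sub>R U - G) v = 0" by (auto simp: dif_in_Sp in_keys_iff)
  moreover have "lk G v = (\<Sum>u\<in>Poly_Mapping.keys U. if u = v then g v *\<^sub>R lk U v else 0)"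
    unfolding G_def lookup_sum by (intro sum.cong) (auto simp: lookup_single)
  then have "lk G v = g v *\<^sub>R lk U v" using v(1) by simp
  ultimately have "(x - g v) *\<^sub>R lk U v = 0" by (simp add: lookup_minus algebra_simps)
  then show False using v(1) U(2) g[of v] by (auto simp: in_keys_iff)
qed

lemma quantization_map_eigen:
  assumes q: "quantization_map w q" "equivariant_wrt w q \<C>" and e: "eigenop w \<C> g"
  shows "app \<C> (q (Poly_Mapping.single v A)) = g v *\<^sub>R q (Poly_Mapping.single v A)"
proof -
  let ?S = "Poly_Mapping.single v A"
  have S: "?S \<in> Hom w (w v)" by (rule Hom_single) simp
  have "app \<C> (dif ?S) - dif (g v *\<^sub>R ?S) \<in> Sp {u. w u < w v}"
    unfolding dif_lin dif_single by (rule eigenopD[OF e])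
  moreover have "g v *\<^sub>R ?S \<in> Hom w (w v)" using S by (rule Hom_scaleR)
  ultimately have "graded_action w \<C> (w v) ?S = g v *\<^sub>R ?S" unfolding graded_action_def by (intro res_coeffs_of_unique)
  then show ?thesis using q S by (simp add: equivariant_wrt_def linear_cmul[OF quantization_map_linear[OF q(1)]])
qed

text \<open>On a single monomial both maps give eigenvectors for the same eigenvalue and with the
  same leading part. Their difference has lower weight, where that eigenvalue does not
  occur.\<close>

lemma quantization_map_unique:
  assumes q: "quantization_map w q" "equivariant_wrt w q \<C>" and q': "quantization_map w q'" "equivariant_wrt w q' \<C>"
    and e: "eigenop w \<C> g" and g: "\<And>u v. w u < w v \<Longrightarrow> g u \<noteq> g v"
  shows "q = q'"
proof (rule ext, rule linear_symb_eqI)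
  fix v :: "nat \<times> 'a set" and A :: "'a sfun"
  let ?S = "Poly_Mapping.single v A"
  have S: "?S \<in> Hom w (w v)" by (rule Hom_single) simp
  have "q ?S - q' ?S = (q ?S - dif ?S) - (q' ?S - dif ?S)" by simp
  also have "\<dots> \<in> Sp {u. w u < w v}" by (intro Sp_closed(2) quantization_map_low[OF q(1) S] quantization_map_low[OF q'(1) S])
  finally have "q ?S - q' ?S = 0"
    by (rule eigen_zero[OF e, where x = "g v"])
      (use g quantization_map_eigen[OF q e, of v A] quantization_map_eigen[OF q' e, of v A] in \<open>auto simp: algebra_simps\<close>)
  then show "q ?S = q' ?S" by simp
qed (use quantization_map_linear q q' in blast)+

text \<open>Unitriangularity: the leading part of a nonzero symbol survives, and surjectivity
  follows by induction on the weight, since the error made by lifting the leading part lies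
  lower.\<close>

lemma quantization_map_bij:
  assumes q: "quantization_map w q" shows "bij_betw q UNIV (Sp UNIV)"
proof -
  note lin = quantization_map_linear[OF q]
  have low: "q S - dif S \<in> Sp {v. w v < n}" if S: "Poly_Mapping.keys S \<subseteq> {v. w v \<le> n}" for S n
  proof -
    have "q S - dif S = (\<Sum>v\<in>Poly_Mapping.keys S. q (Poly_Mapping.single v (lk S v)) - dif (Poly_Mapping.single v (lk S v)))"
      unfolding sum_subtractf linear_symb_sum[OF lin, symmetric] linear_symb_sum[OF linear_dif, symmetric] ..
    also have "\<dots> \<in> Sp {v. w v < n}"
    proof (rule Sp_closed(6))
      fix v assume "v \<in> Poly_Mapping.keys S"
      then have "w v \<le> n" using S by auto
      then show "q (Poly_Mapping.single v (lk S v)) - dif (Poly_Mapping.single v (lk S v)) \<in> Sp {v. w v < n}"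
        by (intro Sp_mono[OF _ quantization_map_low[OF q Hom_single[OF refl]]] Collect_mono) simp
    qed
    finally show ?thesis .
  qed
  have "inj q"
  proof (rule linear_inj_iff_eq_0[OF lin, THEN iffD2], intro allI impI)
    fix S assume z: "q S = 0"
    show "S = 0"
    proof (rule ccontr)
      assume "S \<noteq> 0"
      then have ne: "w ` Poly_Mapping.keys S \<noteq> {}" by simp
      then have "Max (w ` Poly_Mapping.keys S) \<in> w ` Poly_Mapping.keys S" by (intro Max_in) auto
      then obtain v where v: "v \<in> Poly_Mapping.keys S" "w v = Max (w ` Poly_Mapping.keys S)" by auto
      have "Poly_Mapping.keys S \<subseteq> {u. w u \<le> w v}" unfolding v(2) by auto
      from low[OF this] have "- dif S \<in> Sp {u. w u < w v}" using z by simp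
      from Sp_closed(5)[OF this] have "dif S \<in> Sp {u. w u < w v}" by simp
      then show False using v(1) by (auto simp: dif_in_Sp)
    qed
  qed
  moreover have "q ` UNIV = Sp UNIV"
  proof
    show "q ` UNIV \<subseteq> Sp UNIV"
    proof clarify
      fix S :: "'a symb"
      have "Poly_Mapping.keys S \<subseteq> {v. w v \<le> Max (w ` Poly_Mapping.keys S)}" by auto
      from low[OF this] have "q S - dif S \<in> Sp UNIV" by (rule Sp_UNIV)
      moreover have "dif S \<in> Sp UNIV" by (simp add: dif_in_Sp)
      ultimately show "q S \<in> Sp UNIV" using Sp_closed(1)[of "q S - dif S" UNIV "dif S"] by simp
    qed
    have ind: "Sp {v. w v < n} \<subseteq> q ` UNIV" for n
    proof (induction n)
      case 0
      have "Sp {v. w v < 0} = {0}" by (simp add: Sp_def)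
      then show ?case using linear_0[OF lin] rangeI[of q 0] by simp
    next
      case (Suc n)
      show ?case
      proof
        fix D assume "D \<in> Sp {v. w v < Suc n}"
        then obtain S where S: "D = dif S" "Poly_Mapping.keys S \<subseteq> {v. w v \<le> n}"
          by (auto simp: Sp_dif less_Suc_eq_le)
        have "q S - dif S \<in> q ` UNIV" using low[OF S(2)] Suc by blast
        then obtain R where R: "q S - dif S = q R" by (rule imageE)
        have "D = q (S - R)" unfolding S(1) linear_diff[OF lin] R[symmetric] by simp
        then show "D \<in> q ` UNIV" by simp
      qed
    qed
    show "Sp UNIV \<subseteq> q ` UNIV"
    proof
      fix D :: "'a sfun endo" assume "D \<in> Sp UNIV"
      then obtain S where S: "D = dif S" by (auto simp: Sp_dif)
      have "Poly_Mapping.keys S \<subseteq> {v. w v < Suc (Max (w ` Poly_Mapping.keys S))}" by (auto simp: less_Suc_eq_le)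
      then have "D \<in> Sp {v. w v < Suc (Max (w ` Poly_Mapping.keys S))}" unfolding S dif_in_Sp .
      then show "D \<in> q ` UNIV" using ind by blast
    qed
  qed
  ultimately show ?thesis by (simp add: bij_betw_def)
qed

section \<open>From the induced actions on symbols to graded actions\<close>

lemma symb_action_eq:
  assumes ww: "\<And>v. ww v = real (w v) / s" and s: "s > 0"
  shows "symb_action ww lam mu X S = (\<Sum>d\<in>w ` Poly_Mapping.keys S. graded_action w (lie_endo lam mu X) d (res w d S))"
proof -
  have e: "ww v = real d / s \<longleftrightarrow> w v = d" for v d using s by (simp add: ww)
  have i: "ww ` Poly_Mapping.keys S = (\<lambda>d. real d / s) ` (w ` Poly_Mapping.keys S)" by (auto simp: ww image_iff)
  have inj: "inj_on (\<lambda>d. real d / s) (w ` Poly_Mapping.keys S)" using s by (auto simp: inj_on_def)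
  show ?thesis
    unfolding symb_action_def i sum.reindex[OF inj] o_def e
    by (simp add: graded_action_def app_dif[symmetric] app_app_lie_endo[symmetric] principal_symbol_app e)
qed

lemma equivariant_wrt_iff:
  assumes ww: "\<And>v. ww v = real (w v) / s" and s: "s > 0" and lin: "linear q"
  shows "(\<forall>S. op_action lam mu X (app (q S)) = app (q (symb_action ww lam mu X S)))
     \<longleftrightarrow> equivariant_wrt w q (lie_endo lam mu X)"
proof -
  have "(\<forall>S. op_action lam mu X (app (q S)) = app (q (symb_action ww lam mu X S)))
    \<longleftrightarrow> (\<forall>S. app (lie_endo lam mu X) (q S) = q (symb_action ww lam mu X S))"
    by (simp add: app_app_lie_endo[symmetric] app_inject)
  also have "\<dots> \<longleftrightarrow> equivariant_wrt w q (lie_endo lam mu X)"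
  proof
    assume *: "\<forall>S. app (lie_endo lam mu X) (q S) = q (symb_action ww lam mu X S)"
    show "equivariant_wrt w q (lie_endo lam mu X)"
      unfolding equivariant_wrt_def
    proof (intro allI ballI)
      fix d S assume S: "S \<in> Hom w d"
      show "app (lie_endo lam mu X) (q S) = q (graded_action w (lie_endo lam mu X) d S)"
      \<comment> \<open>The zero symbol is homogeneous of every degree but has no keys, so
        \<open>d\<close> cannot be recovered from it.\<close>
      proof (cases "S = 0")
        case True
        then show ?thesis
          by (simp add: graded_action_def dif_lin linear_0[OF lin] coeffs_of_zero symb_restrict_lin)
      next
        case False
        then have "Poly_Mapping.keys S \<noteq> {}" by simp
        then have "w ` Poly_Mapping.keys S = {d}" using S image_cong[OF refl, of "Poly_Mapping.keys S" w "\<lambda>_. d"] by (simp add: Hom_def image_constant_conv)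
        then show ?thesis using * by (simp add: symb_action_eq[OF ww s] res_id[OF S])
      qed
    qed
  next
    assume *: "equivariant_wrt w q (lie_endo lam mu X)"
    show "\<forall>S. app (lie_endo lam mu X) (q S) = q (symb_action ww lam mu X S)"
    proof
      fix S
      have "S = (\<Sum>d\<in>w ` Poly_Mapping.keys S. res w d S)"
      proof (rule poly_mapping_eqI)
        fix v
        have "lk (\<Sum>d\<in>w ` Poly_Mapping.keys S. res w d S) v = (\<Sum>d\<in>w ` Poly_Mapping.keys S. if d = w v then lk S v else 0)"
          unfolding lookup_sum by (intro sum.cong) (auto simp: lookup_symb_restrict)
        then show "lk S v = lk (\<Sum>d\<in>w ` Poly_Mapping.keys S. res w d S) v"
          by (auto simp: in_keys_iff)
      qed
      then have "q S = q (\<Sum>d\<in>w ` Poly_Mapping.keys S. res w d S)" by (rule arg_cong)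
      then have "app (lie_endo lam mu X) (q S) = app (lie_endo lam mu X) (\<Sum>d\<in>w ` Poly_Mapping.keys S. q (res w d S))"
        unfolding linear_sum[OF lin] by (rule arg_cong)
      then have "app (lie_endo lam mu X) (q S) = (\<Sum>d\<in>w ` Poly_Mapping.keys S. app (lie_endo lam mu X) (q (res w d S)))"
        unfolding app_arg_sum .
      also have "(\<Sum>d\<in>w ` Poly_Mapping.keys S. app (lie_endo lam mu X) (q (res w d S))) = q (symb_action ww lam mu X S)"
        unfolding symb_action_eq[OF ww s] linear_sum[OF lin]
        using *[unfolded equivariant_wrt_def] res_Hom by (intro sum.cong refl) blast
      finally show "app (lie_endo lam mu X) (q S) = q (symb_action ww lam mu X S)" .
    qed
  qed
  finally show ?thesis .
qed

section \<open>The projectively equivariant quantization\<close>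

text \<open>\<open>heisw\<close> is twice the Heisenberg order.\<close>

definition ordw :: "nat \<times> 'n set \<Rightarrow> nat" where "ordw = wt 1 1"
definition heisw :: "nat \<times> 'n set \<Rightarrow> nat" where "heisw = wt 2 1"

lemma ordw_pair [simp]: "ordw (c, K) = c + card K" by (simp add: ordw_def wt_def)
lemma heisw_pair [simp]: "heisw (c, K) = 2 * c + card K" by (simp add: heisw_def wt_def)

lemma one_mop: "1 = mop 1 0 {}" by (simp add: mop_def fm_hom)

lemma Sp_empty: "D \<in> Sp {} \<Longrightarrow> D = 0" by (simp add: Sp_def)

text \<open>The identity operator has weight 0 and nothing lies below, so the congruence of
  \<open>Phi_mop\<close> is an equality.\<close>

lemma Phi_one: "Phi l l 1 = al (real CARD('n)) l l 0 *\<^sub>R (1 :: 'n::{finite,linorder} sfun endo)"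
proof -
  have "Phi l l (1 :: 'n sfun endo) - al (real CARD('n)) l l 0 *\<^sub>R 1 \<in> Sp {}"
    using Phi_mop[of 1 1 l l "1 :: 'n sfun" 0 "{}"] by (simp add: one_mop[symmetric] wt_def)
  from Sp_empty[OF this] show ?thesis by (rule eq_iff_diff_eq_0[THEN iffD2])
qed

lemma Psi_one: "Psi l l 1 = (- l) *\<^sub>R (1 :: 'n::{finite,linorder} sfun endo)"
proof -
  have d: "DD 1 0 {} = (0 :: 'n sfun endo)" by (simp add: DD_def mop_lin)
  have "Psi l l (1 :: 'n sfun endo) - (- l) *\<^sub>R 1 \<in> Sp {}"
    using Psi_mop[of 1 1 l l "1 :: 'n sfun" 0 "{}"] by (simp add: one_mop[symmetric] wt_def d)
  from Sp_empty[OF this] show ?thesis by (rule eq_iff_diff_eq_0[THEN iffD2])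
qed

definition gl_eigenvalue :: "real \<Rightarrow> real \<Rightarrow> real \<Rightarrow> nat \<Rightarrow> real" where
  "gl_eigenvalue n l l' k = al n l' l' 0 + al n l l 0 - 2 * al n l l' (real k)"

lemma gl_casimir_mop:
  fixes A :: "'n::{finite,linorder} sfun"
  assumes "1 \<le> a" "1 \<le> b"
  shows "app (gl_casimir l l') (mop A c K) - gl_eigenvalue (real CARD('n)) l l' (c + card K) *\<^sub>R mop A c K \<in> Low a b (wt a b (c, K))"
proof -
  have eq: "app (gl_casimir l l') (mop A c K) - gl_eigenvalue (real CARD('n)) l l' (c + card K) *\<^sub>R mop A c K
    = (- 2) *\<^sub>R (Phi l l' (mop A c K) - al (real CARD('n)) l l' (real c + real (card K)) *\<^sub>R mop A c K)"
    unfolding gl_casimir_Phi Phi_one gl_eigenvalue_def by (simp add: algebra_simps)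
  show ?thesis unfolding eq by (intro Sp_closed(3) Phi_mop assms)
qed

definition spo_eigenvalue :: "real \<Rightarrow> real \<Rightarrow> real \<Rightarrow> nat \<times> 'n set \<Rightarrow> real" where
  "spo_eigenvalue n l l' v = 2 * (al n l' l' 0 - l' + al n l l 0 - l)
    - 4 * (al n l l' (real (ordw v)) - real (fst v) * (real (fst v) + l - l' + 1) - l)"

lemma spo_casimir_mop:
  fixes A :: "'n::{finite,linorder} sfun"
  assumes "1 \<le> b" "b \<le> a"
  shows "app (spo_casimir l l') (mop A c K) - (spo_eigenvalue (real CARD('n)) l l' (c, K) *\<^sub>R mop A c K + 4 *\<^sub>R DD A c K)
     \<in> Low a b (wt a b (c, K))"
proof -
  have "(r * 4) *\<^sub>R D = (r * 2) *\<^sub>R D + (r * 2) *\<^sub>R D" for r and D :: "'n sfun endo"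
    by (simp flip: scaleR_add_left)
  then have eq: "app (spo_casimir l l') (mop A c K) - (spo_eigenvalue (real CARD('n)) l l' (c, K) *\<^sub>R mop A c K + 4 *\<^sub>R DD A c K)
    = (- 4) *\<^sub>R ((Phi l l' (mop A c K) - al (real CARD('n)) l l' (real c + real (card K)) *\<^sub>R mop A c K)
      + (Psi l l' (mop A c K) - ((- (real c * (real c + l - l' + 1)) - l) *\<^sub>R mop A c K - DD A c K)))"
    unfolding spo_casimir_PhiPsi Phi_one Psi_one spo_eigenvalue_def by (simp add: algebra_simps)
  have "1 \<le> a" using assms by simp
  then show ?thesis
    unfolding eq by (intro Sp_closed(3) Sp_closed(1) Phi_mop Psi_mop assms)
qed

lemma eigenop_gl_casimir:
  assumes "1 \<le> a" "1 \<le> b"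
  shows "eigenop (wt a b) (gl_casimir l l' :: 'n::{finite,linorder} sfun endo endo) (\<lambda>v. gl_eigenvalue (real CARD('n)) l l' (ordw v))"
  unfolding eigenop_def using gl_casimir_mop[OF assms] by auto

lemma eigenop_gl_casimir_ordw:
  "eigenop ordw (gl_casimir l l' :: 'n::{finite,linorder} sfun endo endo) (\<lambda>v. gl_eigenvalue (real CARD('n)) l l' (ordw v))"
  by (rule eigenop_gl_casimir[of 1 1, folded ordw_def]) auto

lemma DD_low:
  fixes A :: "'n::{finite,linorder} sfun"
  shows "DD A c K \<in> Low 2 1 (wt 2 1 (c, K))"
proof (cases c)
  case 0
  then show ?thesis by (simp add: DD_def mop_lin Sp_closed)
next
  case (Suc e)
  then show ?thesis
    unfolding DD_def by (intro Sp_closed(6) Sp_closed(3) Sp_mop) (auto simp: wt_def)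
qed

text \<open>For the Heisenberg weight the off-diagonal part \<open>4 *\<^sub>R DD A c K\<close>
  counts as lower, because trading a \<open>\<zeta>\<close> for a \<open>\<gamma>\<close> loses half
  a degree.\<close>

lemma eigenop_spo_casimir:
  "eigenop heisw (spo_casimir l l' :: 'n::{finite,linorder} sfun endo endo) (spo_eigenvalue (real CARD('n)) l l')"
  unfolding eigenop_def
proof (intro allI)
  fix v :: "nat \<times> 'n set" and A :: "'n sfun"
  obtain c K where v: "v = (c, K)" by force
  show "app (spo_casimir l l') (mopv A v) - spo_eigenvalue (real CARD('n)) l l' v *\<^sub>R mopv A v \<in> Sp {u. heisw u < heisw v}"
    using Sp_closed(1)[OF spo_casimir_mop[of 1 2 l l' A c K] Sp_closed(3)[OF DD_low[of A c K], of 4]]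
    by (simp add: v heisw_def)
qed

lemma eigenop_image:
  assumes e: "eigenop w C g" and D: "D \<in> Sp {v. w v \<le> N \<and> P v}" and g: "\<And>v. w v \<le> N \<Longrightarrow> P v \<Longrightarrow> w v < N \<or> g v = x"
  shows "app C D - x *\<^sub>R D \<in> Sp {v. w v < N}"
proof -
  have "app (C - x *\<^sub>R 1) D \<in> Sp {v. w v < N}"
    using D linear_app
  proof (rule Sp_linear_image)
    fix A c K assume "(c, K) \<in> {v. w v \<le> N \<and> P v}"
    then have v: "w (c, K) \<le> N" "P (c, K)" by auto
    have low: "app C (mop A c K) - g (c, K) *\<^sub>R mop A c K \<in> Sp {v. w v < N}"
    proof (rule Sp_mono)
      show "{u. w u < w (c, K)} \<subseteq> {v. w v < N}" using v(1) by auto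
      show "app C (mop A c K) - g (c, K) *\<^sub>R mop A c K \<in> Sp {u. w u < w (c, K)}"
        using eigenopD[OF e, of A "(c, K)"] by simp
    qed
    have "(g (c, K) - x) *\<^sub>R mop A c K \<in> Sp {v. w v < N}"
      using g[OF v]
    proof
      assume "w (c, K) < N"
      then show ?thesis by (intro Sp_closed(3) Sp_mop) simp
    qed (simp add: Sp_closed)
    then have "(app C (mop A c K) - g (c, K) *\<^sub>R mop A c K) + (g (c, K) - x) *\<^sub>R mop A c K \<in> Sp {v. w v < N}"
      using low by (rule Sp_closed(1)[rotated])
    then show "app (C - x *\<^sub>R 1) (mop A c K) \<in> Sp {v. w v < N}" by (simp add: algebra_simps)
  qed
  then show ?thesis by simp
qed

lemma eigenop_preserves: "eigenop w C g \<Longrightarrow> preserves w C"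
  unfolding preserves_def
proof (intro allI ballI)
  fix n D assume e: "eigenop w C g" and D: "D \<in> Sp {v. w v \<le> n}"
  have "app C D - 0 *\<^sub>R D \<in> Sp {v. w v < Suc n}"
  proof (rule eigenop_image[OF e])
    show "D \<in> Sp {v. w v \<le> Suc n \<and> w v \<le> n}" by (rule Sp_mono[OF _ D]) auto
  qed auto
  then show "app C D \<in> Sp {v. w v \<le> n}" by (simp add: less_Suc_eq_le)
qed

text \<open>
  A Lagrange product: it kills the eigenvalues \<open>g 0, \<dots>, g (j - 1)\<close> and is normalised at \<open>g k\<close>.
\<close>

primrec spectral_proj :: "'n::{finite,linorder} sfun endo endo \<Rightarrow> (nat \<Rightarrow> real) \<Rightarrow> nat \<Rightarrow> nat \<Rightarrow> 'n sfun endo endo" where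
  "spectral_proj C g k 0 = 1"
| "spectral_proj C g k (Suc j) = (1 / (g k - g j)) *\<^sub>R ((C - g j *\<^sub>R 1) * spectral_proj C g k j)"

lemma spectral_proj_commute: "X * C = C * X \<Longrightarrow> X * spectral_proj C g k j = spectral_proj C g k j * X"
proof (induction j)
  case (Suc j)
  then have "X * (C - g j *\<^sub>R 1) = (C - g j *\<^sub>R 1) * X" by (simp add: algebra_simps)
  then have "X * ((C - g j *\<^sub>R 1) * spectral_proj C g k j) = (C - g j *\<^sub>R 1) * (X * spectral_proj C g k j)"
    by (simp only: mult.assoc[symmetric])
  then show ?case using Suc by (simp add: mult.assoc)
qed simp

text \<open>The factor \<open>C - g j\<close> maps the span of weights up to \<open>j\<close> into
  that of weights below \<open>j\<close>. The factors commute, so this one may act first and the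
  induction proceeds downwards.\<close>

lemma spectral_proj_kill:
  assumes e: "eigenop w C (\<lambda>v. g (w v))" and D: "D \<in> Sp {v. w v < j}"
  shows "app (spectral_proj C g k j) D = 0"
  using D
proof (induction j arbitrary: D)
  case 0
  then show ?case using Sp_empty[of D] by simp
next
  case (Suc j)
  have "app C D - g j *\<^sub>R D \<in> Sp {v. w v < j}"
  proof (rule eigenop_image[OF e])
    show "D \<in> Sp {v. w v \<le> j \<and> True}" using Suc.prems by (simp add: less_Suc_eq_le)
    show "w v < j \<or> g (w v) = g j" if "w v \<le> j" for v using that by (cases "w v = j") auto
  qed
  then have z: "app (spectral_proj C g k j) (app C D - g j *\<^sub>R D) = 0" by (rule Suc.IH)
  have c: "(C - g j *\<^sub>R 1) * spectral_proj C g k j = spectral_proj C g k j * (C - g j *\<^sub>R 1)"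
    by (rule spectral_proj_commute) (simp add: algebra_simps)
  have "app ((C - g j *\<^sub>R 1) * spectral_proj C g k j) D = 0"
    unfolding c using z by (simp del: app_arg)
  then show ?case by (simp only: spectral_proj.simps app_simps scaleR_zero_right)
qed

text \<open>Modulo lower weight the factor number \<open>j\<close> multiplies by
  \<open>g k - g j\<close> and is divided by the same number. The filtration \<open>w\<close> is
  independent of the order because the projection is used both for \<open>ordw\<close> and for
  \<open>heisw\<close>.\<close>

lemma spectral_proj_top:
  assumes e: "eigenop w C (\<lambda>v. g (ordw v))" and g: "\<And>i. i < k \<Longrightarrow> g k \<noteq> g i"
    and D: "D \<in> Sp {v. w v \<le> N \<and> ordw v = k}" and j: "j \<le> k"
  shows "app (spectral_proj C g k j) D - D \<in> Sp {v. w v < N}"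
  using j
proof (induction j)
  case 0
  then show ?case by (simp add: Sp_closed)
next
  case (Suc j)
  define L where "L = app (spectral_proj C g k j) D - D"
  have L: "L \<in> Sp {v. w v < N}" using Suc by (simp add: L_def)
  have 1: "app C D - g k *\<^sub>R D \<in> Sp {v. w v < N}"
    by (rule eigenop_image[OF e D]) auto
  have 2: "app C L - g j *\<^sub>R L \<in> Sp {v. w v < N}"
    by (intro Sp_closed L preserves_less[OF eigenop_preserves[OF e]])
  have ne: "g k - g j \<noteq> 0" using g[of j] Suc.prems by simp
  have "app (spectral_proj C g k j) D = D + L" by (simp add: L_def)
  then have "app (spectral_proj C g k (Suc j)) D - D = (1 / (g k - g j)) *\<^sub>R (app C (D + L) - g j *\<^sub>R (D + L)) - D"
    by (simp del: app_arg)
  also have "\<dots> = (1 / (g k - g j)) *\<^sub>R ((app C D - g k *\<^sub>R D) + (app C L - g j *\<^sub>R L) + (g k - g j) *\<^sub>R D) - D"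
    by (simp add: algebra_simps)
  also have "\<dots> = (1 / (g k - g j)) *\<^sub>R ((app C D - g k *\<^sub>R D) + (app C L - g j *\<^sub>R L))"
    using ne by (subst scaleR_add_right) simp
  also have "\<dots> \<in> Sp {v. w v < N}" by (intro Sp_closed(1,3) 1 2)
  finally show ?case .
qed

abbreviation PR :: "real \<Rightarrow> real \<Rightarrow> nat \<Rightarrow> 'n::{finite,linorder} sfun endo endo" where
  "PR l l' k \<equiv> spectral_proj (gl_casimir l l') (gl_eigenvalue (real CARD('n)) l l') k k"

lemma linear_ext:
  assumes "\<And>v. linear (f v)"
  shows "linear (\<lambda>S :: 'n::{finite,linorder} symb. \<Sum>v\<in>Poly_Mapping.keys S. f v (lk S v))"
proof -
  have s: "(\<Sum>v\<in>Poly_Mapping.keys S. f v (lk S v)) = (\<Sum>v\<in>X. f v (lk S v))"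
    if "finite X" "Poly_Mapping.keys S \<subseteq> X" for X and S :: "'n symb"
    using that linear_0[OF assms] by (intro sum.mono_neutral_left) (auto simp: in_keys_iff)
  show ?thesis
  proof (rule linearI)
    fix S T :: "'n symb"
    let ?X = "Poly_Mapping.keys S \<union> Poly_Mapping.keys T"
    show "(\<Sum>v\<in>Poly_Mapping.keys (S + T). f v (lk (S + T) v))
      = (\<Sum>v\<in>Poly_Mapping.keys S. f v (lk S v)) + (\<Sum>v\<in>Poly_Mapping.keys T. f v (lk T v))"
      using s[of ?X S] s[of ?X T] s[of ?X "S + T"] keys_add[of S T]
      by (simp add: lookup_add linear_add[OF assms] sum.distrib)
  next
    fix r and S :: "'n symb"
    have "Poly_Mapping.keys (r *\<^sub>R S) \<subseteq> Poly_Mapping.keys S" by (auto simp: in_keys_iff)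
    then show "(\<Sum>v\<in>Poly_Mapping.keys (r *\<^sub>R S). f v (lk (r *\<^sub>R S) v)) = r *\<^sub>R (\<Sum>v\<in>Poly_Mapping.keys S. f v (lk S v))"
      using s[of "Poly_Mapping.keys S" "r *\<^sub>R S"] by (simp add: linear_cmul[OF assms] scaleR_sum_right)
  qed
qed

lemma ext_single:
  assumes "linear (f v)"
  shows "(\<Sum>u\<in>Poly_Mapping.keys (Poly_Mapping.single v A). f u (lk (Poly_Mapping.single v A) u)) = f v A"
  using linear_0[OF assms] by simp

text \<open>Each monomial of order \<open>k\<close> is sent to the eigenvector of the
  \<open>gl(2|n)\<close> Casimir with that leading part, obtained by a spectral projection.\<close>

definition sl_map :: "real \<Rightarrow> real \<Rightarrow> 'n::{finite,linorder} symb \<Rightarrow> 'n sfun endo" where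
  "sl_map l l' S = (\<Sum>v\<in>Poly_Mapping.keys S. app (PR l l' (ordw v)) (mopv (lk S v) v))"

lemma linear_sl_map: "linear (sl_map l l')"
  unfolding sl_map_def by (rule linear_ext) (simp add: linear_iff mop_lin)

lemma sl_map_Hom:
  assumes "S \<in> Hom ordw k" shows "sl_map l l' S = app (PR l l' k) (dif S)"
  unfolding sl_map_def dif_def app_arg_sum using assms by (intro sum.cong) (auto simp: Hom_def)

lemma quantization_map_sl_map:
  assumes g: "\<And>i k. i < k \<Longrightarrow> gl_eigenvalue (real CARD('n)) l l' k \<noteq> gl_eigenvalue (real CARD('n)) l l' i"
  shows "quantization_map ordw (sl_map l l' :: 'n::{finite,linorder} symb \<Rightarrow> _)"
  unfolding quantization_map_def
proof (intro conjI allI ballI)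
  fix d and S :: "'n symb" assume S: "S \<in> Hom ordw d"
  show "sl_map l l' S - dif S \<in> Sp {v. ordw v < d}"
    unfolding sl_map_Hom[OF S]
  proof (rule spectral_proj_top[OF eigenop_gl_casimir_ordw g _ order_refl])
    show "dif S \<in> Sp {v. ordw v \<le> d \<and> ordw v = d}" by (rule Sp_mono[OF _ Hom_dif[OF S]]) auto
  qed
qed (rule linear_sl_map)

text \<open>The projection commutes with \<open>X\<close>, and the part of \<open>X\<close> that
  lowers the order of a symbol of order \<open>d\<close> is annihilated by the projection belonging
  to \<open>d\<close>. What remains is the graded action.\<close>

lemma equivariant_wrt_sl_map:
  assumes p: "preserves ordw X" and c: "X * gl_casimir l l' = gl_casimir l l' * X"
  shows "equivariant_wrt ordw (sl_map l l' :: 'n::{finite,linorder} symb \<Rightarrow> _) X"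
  unfolding equivariant_wrt_def
proof (intro allI ballI)
  fix d and S :: "'n symb" assume S: "S \<in> Hom ordw d"
  have e: "eigenop ordw (gl_casimir l l' :: 'n sfun endo endo) (\<lambda>v. gl_eigenvalue (real CARD('n)) l l' (ordw v))" by (rule eigenop_gl_casimir_ordw)
  have "app X (sl_map l l' S) = app (X * PR l l' d) (dif S)" by (simp add: sl_map_Hom[OF S])
  also have "X * PR l l' d = PR l l' d * X" by (rule spectral_proj_commute[OF c])
  also have "app (PR l l' d * X) (dif S) = app (PR l l' d) (dif (graded_action ordw X d S))
      + app (PR l l' d) (app X (dif S) - dif (graded_action ordw X d S))"
    by simp
  also have "app (PR l l' d) (app X (dif S) - dif (graded_action ordw X d S)) = 0"
    by (rule spectral_proj_kill[OF e graded_action_low[OF p S]])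
  finally show "app X (sl_map l l' S) = sl_map l l' (graded_action ordw X d S)" by (simp add: sl_map_Hom[OF graded_action_Hom])
qed

lemma preserves_ee: "preserves ordw (ee l l' i j)"
  unfolding preserves_def ordw_def by (intro allI ballI ee_Fil)

lemma preserves_mm: "preserves ordw (mm l l' i j)" "preserves heisw (mm l l' i j)"
  unfolding preserves_def ordw_def heisw_def by (intro allI ballI mm_Fil; simp)+

text \<open>The factor \<open>s\<close> rescales the real weights to natural numbers: 1 for the
  order, 2 for the Heisenberg order.\<close>

lemma quant_iff:
  fixes Q :: "'n::{finite,linorder} symb \<Rightarrow> 'n sfun \<Rightarrow> 'n sfun"
  assumes ww: "\<And>v. ww v = real (w v) / s" and s: "s > 0"
  shows "(\<forall>g. linear (\<lambda>S. Q S g)) \<and> range Q \<subseteq> diffops \<and>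
     (\<forall>d. \<forall>S\<in>homogeneous_symbols ww (real d / s).
        Q S \<in> op_filtration ww (real d / s) \<and> principal_symbol ww (real d / s) (Q S) = S)
     \<longleftrightarrow> (\<exists>q. Q = (\<lambda>S. app (q S)) \<and> quantization_map w q)"
proof -
  have e: "ww v = real d / s \<longleftrightarrow> w v = d" "ww v \<le> real d / s \<longleftrightarrow> w v \<le> d" for v d
    using s by (auto simp: ww divide_le_cancel)
  have h: "homogeneous_symbols ww (real d / s) = Hom w d" for d
    by (simp add: homogeneous_symbols_def Hom_def e)
  show ?thesis
  proof (intro iffI; (elim conjE exE)?)
    assume lin: "\<forall>g. linear (\<lambda>S. Q S g)" and r: "range Q \<subseteq> diffops"
      and *: "\<forall>d. \<forall>S\<in>homogeneous_symbols ww (real d / s).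
        Q S \<in> op_filtration ww (real d / s) \<and> principal_symbol ww (real d / s) (Q S) = S"
    define q where "q S = Endo (Q S)" for S
    have Q: "app (q S) = Q S" for S
    proof -
      have "Q S \<in> diffops" using r by auto
      then obtain T where "Q S = app (dif T)" by (auto simp: diffops_def app_dif)
      then show ?thesis by (simp add: q_def app_inverse)
    qed
    have "linear q"
    proof (rule linearI)
      show "q (S + T) = q S + q T" for S T
        by (rule endo_eqI) (simp add: Q linear_add[OF spec[OF lin]])
      show "q (r *\<^sub>R S) = r *\<^sub>R q S" for r S
        by (rule endo_eqI) (simp add: Q linear_cmul[OF spec[OF lin]])
    qed
    moreover have "q S - dif S \<in> Sp {v. w v < d}" if "S \<in> Hom w d" for d S
    proof -
      have "app (q S) \<in> op_filtration ww (real d / s)" "principal_symbol ww (real d / s) (app (q S)) = S"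
        using *[rule_format, of S d] that unfolding h Q by blast+
      then have "q S \<in> Sp {v. w v \<le> d}" "res w d (coeffs_of (q S)) = S"
        by (simp_all add: op_filtration_iff principal_symbol_app e)
      then show ?thesis using coeffs_of_top[of "q S" w d] by simp
    qed
    ultimately have "quantization_map w q" by (simp add: quantization_map_def)
    moreover have "Q = (\<lambda>S. app (q S))" by (rule ext) (rule Q[symmetric])
    ultimately show "\<exists>q. Q = (\<lambda>S. app (q S)) \<and> quantization_map w q" by blast
  next
    fix q assume Q: "Q = (\<lambda>S. app (q S))" and q: "quantization_map w q"
    have c1: "linear (\<lambda>S. Q S g)" for g
      unfolding Q using quantization_map_linear[OF q] by (simp add: linear_iff)
    have c2: "range Q \<subseteq> diffops"
    proof -
      have "range q = Sp UNIV" using quantization_map_bij[OF q] by (simp add: bij_betw_def)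
      then have "q S \<in> Sp UNIV" for S using rangeI[of q S] by simp
      then show ?thesis unfolding Q by (auto simp: app_in_diffops)
    qed
    have c3: "Q S \<in> op_filtration ww (real d / s) \<and> principal_symbol ww (real d / s) (Q S) = S"
      if "S \<in> homogeneous_symbols ww (real d / s)" for d S
    proof -
      have S: "S \<in> Hom w d" using that by (simp add: h)
      have l: "q S - dif S \<in> Sp {v. w v < d}" by (rule quantization_map_low[OF q S])
      have "(q S - dif S) + dif S \<in> Sp {v. w v \<le> d}"
        by (intro Sp_closed(1) Sp_less_le[OF l] Sp_eq_le[OF Hom_dif[OF S]])
      then show ?thesis using res_coeffs_of_unique[OF S l]
        by (simp add: Q op_filtration_iff principal_symbol_app e)
    qed
    show "(\<forall>g. linear (\<lambda>S. Q S g)) \<and> range Q \<subseteq> diffops \<and>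
     (\<forall>d. \<forall>S\<in>homogeneous_symbols ww (real d / s).
        Q S \<in> op_filtration ww (real d / s) \<and> principal_symbol ww (real d / s) (Q S) = S)"
      by (intro conjI[OF _ conjI] allI ballI c1 c2 c3)
  qed
qed

lemma equivariant_wrt_span:
  assumes q: "quantization_map w q" and G: "\<And>X. X \<in> G \<Longrightarrow> preserves w (lie_endo lam mu X) \<and> equivariant_wrt w q (lie_endo lam mu X)"
    and X: "X \<in> span G"
  shows "preserves w (lie_endo lam mu X) \<and> equivariant_wrt w q (lie_endo lam mu X)"
  using X
proof (induction rule: span_induct_alt)
  case base
  then show ?case using preserves_closed(4) equivariant_wrt_zero[OF q] by (simp add: lie_endo_lin)
next
  case (step c x y)
  then have x: "preserves w (lie_endo lam mu x)" "equivariant_wrt w q (lie_endo lam mu x)" using G by auto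
  have cx: "preserves w (c *\<^sub>R lie_endo lam mu x)" "equivariant_wrt w q (c *\<^sub>R lie_endo lam mu x)"
    by (rule preserves_closed(2)[OF x(1)], rule equivariant_wrt_scaleR[OF q x])
  show ?case
    unfolding lie_endo_lin
    by (intro conjI preserves_closed(1) equivariant_wrt_add[OF q] cx) (use step(2) in simp_all)
qed

abbreviation preserved_equivariant :: "'n::{finite,linorder} weight \<Rightarrow> ('n symb \<Rightarrow> 'n sfun endo) \<Rightarrow> 'n sfun endo endo \<Rightarrow> bool" where
  "preserved_equivariant w q X \<equiv> preserves w X \<and> equivariant_wrt w q X"

lemma preserved_equivariant_closed:
  assumes q: "quantization_map w q"
  shows "preserved_equivariant w q X \<Longrightarrow> preserved_equivariant w q Y \<Longrightarrow> preserved_equivariant w q (X + Y)" "preserved_equivariant w q X \<Longrightarrow> preserved_equivariant w q (r *\<^sub>R X)"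
    "preserved_equivariant w q X \<Longrightarrow> preserved_equivariant w q Y \<Longrightarrow> preserved_equivariant w q (X * Y)" "preserved_equivariant w q 1"
    "(\<And>x. x \<in> A \<Longrightarrow> preserved_equivariant w q (f x)) \<Longrightarrow> preserved_equivariant w q (sum f A)"
proof -
  show "preserved_equivariant w q X \<Longrightarrow> preserved_equivariant w q Y \<Longrightarrow> preserved_equivariant w q (X + Y)"
    by (intro conjI preserves_closed(1) equivariant_wrt_add[OF q]) simp_all
  show "preserved_equivariant w q X \<Longrightarrow> preserved_equivariant w q (r *\<^sub>R X)"
    by (intro conjI preserves_closed(2) equivariant_wrt_scaleR[OF q]) simp_all
  show "preserved_equivariant w q X \<Longrightarrow> preserved_equivariant w q Y \<Longrightarrow> preserved_equivariant w q (X * Y)"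
    by (intro conjI preserves_closed(3) equivariant_wrt_mult[OF q]) simp_all
  show "preserved_equivariant w q 1" by (intro conjI preserves_closed(5) equivariant_wrt_one[OF q])
  show "(\<And>x. x \<in> A \<Longrightarrow> preserved_equivariant w q (f x)) \<Longrightarrow> preserved_equivariant w q (sum f A)"
    by (intro conjI preserves_sum equivariant_wrt_sum[OF q]) simp_all
qed

lemma preserved_equivariant_uminus: "quantization_map w q \<Longrightarrow> preserved_equivariant w q X \<Longrightarrow> preserved_equivariant w q (- X)"
  using preserved_equivariant_closed(2)[of w q X "- 1"] by simp

lemma preserved_equivariant_diff: "quantization_map w q \<Longrightarrow> preserved_equivariant w q X \<Longrightarrow> preserved_equivariant w q Y \<Longrightarrow> preserved_equivariant w q (X - Y)"
  using preserved_equivariant_closed(1)[of w q X "- Y"] preserved_equivariant_uminus[of w q Y] by simp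

text \<open>The spanning fields of \<open>pgl\<close> contain none for the index pair
  \<open>None None\<close>. By Euler's identity the sum of all diagonal matrix units acts by a
  scalar, which recovers the missing one.\<close>

lemma ee_trace: "ee l l' None None = (l - l') *\<^sub>R 1 - (\<Sum>j\<in>UNIV. ee l l' (Some j) (Some j))"
proof -
  have s: "(\<Sum>a\<in>UNIV. EE l a a) = - (l *\<^sub>R (1 :: 'a sfun endo))" for l
    unfolding EE_def by (rule sum_yy_pp)
  have "(\<Sum>a\<in>UNIV. ee l l' a a) = AD False (\<Sum>a\<in>UNIV. EE l' a a) (\<Sum>a\<in>(UNIV :: 'a idx set). EE l a a)"
    by (rule endo_eqI) (simp add: ee_def app_sum sum_distrib_left sum_distrib_right sum_subtractf)
  also have "\<dots> = (l - l') *\<^sub>R 1" unfolding s by (rule endo_eqI) (simp add: cj_simps algebra_simps)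
  finally show ?thesis by (simp add: sum_option algebra_simps)
qed

lemma pgl_equivariant_wrt_iff:
  fixes q :: "'n::{finite,linorder} symb \<Rightarrow> _"
  assumes n: "CARD('n) \<noteq> 2" and q: "quantization_map ordw q"
  shows "(\<forall>X\<in>pgl. equivariant_wrt ordw q (lie_endo lam mu X)) \<longleftrightarrow> (\<forall>i j. equivariant_wrt ordw q (ee (2 * lam) (2 * mu) i j))"
proof
  let ?e = "ee (2 * lam) (2 * mu) :: 'n idx \<Rightarrow> _"
  assume *: "\<forall>X\<in>pgl. equivariant_wrt ordw q (lie_endo lam mu X)"
  have gen: "equivariant_wrt ordw q (lie_endo lam mu X)"
    if "X \<in> range coord_field \<union> {vf_scale (coord i) (coord_field j) | i j. True}
     \<union> range (\<lambda>j. vf_scale (coord j) euler_field)" for X :: "'n vfield"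
    using * span_base[OF that] unfolding pgl_def by blast
  have 1: "preserved_equivariant ordw q (?e None (Some j))" for j
    using gen[of "coord_field j"] preserves_ee[of "2 * lam" "2 * mu" None "Some j"] unfolding lie_endo_coord_field by blast
  have 2: "preserved_equivariant ordw q (?e (Some i) (Some j))" for i j
  proof -
    obtain r where r: "lie_endo lam mu (vf_scale (coord i) (coord_field j)) = ?e (Some i) (Some j) + r *\<^sub>R 1"
      using lie_endo_linear_field by blast
    have "equivariant_wrt ordw q (lie_endo lam mu (vf_scale (coord i) (coord_field j)))" by (rule gen) blast
    then have "preserved_equivariant ordw q (?e (Some i) (Some j) + r *\<^sub>R 1)"
      unfolding r by (intro conjI preserves_closed(1,2,5) preserves_ee)
    from preserved_equivariant_diff[OF q this preserved_equivariant_closed(2)[OF q preserved_equivariant_closed(4)[OF q], of r]] show ?thesis by simp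
  qed
  have 3: "preserved_equivariant ordw q (?e (Some j) None)" for j
  proof -
    have "equivariant_wrt ordw q (lie_endo lam mu (vf_scale (coord j) euler_field))" by (rule gen) blast
    then have "preserved_equivariant ordw q (- ?e (Some j) None)"
      unfolding lie_endo_quadratic_field[OF n] using preserves_closed(2)[OF preserves_ee[of "2 * lam" "2 * mu" "Some j" None], of "- 1"] by simp
    from preserved_equivariant_uminus[OF q this] show ?thesis by simp
  qed
  have 4: "preserved_equivariant ordw q (?e None None)"
    unfolding ee_trace by (rule preserved_equivariant_diff[OF q preserved_equivariant_closed(2)[OF q preserved_equivariant_closed(4)[OF q]] preserved_equivariant_closed(5)[OF q 2]])
  show "\<forall>i j. equivariant_wrt ordw q (?e i j)"
  proof (intro allI)
    show "equivariant_wrt ordw q (?e i j)" for i j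
      by (cases i; cases j) (simp_all add: 1 2 3 4)
  qed
next
  let ?e = "ee (2 * lam) (2 * mu) :: 'n idx \<Rightarrow> _"
  assume "\<forall>i j. equivariant_wrt ordw q (?e i j)"
  then have e: "preserved_equivariant ordw q (?e i j)" for i j by (simp add: preserves_ee)
  show "\<forall>X\<in>pgl. equivariant_wrt ordw q (lie_endo lam mu X)"
  proof
    fix X :: "'n vfield" assume "X \<in> pgl"
    then have X: "X \<in> span (range coord_field \<union> {vf_scale (coord i) (coord_field j) | i j. True}
     \<union> range (\<lambda>j. vf_scale (coord j) euler_field))" by (simp add: pgl_def)
    have "preserved_equivariant ordw q (lie_endo lam mu X)"
    proof (rule equivariant_wrt_span[OF q _ X], elim UnE)
      fix Y :: "'n vfield"
      show "Y \<in> range coord_field \<Longrightarrow> preserved_equivariant ordw q (lie_endo lam mu Y)"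
        by (elim imageE) (simp only: lie_endo_coord_field e)
      show "Y \<in> range (\<lambda>j. vf_scale (coord j) euler_field) \<Longrightarrow> preserved_equivariant ordw q (lie_endo lam mu Y)"
        by (elim imageE) (simp only: lie_endo_quadratic_field[OF n] preserved_equivariant_uminus[OF q e])
      assume "Y \<in> {vf_scale (coord i) (coord_field j) | i j. True}"
      then obtain i j where Y: "Y = vf_scale (coord i) (coord_field j)" by auto
      obtain r where "lie_endo lam mu Y = ?e (Some i) (Some j) + r *\<^sub>R 1"
        unfolding Y using lie_endo_linear_field by blast
      then show "preserved_equivariant ordw q (lie_endo lam mu Y)"
        by (simp only:) (rule preserved_equivariant_closed(1)[OF q e preserved_equivariant_closed(2)[OF q preserved_equivariant_closed(4)[OF q]]])
    qed
    then show "equivariant_wrt ordw q (lie_endo lam mu X)" by blast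
  qed
qed

text \<open>The difference of the eigenvalues has the factors \<open>k - i\<close> and
  \<open>k + i + 1 - n - 2 \<delta>\<close>. The second vanishes exactly at the element of
  \<open>C_pgl\<close> with parameters \<open>k\<close> and \<open>k - i\<close>.\<close>

lemma gl_eigenvalue_nonres:
  assumes "\<delta> = mu - lam" "\<delta> \<notin> C_pgl (1 - n)" "i < k"
  shows "gl_eigenvalue n (2 * lam) (2 * mu) k \<noteq> gl_eigenvalue n (2 * lam) (2 * mu) i"
proof
  assume "gl_eigenvalue n (2 * lam) (2 * mu) k = gl_eigenvalue n (2 * lam) (2 * mu) i"
  then have "al n (2 * lam) (2 * mu) (real k) = al n (2 * lam) (2 * mu) (real i)" by (simp add: gl_eigenvalue_def)
  then have "(real k - real i) * (real k + real i + (1 - n) - 2 * \<delta>) = 0"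
    by (simp add: al_def assms(1) algebra_simps)
  then have "\<delta> = (2 * real k - real (k - i) + (1 - n)) / 2" using assms(3) by (simp add: of_nat_diff)
  moreover have "k - i \<in> {1..k}" using assms(3) by auto
  ultimately have "\<delta> \<in> C_pgl (1 - n)" unfolding C_pgl_def by blast
  with assms(2) show False by simp
qed

lemma order_weight_eq: "order_weight v = real (ordw v) / 1"
  by (cases v) (simp add: order_weight_def wt_def)

lemma heis_weight_eq: "heis_weight v = real (heisw v) / 2"
  by (cases v) (simp add: heis_weight_def wt_def)

lemma pgl_quantization_iff:
  fixes Q :: "'n::{finite,linorder} symb \<Rightarrow> 'n sfun \<Rightarrow> 'n sfun"
  assumes n: "CARD('n) \<noteq> 2"
  shows "pgl_quantization lam mu Q \<longleftrightarrow> (\<exists>q. Q = (\<lambda>S. app (q S)) \<and> quantization_map ordw q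
    \<and> (\<forall>i j. equivariant_wrt ordw q (ee (2 * lam) (2 * mu) i j)))"
proof -
  have eq: "(\<forall>X\<in>pgl. \<forall>S. op_action lam mu X (Q S) = Q (symb_action order_weight lam mu X S))
     \<longleftrightarrow> (\<forall>i j. equivariant_wrt ordw q (ee (2 * lam) (2 * mu) i j))" if Q: "Q = (\<lambda>S. app (q S))" and q: "quantization_map ordw q" for q
    unfolding pgl_equivariant_wrt_iff[OF n q, symmetric] Q
    using equivariant_wrt_iff[of order_weight ordw 1 q, OF order_weight_eq zero_less_one quantization_map_linear[OF q]] by simp
  have "pgl_quantization lam mu Q \<longleftrightarrow> (\<exists>q. Q = (\<lambda>S. app (q S)) \<and> quantization_map ordw q) \<and>
     (\<forall>X\<in>pgl. \<forall>S. op_action lam mu X (Q S) = Q (symb_action order_weight lam mu X S))"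
    using quant_iff[of order_weight ordw 1 Q, OF order_weight_eq zero_less_one]
    unfolding pgl_quantization_def by simp blast
  then show ?thesis using eq by blast
qed

lemma Q_sl_eq:
  assumes n: "CARD('n) \<noteq> 2" and \<delta>: "\<delta> = mu - lam" "\<delta> \<notin> C_pgl (1 - real CARD('n))"
  shows "Q_sl lam mu = (\<lambda>S :: 'n::{finite,linorder} symb. app (sl_map (2 * lam) (2 * mu) S))"
  unfolding Q_sl_def
proof (rule the_equality)
  let ?l = "2 * lam" and ?l' = "2 * mu"
  note g = gl_eigenvalue_nonres[OF \<delta>]
  have e: "eigenop ordw (gl_casimir ?l ?l' :: 'n sfun endo endo) (\<lambda>v. gl_eigenvalue (real CARD('n)) ?l ?l' (ordw v))"
    by (rule eigenop_gl_casimir_ordw)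
  have qs: "quantization_map ordw (sl_map ?l ?l' :: 'n symb \<Rightarrow> _)" by (rule quantization_map_sl_map[OF g])
  have es: "equivariant_wrt ordw (sl_map ?l ?l' :: 'n symb \<Rightarrow> _) (ee ?l ?l' i j)" for i j
    by (rule equivariant_wrt_sl_map[OF preserves_ee ee_gl_casimir])
  show "pgl_quantization lam mu (\<lambda>S :: 'n symb. app (sl_map ?l ?l' S))"
    unfolding pgl_quantization_iff[OF n] using qs es by blast
  \<comment> \<open>Uniqueness reduces to the Casimir: equivariance for the generators passes to
    this polynomial in them.\<close>
  have C: "equivariant_wrt ordw q (gl_casimir ?l ?l')" if q: "quantization_map ordw q" and "\<And>i j. equivariant_wrt ordw q (ee ?l ?l' i j)" for q :: "'n symb \<Rightarrow> _"
  proof -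
    have e: "preserved_equivariant ordw q (ee ?l ?l' i j)" for i j using that preserves_ee by blast
    have "preserved_equivariant ordw q (gl_casimir ?l ?l')" unfolding gl_casimir_def by (intro preserved_equivariant_closed(2,3,5)[OF q] e)
    then show ?thesis by blast
  qed
  fix Q :: "'n symb \<Rightarrow> 'n sfun \<Rightarrow> 'n sfun" assume "pgl_quantization lam mu Q"
  then obtain q where Q: "Q = (\<lambda>S. app (q S))" and q: "quantization_map ordw q" "\<And>i j. equivariant_wrt ordw q (ee ?l ?l' i j)"
    unfolding pgl_quantization_iff[OF n] by blast
  have "q = sl_map ?l ?l'"
    by (rule quantization_map_unique[OF q(1) C[OF q] qs C[OF qs es] e]) (metis g)
  then show "Q = (\<lambda>S. app (sl_map ?l ?l' S))" by (simp add: Q)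
qed

section \<open>The fine quantization\<close>

lemma contact_scaleR: "contact_field (r *\<^sub>R f) = r *\<^sub>R contact_field f"
proof (rule prod_eqI)
  show "fst (contact_field (r *\<^sub>R f)) = fst (r *\<^sub>R contact_field f)"
    by (simp add: fst_contact par_simps Dbar_scaleR scaleR_sum_right algebra_simps)
  show "snd (contact_field (r *\<^sub>R f)) = snd (r *\<^sub>R contact_field f)"
    by (simp add: vec_eq_iff snd_contact par_simps Dbar_scaleR)
qed

lemma spo_generators_ys:
  assumes "f \<in> spo_generators" obtains a b where "f = ys a * ys b"
proof -
  consider "f = ys None * ys None" | "f = ys None * ys (Some None)" | "f = ys (Some None) * ys (Some None)"
    | i where "f = ys None * ys (Some (Some i))" | i where "f = ys (Some None) * ys (Some (Some i))"
    | i j where "f = ys (Some (Some i)) * ys (Some (Some j))"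
    using assms unfolding spo_generators_def by force
  then show ?thesis using that by cases
qed

text \<open>The generators list each product of coordinates in one order only; the others agree with
  a listed one up to sign, and the square of an odd coordinate is 0.\<close>

lemma contact_ys_spo: "contact_field (ys a * ys (b :: 'n::{finite,linorder} idx)) \<in> spo"
proof -
  have base: "contact_field f \<in> spo" if "f \<in> spo_generators" for f :: "'n sfun"
    unfolding spo_def using that by (intro span_base) simp
  have neg: "contact_field (- f) \<in> spo" if "f \<in> spo_generators" for f :: "'n sfun"
    using span_neg[OF base[OF that, unfolded spo_def]] contact_scaleR[of "- 1" f] by (simp add: spo_def)
  have zero: "contact_field (0 :: 'n sfun) \<in> spo"
    using contact_scaleR[of 0 "0 :: 'n sfun"] by (simp add: spo_def span_zero)
  have g: "1 \<in> spo_generators" "sf_x \<in> spo_generators" "sf_x * sf_x \<in> spo_generators"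
    "sf_theta i \<in> spo_generators" "sf_x * sf_theta i \<in> spo_generators"
    "i < j \<Longrightarrow> sf_theta i * sf_theta j \<in> spo_generators" for i j :: 'n
    by (auto simp: spo_generators_def)
  show ?thesis
  proof (cases a rule: idx_cases)
    case 1
    then show ?thesis by (cases b rule: idx_cases) (simp_all add: base g)
  next
    case 2
    then show ?thesis by (cases b rule: idx_cases) (simp_all add: base g)
  next
    case (3 i)
    show ?thesis
    proof (cases b rule: idx_cases)
      case 2
      have "ys a * ys b = sf_x * sf_theta i" unfolding 2 3 ys_simps by (rule sf_x_central)
      then show ?thesis by (simp add: base g)
    next
      case b: (3 j)
      consider "i < j" | "j < i" | "i = j" by force
      then show ?thesis
      proof cases
        case 2
        have "ys a * ys b = - (sf_theta j * sf_theta i)" unfolding 3 b ys_simps by (rule theta_comm)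
        then show ?thesis using neg[OF g(6)[OF 2]] by simp
      next
        case i: 3
        have "ys a * ys b = 0" using theta_theta[of i 1] by (simp add: 3 b i)
        then show ?thesis by (simp add: zero)
      qed (simp add: 3 b base g)
    qed (simp add: 3 base g)
  qed
qed

lemma om_om [simp]: "om a * om a = 1" "om a * (om a * r) = r" by (auto simp: om_def)

lemma lie_endo_contact':
  assumes "CARD('n::{finite,linorder}) \<noteq> 2"
  shows "lie_endo lam mu (contact_field (ys a * ys b)) = (om b / 2) *\<^sub>R mm (2 * lam) (2 * mu) a (os (b :: 'n idx))"
  unfolding lie_endo_contact[OF assms] by simp

lemma spo_equivariant_wrt_iff:
  fixes q :: "'n::{finite,linorder} symb \<Rightarrow> _"
  assumes n: "CARD('n) \<noteq> 2" and q: "quantization_map heisw q"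
  shows "(\<forall>X\<in>spo. equivariant_wrt heisw q (lie_endo lam mu X)) \<longleftrightarrow> (\<forall>i j. equivariant_wrt heisw q (mm (2 * lam) (2 * mu) i j))"
proof
  assume *: "\<forall>X\<in>spo. equivariant_wrt heisw q (lie_endo lam mu X)"
  show "\<forall>i j. equivariant_wrt heisw q (mm (2 * lam) (2 * mu) i j)"
  proof (intro allI)
    fix i j :: "'n idx"
    let ?X = "lie_endo lam mu (contact_field (ys i * ys (os j)))"
    have "equivariant_wrt heisw q ?X" using * contact_ys_spo by blast
    moreover have "preserves heisw ?X" unfolding lie_endo_contact'[OF n] by (intro preserves_closed(2) preserves_mm)
    ultimately have "equivariant_wrt heisw q ((2 * om (os j)) *\<^sub>R ?X)" by (intro equivariant_wrt_scaleR[OF q])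
    then show "equivariant_wrt heisw q (mm (2 * lam) (2 * mu) i j)"
      using lie_endo_contact[OF n, of lam mu i "os j"] by simp
  qed
next
  assume *: "\<forall>i j. equivariant_wrt heisw q (mm (2 * lam) (2 * mu) i j)"
  show "\<forall>X\<in>spo. equivariant_wrt heisw q (lie_endo lam mu X)"
  proof
    fix X :: "'n vfield" assume X: "X \<in> spo"
    have "preserved_equivariant heisw q (lie_endo lam mu X)"
    proof (rule equivariant_wrt_span[OF q _ X[unfolded spo_def]])
      fix Y :: "'n vfield" assume "Y \<in> contact_field ` spo_generators"
      then obtain f where f: "Y = contact_field f" "f \<in> spo_generators" by blast
      obtain a b where ab: "f = ys a * ys b" using f(2) by (rule spo_generators_ys)
      have "preserved_equivariant heisw q (mm (2 * lam) (2 * mu) a (os b))" using * preserves_mm by blast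
      from preserved_equivariant_closed(2)[OF q this] show "preserved_equivariant heisw q (lie_endo lam mu Y)"
        unfolding f(1) ab lie_endo_contact'[OF n] .
    qed
    then show "equivariant_wrt heisw q (lie_endo lam mu X)" by blast
  qed
qed

text \<open>Bijectivity onto \<open>diffops\<close> is supplied by triangularity,
  \<open>quantization_map_bij\<close>; equivariance under the span reduces to the generators
  \<open>mm\<close>.\<close>

lemma fine_quantization_iff:
  fixes Q :: "'n::{finite,linorder} symb \<Rightarrow> 'n sfun \<Rightarrow> 'n sfun"
  assumes n: "CARD('n) \<noteq> 2"
  shows "fine_quantization lam mu Q \<longleftrightarrow> (\<exists>q. Q = (\<lambda>S. app (q S)) \<and> quantization_map heisw q
    \<and> (\<forall>i j. equivariant_wrt heisw q (mm (2 * lam) (2 * mu) i j)))"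
proof -
  have two: "(2 :: real) > 0" by simp
  have eq: "(\<forall>X\<in>spo. \<forall>S. op_action lam mu X (Q S) = Q (symb_action heis_weight lam mu X S))
     \<longleftrightarrow> (\<forall>i j. equivariant_wrt heisw q (mm (2 * lam) (2 * mu) i j))" if Q: "Q = (\<lambda>S. app (q S))" and q: "quantization_map heisw q" for q
    unfolding spo_equivariant_wrt_iff[OF n q, symmetric] Q
    using equivariant_wrt_iff[of heis_weight heisw 2 q, OF heis_weight_eq two quantization_map_linear[OF q]] by simp
  have hn: "(\<forall>d\<in>half_nats. P d) \<longleftrightarrow> (\<forall>d::nat. P (real d / 2))" for P
    unfolding half_nats_def by blast
  let ?B = "\<forall>d. \<forall>S\<in>homogeneous_symbols heis_weight (real d / 2).
        Q S \<in> op_filtration heis_weight (real d / 2) \<and> principal_symbol heis_weight (real d / 2) (Q S) = S"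
  have bij: "bij_betw Q UNIV diffops" if Q: "Q = (\<lambda>S. app (q S))" and q: "quantization_map heisw q" for q
  proof -
    have b: "bij_betw q UNIV (Sp UNIV)" by (rule quantization_map_bij[OF q])
    have d: "diffops = app ` (Sp UNIV :: 'n sfun endo set)"
      by (auto simp: diffops_def Sp_dif app_dif[symmetric])
    have "bij_betw app (Sp UNIV :: 'n sfun endo set) diffops"
      unfolding d by (intro inj_on_imp_bij_betw inj_onI) (simp add: app_inject)
    from bij_betw_trans[OF b this] show ?thesis by (simp add: Q o_def)
  qed
  have 1: "(\<forall>g. linear (\<lambda>S. Q S g)) \<and> bij_betw Q UNIV diffops \<and> ?B
     \<longleftrightarrow> (\<exists>q. Q = (\<lambda>S. app (q S)) \<and> quantization_map heisw q)"
  proof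
    assume *: "(\<forall>g. linear (\<lambda>S. Q S g)) \<and> bij_betw Q UNIV diffops \<and> ?B"
    then have "range Q \<subseteq> diffops" by (simp add: bij_betw_def)
    with * show "\<exists>q. Q = (\<lambda>S. app (q S)) \<and> quantization_map heisw q"
      using quant_iff[of heis_weight heisw 2 Q, OF heis_weight_eq two] by blast
  next
    assume *: "\<exists>q. Q = (\<lambda>S. app (q S)) \<and> quantization_map heisw q"
    then have "bij_betw Q UNIV diffops" using bij by blast
    with * show "(\<forall>g. linear (\<lambda>S. Q S g)) \<and> bij_betw Q UNIV diffops \<and> ?B"
      using quant_iff[of heis_weight heisw 2 Q, OF heis_weight_eq two] by blast
  qed
  have "fine_quantization lam mu Q \<longleftrightarrow> ((\<forall>g. linear (\<lambda>S. Q S g)) \<and> bij_betw Q UNIV diffops \<and> ?B) \<and>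
     (\<forall>X\<in>spo. \<forall>S. op_action lam mu X (Q S) = Q (symb_action heis_weight lam mu X S))"
    unfolding fine_quantization_def hn by simp
  then show ?thesis unfolding 1 using eq by blast
qed

lemma coeffs_of_sum:
  assumes "\<And>x. x \<in> X \<Longrightarrow> f x \<in> Sp UNIV" shows "coeffs_of (sum f X) = (\<Sum>x\<in>X. coeffs_of (f x))"
  using assms
proof (induction X rule: infinite_finite_induct)
  case (insert x X)
  then show ?case using coeffs_of_lin(1)[of "f x" "sum f X"] Sp_closed(6)[of X f UNIV] by simp
qed simp_all

lemma symb_restrict_sum: "symb_restrict V (sum f X) = (\<Sum>x\<in>X. symb_restrict V (f x))"
  by (induction X rule: infinite_finite_induct) (simp_all add: symb_restrict_lin)

text \<open>As \<open>\<A>\<close> commutes with \<open>\<C>\<close>, it maps eigenvectors to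
  eigenvectors for the same eigenvalue. Both \<open>\<A>\<close> applied to \<open>q S\<close> and
  \<open>q\<close> of the graded action are such, with the same leading part, so they agree by
  nonresonance.\<close>

lemma eigen_equivariant_wrt:
  fixes q :: "'n::{finite,linorder} symb \<Rightarrow> _"
  assumes q: "quantization_map w q" and e: "eigenop w \<C> g"
    and qe: "\<And>v A. app \<C> (q (Poly_Mapping.single v A)) = g v *\<^sub>R q (Poly_Mapping.single v A)"
    and c: "\<A> * \<C> = \<C> * \<A>" and p: "preserves w \<A>" and g: "\<And>u v. w u < w v \<Longrightarrow> g u \<noteq> g v"
  shows "equivariant_wrt w q \<A>"
proof -
  note lin = quantization_map_linear[OF q]
  have cc: "app \<A> (app \<C> D) = app \<C> (app \<A> D)" for D using c by (metis app_simps(7))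
  have single: "app \<A> (q (Poly_Mapping.single v A)) = q (graded_action w \<A> (w v) (Poly_Mapping.single v A))"
    for v and A :: "'n sfun"
  proof -
    let ?S = "Poly_Mapping.single v A" and ?d = "w v"
    define S' where "S' = graded_action w \<A> ?d ?S"
    let ?L = "Sp {u. w u < ?d} :: 'n sfun endo set"
    have S: "?S \<in> Hom w ?d" by (rule Hom_single) simp
    have S': "S' \<in> Hom w ?d" unfolding S'_def by (rule graded_action_Hom)
    have a: "app \<A> (dif ?S) - dif S' \<in> ?L" unfolding S'_def by (rule graded_action_low[OF p S])
    have "app \<C> (dif ?S) - g v *\<^sub>R dif ?S \<in> ?L" unfolding dif_single by (rule eigenopD[OF e])
    from preserves_less[OF p this] have b: "app \<C> (app \<A> (dif ?S)) - g v *\<^sub>R app \<A> (dif ?S) \<in> ?L"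
      by (simp add: cc)
    have c': "app \<C> (app \<A> (dif ?S) - dif S') - g v *\<^sub>R (app \<A> (dif ?S) - dif S') \<in> ?L"
      by (intro Sp_closed(2,3) preserves_less[OF eigenop_preserves[OF e]] a)
    have d: "app \<C> (dif S') - g v *\<^sub>R dif S' \<in> ?L"
      using Sp_closed(2)[OF b c'] by (simp add: algebra_simps)
    \<comment> \<open>The symbol of \<open>\<C> - g v\<close> on \<open>S'\<close>. It is supported
      in degree \<open>?d\<close> and, by \<open>d\<close>, in lower degrees, so it is 0; hence all
      monomials of \<open>S'\<close> have the eigenvalue \<open>g v\<close>. This is not automatic,
      as \<open>g\<close> may vary within one degree.\<close>
    define R where "R = (\<Sum>u\<in>Poly_Mapping.keys S'. Poly_Mapping.single u ((g u - g v) *\<^sub>R lk S' u))"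
    have dR: "dif R = (\<Sum>u\<in>Poly_Mapping.keys S'. g u *\<^sub>R mopv (lk S' u) u) - g v *\<^sub>R dif S'"
      unfolding R_def linear_sum[OF linear_dif] dif_single mop_lin(2)
      by (simp add: dif_def[of S'] scaleR_sum_right scaleR_diff_left sum_subtractf)
    have "app \<C> (dif S') - (\<Sum>u\<in>Poly_Mapping.keys S'. g u *\<^sub>R mopv (lk S' u) u) \<in> ?L"
      unfolding dif_def app_arg_sum sum_subtractf[symmetric]
    proof (rule Sp_closed(6))
      fix u assume "u \<in> Poly_Mapping.keys S'"
      then have "w u = ?d" using S' by (simp add: Hom_def)
      then show "app \<C> (mopv (lk S' u) u) - g u *\<^sub>R mopv (lk S' u) u \<in> ?L"
        using eigenopD[OF e, of "lk S' u" u] by simp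
    qed
    from Sp_closed(2)[OF d this] have "dif R \<in> ?L" by (simp add: dR)
    then have Rk: "Poly_Mapping.keys R \<subseteq> {u. w u < ?d}" by (simp add: dif_in_Sp)
    have lR: "lk R u = (if u \<in> Poly_Mapping.keys S' then (g u - g v) *\<^sub>R lk S' u else 0)" for u
    proof -
      have "lk R u = (\<Sum>t\<in>Poly_Mapping.keys S'. if t = u then (g u - g v) *\<^sub>R lk S' u else 0)"
        unfolding R_def lookup_sum by (intro sum.cong) (auto simp: lookup_single)
      then show ?thesis by simp
    qed
    have gu: "g u = g v" if u: "u \<in> Poly_Mapping.keys S'" for u
    proof (rule ccontr)
      assume "g u \<noteq> g v"
      then have "lk R u \<noteq> 0" using u by (simp add: lR in_keys_iff)
      then have "w u < ?d" using Rk by (auto simp: in_keys_iff)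
      moreover have "w u = ?d" using S' u by (simp add: Hom_def)
      ultimately show False by simp
    qed
    have "app \<C> (q S') = (\<Sum>u\<in>Poly_Mapping.keys S'. g u *\<^sub>R q (Poly_Mapping.single u (lk S' u)))"
      unfolding linear_symb_sum[OF lin, of S'] app_arg_sum qe ..
    also have "\<dots> = g v *\<^sub>R q S'"
      unfolding linear_symb_sum[OF lin, of S'] scaleR_sum_right by (intro sum.cong refl) (simp add: gu)
    finally have qS': "app \<C> (q S') = g v *\<^sub>R q S'" .
    define T where "T = app \<A> (q ?S) - q S'"
    have "app \<A> (q ?S - dif ?S) \<in> ?L" by (rule preserves_less[OF p quantization_map_low[OF q S]])
    from Sp_closed(1)[OF this a] have "app \<A> (q ?S) - dif S' \<in> ?L" by simp
    from Sp_closed(2)[OF this quantization_map_low[OF q S']] have TL: "T \<in> ?L" by (simp add: T_def)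
    have Te: "app \<C> T = g v *\<^sub>R T"
      by (simp add: T_def cc[symmetric] qe qS' scaleR_diff_right)
    have "T = 0" by (rule eigen_zero[OF e TL Te]) (use g in blast)
    then show ?thesis by (simp add: T_def S'_def)
  qed
  show ?thesis
    unfolding equivariant_wrt_def
  proof (intro allI ballI)
    fix d and S :: "'n symb" assume S: "S \<in> Hom w d"
    have wd: "w v = d" if "v \<in> Poly_Mapping.keys S" for v using S that by (simp add: Hom_def)
    have u: "app \<A> (dif (Poly_Mapping.single v A)) \<in> Sp UNIV" for v and A :: "'n sfun"
      using preserves_Hom[OF p Hom_single[OF refl]] by (rule Sp_UNIV)
    have "graded_action w \<A> d S = (\<Sum>v\<in>Poly_Mapping.keys S. graded_action w \<A> d (Poly_Mapping.single v (lk S v)))"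
      unfolding graded_action_def linear_symb_sum[OF linear_dif, of S] app_arg_sum coeffs_of_sum[OF u] symb_restrict_sum ..
    then have "q (graded_action w \<A> d S) = (\<Sum>v\<in>Poly_Mapping.keys S. q (graded_action w \<A> d (Poly_Mapping.single v (lk S v))))"
      by (simp add: linear_sum[OF lin])
    also have "\<dots> = (\<Sum>v\<in>Poly_Mapping.keys S. app \<A> (q (Poly_Mapping.single v (lk S v))))"
      by (intro sum.cong refl) (simp add: single wd)
    also have "\<dots> = app \<A> (q S)"
      unfolding linear_symb_sum[OF lin, of S] app_arg_sum ..
    finally show "app \<A> (q S) = q (graded_action w \<A> d S)" ..
  qed
qed

section \<open>The operator \<open>Delta\<close> and the map \<open>SQ\<close> on monomials\<close>

lemma single_scaleR: "Poly_Mapping.single v (r *\<^sub>R A) = r *\<^sub>R Poly_Mapping.single v A"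
  for v :: "nat \<times> 'n::{finite,linorder} set" and A :: "'n sfun"
  by (rule poly_mapping_eqI) (simp add: lookup_single when_def)

lemma linear_single: "linear h \<Longrightarrow> linear (\<lambda>A :: 'n sfun. Poly_Mapping.single v (h A :: 'n sfun))"
  for v :: "nat \<times> 'n::{finite,linorder} set"
  by (simp add: linear_iff single_add single_scaleR)

lemma linear_gamma_term:
  "linear (\<lambda>A :: 'n sfun. if i \<in> snd v then 0 else
     Poly_Mapping.single (fst v, insert i (snd v)) (grassmann_sign {i} (snd v) *\<^sub>R sf_par A))"
  for v :: "nat \<times> 'n::{finite,linorder} set"
  by (cases "i \<in> snd v") (simp_all add: linear_iff par_simps scaleR_add_right single_add single_scaleR mult.commute)

lemma gamma_mult_eq: "gamma_mult i S = (\<Sum>v\<in>Poly_Mapping.keys S. if i \<in> snd v then 0 else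
     Poly_Mapping.single (fst v, insert i (snd v)) (grassmann_sign {i} (snd v) *\<^sub>R sf_par (lk S v)))"
  by (simp add: gamma_mult_def case_prod_beta cong: if_cong)

lemma symb_dzeta_eq: "symb_dzeta S = (\<Sum>v\<in>Poly_Mapping.keys S.
     Poly_Mapping.single (fst v - 1, snd v) (real (fst v) *\<^sub>R lk S v))"
  by (simp add: symb_dzeta_def case_prod_beta)

lemma linear_dzeta_term: "linear (\<lambda>A :: 'n sfun. Poly_Mapping.single (fst v - 1, snd v) (real (fst v) *\<^sub>R A))"
  for v :: "nat \<times> 'n::{finite,linorder} set"
  by (rule linear_single[of "\<lambda>A. real (fst v) *\<^sub>R A"]) (simp add: linear_iff algebra_simps)

lemma linear_Dbar: "linear (Dbar i)"
  using linear_app[of "dB i"] by (simp add: linear_iff del: app_arg)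

lemma linear_Dbar_term: "linear (\<lambda>A :: 'n sfun. Poly_Mapping.single v (Dbar i A))"
  for v :: "nat \<times> 'n::{finite,linorder} set"
  by (rule linear_single) (rule linear_Dbar)

lemma linear_Delta_parts: "linear (gamma_mult i)" "linear (symb_Dbar i)" "linear symb_dzeta"
  unfolding gamma_mult_eq[abs_def] symb_Dbar_def[abs_def] symb_dzeta_eq[abs_def]
  by (rule linear_ext[OF linear_gamma_term] linear_ext[OF linear_Dbar_term] linear_ext[OF linear_dzeta_term])+

lemma linear_Delta: "linear Delta"
  unfolding Delta_def[abs_def]
  by (rule linear_compose_sum, rule ballI)
    (intro linear_compose[unfolded o_def, OF _ linear_Delta_parts(1)]
      linear_compose[unfolded o_def, OF _ linear_Delta_parts(2)] linear_Delta_parts(3))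

lemma Delta_parts_single:
  "gamma_mult i (Poly_Mapping.single (c, K) A) = (if i \<in> K then 0 else
     Poly_Mapping.single (c, insert i K) (grassmann_sign {i} K *\<^sub>R sf_par A))"
  "symb_Dbar i (Poly_Mapping.single (c, K) A) = Poly_Mapping.single (c, K) (Dbar i A)"
  "symb_dzeta (Poly_Mapping.single (c, K) A) = Poly_Mapping.single (c - 1, K) (real c *\<^sub>R A)"
  unfolding gamma_mult_eq symb_Dbar_def symb_dzeta_eq
  by (simp_all only: ext_single[of "\<lambda>v A. if i \<in> snd v then 0 else
     Poly_Mapping.single (fst v, insert i (snd v)) (grassmann_sign {i} (snd v) *\<^sub>R sf_par A)", OF linear_gamma_term]
   ext_single[of "\<lambda>v A. Poly_Mapping.single v (Dbar i A)", OF linear_Dbar_term]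
   ext_single[of "\<lambda>v A. Poly_Mapping.single (fst v - 1, snd v) (real (fst v) *\<^sub>R A)", OF linear_dzeta_term] fst_conv snd_conv)

lemma Delta_single: "Delta (Poly_Mapping.single (c, K) A) = (\<Sum>i\<in>UNIV. if i \<in> K then 0 else
     Poly_Mapping.single (c - 1, insert i K) (grassmann_sign {i} K *\<^sub>R sf_par (Dbar i (real c *\<^sub>R A))))"
  by (simp only: Delta_def Delta_parts_single cong: if_cong)

lemma dif_Delta_single: "dif (Delta (Poly_Mapping.single (c, K) A)) = DD A c K"
proof -
  have "dif (Delta (Poly_Mapping.single (c, K) A)) = (\<Sum>i\<in>UNIV. if i \<in> K then 0 else
     grassmann_sign {i} K *\<^sub>R mop (sf_par (Dbar i (real c *\<^sub>R A))) (c - 1) (insert i K))"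
    unfolding Delta_single linear_sum[OF linear_dif]
    by (intro sum.cong refl) (simp add: dif_single dif_lin mop_lin(2) del: scaleR_conv_of_real)
  also have "\<dots> = DD A c K"
    unfolding DD_def by (rule sum.mono_neutral_cong_right) auto
  finally show ?thesis .
qed

text \<open>\<open>Delta\<close> lowers the degree in \<open>\<zeta>\<close> by one and keeps the
  order. A singleton \<open>R\<close> records the order; \<open>UNIV\<close> is taken where only the
  degree in \<open>\<zeta>\<close> matters.\<close>

definition homog_symbols :: "nat \<Rightarrow> nat set \<Rightarrow> 'n::{finite,linorder} symb set" where
  "homog_symbols c R = {S. \<forall>v\<in>Poly_Mapping.keys S. fst v = c \<and> ordw v \<in> R}"

lemma homog_symbols_sum: "(\<And>x. x \<in> X \<Longrightarrow> f x \<in> homog_symbols c R) \<Longrightarrow> sum f X \<in> homog_symbols c R"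
proof -
  assume *: "\<And>x. x \<in> X \<Longrightarrow> f x \<in> homog_symbols c R"
  have "Poly_Mapping.keys (sum f X) \<subseteq> (\<Union>x\<in>X. Poly_Mapping.keys (f x))"
    by (rule keys_sum)
  then show ?thesis using * unfolding homog_symbols_def by blast
qed

lemma Delta_homog_symbols: "S \<in> homog_symbols (Suc c) R \<Longrightarrow> Delta S \<in> homog_symbols c R"
proof -
  assume S: "S \<in> homog_symbols (Suc c) R"
  show ?thesis
    unfolding linear_symb_sum[OF linear_Delta, of S]
  proof (rule homog_symbols_sum)
    fix v assume "v \<in> Poly_Mapping.keys S"
    then have v: "fst v = Suc c" "ordw v \<in> R" using S by (auto simp: homog_symbols_def)
    obtain K where K: "v = (Suc c, K)" using v(1) by (metis prod.collapse)
    have "(if i \<in> K then 0 else Poly_Mapping.single (Suc c - 1, insert i K) B) \<in> homog_symbols c R" for i B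
      using v(2) by (auto simp: homog_symbols_def K)
    then show "Delta (Poly_Mapping.single v (lk S v)) \<in> homog_symbols c R"
      unfolding K Delta_single by (intro homog_symbols_sum)
  qed
qed

lemma Delta_homog_symbols_zero: "S \<in> homog_symbols 0 R \<Longrightarrow> Delta S = 0"
proof -
  assume S: "S \<in> homog_symbols 0 R"
  show ?thesis
    unfolding linear_symb_sum[OF linear_Delta, of S]
  proof (rule sum.neutral, rule ballI)
    fix v assume "v \<in> Poly_Mapping.keys S"
    then have "fst v = 0" using S by (auto simp: homog_symbols_def)
    then obtain K where "v = (0, K)" by (metis prod.collapse)
    then show "Delta (Poly_Mapping.single v (lk S v)) = 0"
      unfolding Delta_single by (simp add: Delta_single linear_0[OF linear_Dbar] cong: if_cong)
  qed
qed

lemma Delta_zero: "Delta 0 = 0" by (rule linear_0[OF linear_Delta])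

lemma Delta_power_homog_symbols: "S \<in> homog_symbols c R \<Longrightarrow> a \<le> c \<Longrightarrow> (Delta ^^ a) S \<in> homog_symbols (c - a) R"
proof (induction a)
  case (Suc a)
  then have "(Delta ^^ a) S \<in> homog_symbols (Suc (c - Suc a)) R" by (simp add: Suc_diff_Suc)
  then show ?case by (simp add: Delta_homog_symbols)
qed simp

lemma Delta_power_zero: "S \<in> homog_symbols c R \<Longrightarrow> c < a \<Longrightarrow> (Delta ^^ a) S = 0"
proof (induction a)
  case (Suc a)
  show ?case
  proof (cases "c < a")
    case True
    then show ?thesis using Suc by (simp add: Delta_zero)
  next
    case False
    then have "a = c" using Suc by simp
    then show ?thesis using Delta_power_homog_symbols[OF Suc.prems(1), of c] by (simp add: Delta_homog_symbols_zero)
  qed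
qed simp

lemma linear_Delta_power: "linear (Delta ^^ a)"
proof (induction a)
  case (Suc a)
  show ?case using linear_compose[OF Suc linear_Delta] by (simp add: o_def)
qed (simp add: linear_iff)

definition SQ_coeff :: "real \<Rightarrow> nat \<Rightarrow> nat \<Rightarrow> real" where
  "SQ_coeff \<delta> c a = 1 / (2 ^ a * fact a) * (\<Prod>j<a. 1 / (real c - \<delta> - real j / 2))"

lemma SQ_eq:
  assumes X: "finite X" "fst ` Poly_Mapping.keys S \<subseteq> X"
  shows "SQ \<delta> S = (\<Sum>c\<in>X. \<Sum>a\<le>c. SQ_coeff \<delta> c a *\<^sub>R (Delta ^^ a) (symb_restrict {v. fst v = c} S))"
proof -
  have T: "symb_restrict {v. fst v = c} S \<in> homog_symbols c UNIV" for c
    by (auto simp: homog_symbols_def in_keys_iff lookup_symb_restrict split: if_splits)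
  have "SQ \<delta> S = (\<Sum>c\<in>fst ` Poly_Mapping.keys S. \<Sum>a\<le>c. SQ_coeff \<delta> c a *\<^sub>R (Delta ^^ a) (symb_restrict {v. fst v = c} S))"
    unfolding SQ_def SQ_coeff_def[symmetric]
  proof (intro sum.cong refl)
    fix c
    show "Sum_any (\<lambda>a. SQ_coeff \<delta> c a *\<^sub>R (Delta ^^ a) (symb_restrict {v. fst v = c} S))
      = (\<Sum>a\<le>c. SQ_coeff \<delta> c a *\<^sub>R (Delta ^^ a) (symb_restrict {v. fst v = c} S))"
    proof (rule Sum_any.expand_superset)
      have "SQ_coeff \<delta> c a *\<^sub>R (Delta ^^ a) (symb_restrict {v. fst v = c} S) = 0" if "c < a" for a
        using Delta_power_zero[OF T that] by simp
      then show "{a. SQ_coeff \<delta> c a *\<^sub>R (Delta ^^ a) (symb_restrict {v. fst v = c} S) \<noteq> 0} \<subseteq> {..c}"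
        by (metis (mono_tags, lifting) atMost_iff mem_Collect_eq not_le subsetI)
    qed simp
  qed
  also have "\<dots> = (\<Sum>c\<in>X. \<Sum>a\<le>c. SQ_coeff \<delta> c a *\<^sub>R (Delta ^^ a) (symb_restrict {v. fst v = c} S))"
  proof (rule sum.mono_neutral_left[OF X], rule ballI)
    fix c assume "c \<in> X - fst ` Poly_Mapping.keys S"
    then have "symb_restrict {v. fst v = c} S = 0"
      by (intro poly_mapping_eqI) (auto simp: lookup_symb_restrict in_keys_iff image_iff)
    then show "(\<Sum>a\<le>c. SQ_coeff \<delta> c a *\<^sub>R (Delta ^^ a) (symb_restrict {v. fst v = c} S)) = 0"
      by (simp add: linear_0[OF linear_Delta_power])
  qed
  finally show ?thesis .
qed

lemma linear_SQ: "linear (SQ \<delta> :: 'n::{finite,linorder} symb \<Rightarrow> _)"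
proof (rule linearI)
  fix S T :: "'n symb"
  let ?X = "fst ` Poly_Mapping.keys S \<union> fst ` Poly_Mapping.keys T"
  have "fst ` Poly_Mapping.keys (S + T) \<subseteq> ?X" using keys_add[of S T] by blast
  then show "SQ \<delta> (S + T) = SQ \<delta> S + SQ \<delta> T"
    by (simp add: SQ_eq[of ?X] symb_restrict_lin linear_add[OF linear_Delta_power] scaleR_add_right sum.distrib)
next
  fix r and S :: "'n symb"
  let ?X = "fst ` Poly_Mapping.keys S"
  have "Poly_Mapping.keys (r *\<^sub>R S) \<subseteq> Poly_Mapping.keys S" by (auto simp: in_keys_iff)
  then have "fst ` Poly_Mapping.keys (r *\<^sub>R S) \<subseteq> ?X" by blast
  then show "SQ \<delta> (r *\<^sub>R S) = r *\<^sub>R SQ \<delta> S"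
    by (simp add: SQ_eq[of ?X] symb_restrict_lin linear_cmul[OF linear_Delta_power] scaleR_sum_right mult.commute)
qed

lemma SQ_single: "SQ \<delta> (Poly_Mapping.single (c, K) A) = (\<Sum>a\<le>c. SQ_coeff \<delta> c a *\<^sub>R (Delta ^^ a) (Poly_Mapping.single (c, K) A))"
proof -
  have "symb_restrict {v. fst v = c} (Poly_Mapping.single (c, K) A) = Poly_Mapping.single (c, K) A"
    by (rule poly_mapping_eqI) (auto simp: lookup_symb_restrict lookup_single when_def)
  then show ?thesis by (subst SQ_eq[of "{c}"]) auto
qed

text \<open>The recursion in the form in which the eigenvalue equation asks for it; compare
  \<open>spo_eigenvalue2_diff\<close>.\<close>

lemma SQ_coeff_Suc:
  assumes "real c - \<delta> - real a / 2 \<noteq> 0"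
  shows "SQ_coeff \<delta> c (Suc a) * (2 * (real a + 1) * (real c - \<delta> - real a / 2)) = SQ_coeff \<delta> c a"
proof -
  define x where "x = real c - \<delta> - real a / 2"
  define P where "P = (\<Prod>j<a. 1 / (real c - \<delta> - real j / 2))"
  have "SQ_coeff \<delta> c (Suc a) = 1 / (2 ^ Suc a * fact (Suc a)) * (P * (1 / x))"
    by (simp only: SQ_coeff_def P_def x_def prod.lessThan_Suc)
  also have "\<dots> = SQ_coeff \<delta> c a / (2 * (real a + 1) * x)"
    unfolding SQ_coeff_def P_def[symmetric] by (simp add: algebra_simps)
  finally show ?thesis using assms unfolding x_def[symmetric] by simp
qed

section \<open>The eigenvectors of the \<open>spo(2|n)\<close> Casimir\<close>

definition spo_eigenvalue2 :: "real \<Rightarrow> real \<Rightarrow> real \<Rightarrow> nat \<Rightarrow> nat \<Rightarrow> real" where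
  "spo_eigenvalue2 n l l' c k = 2 * (al n l' l' 0 - l' + al n l l 0 - l)
    - 4 * (al n l l' (real k) - real c * (real c + l - l' + 1) - l)"

lemma spo_eigenvalue_spo_eigenvalue2: "spo_eigenvalue n l l' v = spo_eigenvalue2 n l l' (fst v) (ordw v)" by (simp add: spo_eigenvalue_def spo_eigenvalue2_def)

text \<open>At fixed order the eigenvalue is quadratic in the degree in \<open>\<zeta>\<close>. This
  factorization is the origin of the denominators of \<open>SQ\<close>: four times the off-diagonal
  1 divided by the gap for \<open>a\<close> is
  \<open>1 / (2 a (c - \<delta> - (a - 1) / 2))\<close>.\<close>

lemma spo_eigenvalue2_diff:
  assumes "a \<le> c" "\<delta> = mu - lam"
  shows "spo_eigenvalue2 n (2 * lam) (2 * mu) c k - spo_eigenvalue2 n (2 * lam) (2 * mu) (c - a) k = 8 * real a * (real c - \<delta> - (real a - 1) / 2)"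
  using assms(1) unfolding spo_eigenvalue2_def assms(2) by (simp add: of_nat_diff field_simps)

text \<open>For the order filtration \<open>Delta\<close> belongs to the leading part, since it
  keeps the order; the remainder is of lower order and will be annihilated by the spectral
  projection of order \<open>k\<close>.\<close>

lemma spo_casimir_homog_symbols:
  fixes S :: "'n::{finite,linorder} symb"
  assumes S: "S \<in> homog_symbols c {k}"
  shows "app (spo_casimir l l') (dif S) - (spo_eigenvalue2 (real CARD('n)) l l' c k *\<^sub>R dif S + 4 *\<^sub>R dif (Delta S)) \<in> Sp {v. ordw v < k}"
proof -
  let ?g = "spo_eigenvalue2 (real CARD('n)) l l' c k"
  have "app (spo_casimir l l') (dif S) - (?g *\<^sub>R dif S + 4 *\<^sub>R dif (Delta S))
    = (\<Sum>v\<in>Poly_Mapping.keys S. app (spo_casimir l l') (mopv (lk S v) v) - (?g *\<^sub>R mopv (lk S v) v + 4 *\<^sub>R dif (Delta (Poly_Mapping.single v (lk S v)))))"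
    unfolding linear_symb_sum[OF linear_Delta, of S] dif_def[of S]
    by (simp add: app_arg_sum linear_sum[OF linear_dif] scaleR_sum_right sum_subtractf sum.distrib)
  also have "\<dots> \<in> Sp {v. ordw v < k}"
  proof (rule Sp_closed(6))
    fix v assume "v \<in> Poly_Mapping.keys S"
    then have v: "fst v = c" "ordw v = k" using S by (auto simp: homog_symbols_def)
    obtain K where K: "v = (c, K)" using v(1) by (metis prod.collapse)
    have g: "spo_eigenvalue (real CARD('n)) l l' (c, K) = ?g" using v(2) by (simp add: spo_eigenvalue_spo_eigenvalue2 K)
    show "app (spo_casimir l l') (mopv (lk S v) v) - (?g *\<^sub>R mopv (lk S v) v + 4 *\<^sub>R dif (Delta (Poly_Mapping.single v (lk S v))))
        \<in> Sp {v. ordw v < k}"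
      using spo_casimir_mop[of 1 1 l l' "lk S v" c K] v(2) unfolding g K dif_Delta_single ordw_def by simp
  qed
  finally show ?thesis .
qed

definition fine_map :: "real \<Rightarrow> real \<Rightarrow> 'n::{finite,linorder} symb \<Rightarrow> 'n sfun endo" where
  "fine_map lam mu S = sl_map (2 * lam) (2 * mu) (SQ (mu - lam) S)"

lemma linear_fine_map: "linear (fine_map lam mu)"
  unfolding fine_map_def[abs_def] using linear_compose[OF linear_SQ linear_sl_map] by (simp add: o_def)

lemma homog_symbols_Hom: "S \<in> homog_symbols c {k} \<Longrightarrow> S \<in> Hom ordw k"
  by (auto simp: homog_symbols_def Hom_def)

lemma single_homog_symbols: "Poly_Mapping.single (c, K) A \<in> homog_symbols c {c + card K}"
  by (simp add: homog_symbols_def)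

lemma fine_map_single:
  fixes A :: "'n::{finite,linorder} sfun"
  shows "fine_map lam mu (Poly_Mapping.single (c, K) A) = (\<Sum>a\<le>c. SQ_coeff (mu - lam) c a *\<^sub>R
    app (PR (2 * lam) (2 * mu) (c + card K)) (dif ((Delta ^^ a) (Poly_Mapping.single (c, K) A))))"
proof -
  have "sl_map (2 * lam) (2 * mu) ((Delta ^^ a) (Poly_Mapping.single (c, K) A))
    = app (PR (2 * lam) (2 * mu) (c + card K)) (dif ((Delta ^^ a) (Poly_Mapping.single (c, K) A)))" if "a \<le> c" for a
    by (rule sl_map_Hom[OF homog_symbols_Hom[OF Delta_power_homog_symbols[OF single_homog_symbols that]]])
  then show ?thesis
    unfolding fine_map_def SQ_single linear_sum[OF linear_sl_map] linear_cmul[OF linear_sl_map] by simp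
qed

text \<open>On the projected images \<open>E a\<close> of the powers of \<open>Delta\<close> the
  Casimir is bidiagonal, sending \<open>E a\<close> to \<open>g (c - a)\<close> times
  \<open>E a\<close> plus \<open>4 *\<^sub>R E (Suc a)\<close>. Solving for the eigenvector with
  eigenvalue \<open>g c\<close> that starts with \<open>E 0\<close> gives the coefficients of
  \<open>SQ\<close>.\<close>

lemma fine_map_eigen:
  fixes A :: "'n::{finite,linorder} sfun"
  assumes nz: "\<And>c a. a < c \<Longrightarrow> real c - (mu - lam) - real a / 2 \<noteq> 0"
  shows "app (spo_casimir (2 * lam) (2 * mu)) (fine_map lam mu (Poly_Mapping.single v A))
    = spo_eigenvalue (real CARD('n)) (2 * lam) (2 * mu) v *\<^sub>R fine_map lam mu (Poly_Mapping.single v A)"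
proof -
  obtain c K where v: "v = (c, K)" by force
  let ?l = "2 * lam" and ?l' = "2 * mu" and ?k = "c + card K"
  define P where "P = (PR ?l ?l' ?k :: 'n sfun endo endo)"
  define C where "C = (spo_casimir ?l ?l' :: 'n sfun endo endo)"
  define U where "U a = (Delta ^^ a) (Poly_Mapping.single (c, K) A)" for a
  define E where "E a = app P (dif (U a))" for a
  let ?g = "spo_eigenvalue2 (real CARD('n)) ?l ?l'"
  let ?SQ_coeff = "SQ_coeff (mu - lam) c"
  have PC: "C * P = P * C" unfolding P_def C_def by (rule spectral_proj_commute) (rule gl_casimir_spo_casimir[symmetric])
  have CE: "app C (E a) = ?g (c - a) ?k *\<^sub>R E a + 4 *\<^sub>R E (Suc a)" if "a \<le> c" for a
  proof -
    have "U a \<in> homog_symbols (c - a) {?k}" unfolding U_def by (rule Delta_power_homog_symbols[OF single_homog_symbols that])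
    from spo_casimir_homog_symbols[OF this, of ?l ?l']
    have "app C (dif (U a)) - (?g (c - a) ?k *\<^sub>R dif (U a) + 4 *\<^sub>R dif (U (Suc a))) \<in> Sp {v. ordw v < ?k}"
      unfolding C_def by (simp add: U_def)
    from spectral_proj_kill[OF eigenop_gl_casimir_ordw this]
    have "app P (app C (dif (U a)) - (?g (c - a) ?k *\<^sub>R dif (U a) + 4 *\<^sub>R dif (U (Suc a)))) = 0"
      unfolding P_def .
    then have "app P (app C (dif (U a))) = ?g (c - a) ?k *\<^sub>R E a + 4 *\<^sub>R E (Suc a)"
      by (simp add: E_def)
    moreover have "app C (E a) = app P (app C (dif (U a)))"
      unfolding E_def app_simps(7)[symmetric] PC ..
    ultimately show ?thesis by simp
  qed
  \<comment> \<open>The chain stops because no \<open>\<zeta>\<close> is left.\<close>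
  have E0: "E (Suc c) = 0"
    unfolding E_def U_def Delta_power_zero[OF single_homog_symbols lessI] by (simp add: dif_lin)
  have q: "fine_map lam mu (Poly_Mapping.single v A) = (\<Sum>a\<le>c. ?SQ_coeff a *\<^sub>R E a)"
    by (simp add: v fine_map_single E_def U_def P_def)
  have k4: "4 * ?SQ_coeff a = ?SQ_coeff (Suc a) * (?g c ?k - ?g (c - Suc a) ?k)" if "a < c" for a
  proof -
    have "?g c ?k - ?g (c - Suc a) ?k = 8 * real (Suc a) * (real c - (mu - lam) - (real (Suc a) - 1) / 2)"
      using that by (intro spo_eigenvalue2_diff) auto
    then have "?SQ_coeff (Suc a) * (?g c ?k - ?g (c - Suc a) ?k)
      = 4 * (?SQ_coeff (Suc a) * (2 * (real a + 1) * (real c - (mu - lam) - real a / 2)))" by simp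
    also have "\<dots> = 4 * ?SQ_coeff a" by (simp only: SQ_coeff_Suc[OF nz[OF that]])
    finally show ?thesis ..
  qed
  \<comment> \<open>The off-diagonal terms are shifted by one index. The summand for
    \<open>a = 0\<close> created by the shift vanishes, its eigenvalue gap being 0.\<close>
  have "(\<Sum>a\<le>c. (4 * ?SQ_coeff a) *\<^sub>R E (Suc a)) = (\<Sum>a<c. (4 * ?SQ_coeff a) *\<^sub>R E (Suc a))"
    by (simp add: lessThan_Suc_atMost[symmetric] E0)
  also have "\<dots> = (\<Sum>a<c. (?SQ_coeff (Suc a) * (?g c ?k - ?g (c - Suc a) ?k)) *\<^sub>R E (Suc a))"
    by (intro sum.cong refl) (simp only: k4 lessThan_iff)
  also have "\<dots> = (\<Sum>a\<le>c. (?SQ_coeff a * (?g c ?k - ?g (c - a) ?k)) *\<^sub>R E a)"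
    unfolding sum.atMost_shift by simp
  finally have s4: "(\<Sum>a\<le>c. (4 * ?SQ_coeff a) *\<^sub>R E (Suc a)) = (\<Sum>a\<le>c. (?SQ_coeff a * (?g c ?k - ?g (c - a) ?k)) *\<^sub>R E a)" .
  have "app C (\<Sum>a\<le>c. ?SQ_coeff a *\<^sub>R E a) = (\<Sum>a\<le>c. (?SQ_coeff a * ?g (c - a) ?k) *\<^sub>R E a) + (\<Sum>a\<le>c. (4 * ?SQ_coeff a) *\<^sub>R E (Suc a))"
    unfolding app_arg_sum sum.distrib[symmetric]
    by (intro sum.cong refl) (simp add: CE algebra_simps)
  also have "\<dots> = ?g c ?k *\<^sub>R (\<Sum>a\<le>c. ?SQ_coeff a *\<^sub>R E a)"
    unfolding s4 sum.distrib[symmetric] scaleR_sum_right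
    by (intro sum.cong refl) (simp add: algebra_simps)
  finally show ?thesis unfolding q C_def by (simp add: spo_eigenvalue_spo_eigenvalue2 v)
qed

lemma quantization_map_fine_map:
  assumes g: "\<And>i k. i < k \<Longrightarrow> gl_eigenvalue (real CARD('n)) (2 * lam) (2 * mu) k \<noteq> gl_eigenvalue (real CARD('n)) (2 * lam) (2 * mu) i"
  shows "quantization_map heisw (fine_map lam mu :: 'n::{finite,linorder} symb \<Rightarrow> _)"
  unfolding quantization_map_def
proof (intro conjI allI ballI)
  have e: "eigenop heisw (gl_casimir l l' :: 'n sfun endo endo) (\<lambda>v. gl_eigenvalue (real CARD('n)) l l' (ordw v))" for l l'
    by (rule eigenop_gl_casimir[of 2 1, folded heisw_def]) auto
  have single: "fine_map lam mu (Poly_Mapping.single v A) - dif (Poly_Mapping.single v A) \<in> Sp {u. heisw u < heisw v}" for v and A :: "'n sfun"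
  proof -
    obtain c K where v: "v = (c, K)" by force
    let ?k = "c + card K" and ?L = "Sp {u. heisw u < heisw v} :: 'n sfun endo set"
    define U where "U a = (Delta ^^ a) (Poly_Mapping.single (c, K) A)" for a
    define E where "E a = app (PR (2 * lam) (2 * mu) ?k) (dif (U a))" for a
    have U: "U a \<in> homog_symbols (c - a) {?k}" if "a \<le> c" for a unfolding U_def by (rule Delta_power_homog_symbols[OF single_homog_symbols that])
    \<comment> \<open>At equal order, losing a \<open>\<zeta>\<close> lowers the Heisenberg weight.
      Hence all terms with \<open>a\<close> different from 0 lie below the leading part.\<close>
    have hw: "heisw u = fst u + ordw u" for u :: "nat \<times> 'n set" by (cases u) simp
    have E: "E a - dif (U a) \<in> ?L" if "a \<le> c" for a
      unfolding E_def
    proof (rule spectral_proj_top[OF e g _ order_refl])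
      show "dif (U a) \<in> Sp {u. heisw u \<le> heisw v \<and> ordw u = ?k}"
        unfolding dif_in_Sp using U[OF that] by (auto simp: homog_symbols_def hw v)
    qed
    have Ua: "dif (U a) \<in> ?L" if "a \<le> c" "a \<noteq> 0" for a
      unfolding dif_in_Sp using U[OF that(1)] that by (auto simp: homog_symbols_def hw v)
    have "SQ_coeff (mu - lam) c a *\<^sub>R E a - (if a = 0 then dif (U 0) else 0) \<in> ?L" if "a \<le> c" for a
    proof (cases "a = 0")
      case True
      then show ?thesis using E[of 0] by (simp add: SQ_coeff_def)
    next
      case False
      have "E a \<in> ?L" using Sp_closed(1)[OF E[OF that] Ua[OF that False]] by simp
      then show ?thesis using False Sp_closed(3) by simp
    qed
    then have "(\<Sum>a\<le>c. SQ_coeff (mu - lam) c a *\<^sub>R E a - (if a = 0 then dif (U 0) else 0)) \<in> ?L"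
      by (intro Sp_closed(6)) simp
    moreover have "(\<Sum>a\<le>c. (if a = 0 then dif (U 0) else 0)) = dif (Poly_Mapping.single v A)"
      by (simp add: U_def v)
    ultimately show ?thesis by (simp add: v fine_map_single E_def U_def sum_subtractf)
  qed
  fix d and S :: "'n symb" assume S: "S \<in> Hom heisw d"
  show "fine_map lam mu S - dif S \<in> Sp {v. heisw v < d}"
    unfolding linear_symb_sum[OF linear_fine_map[of lam mu], of S] linear_symb_sum[OF linear_dif, of S] sum_subtractf[symmetric]
  proof (rule Sp_closed(6))
    fix v assume "v \<in> Poly_Mapping.keys S"
    then have "heisw v = d" using S by (simp add: Hom_def)
    then show "fine_map lam mu (Poly_Mapping.single v (lk S v)) - dif (Poly_Mapping.single v (lk S v)) \<in> Sp {v. heisw v < d}"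
      using single[of v "lk S v"] by simp
  qed
qed (rule linear_fine_map)

text \<open>Equality of two eigenvalues is linear in \<open>\<delta>\<close> with coefficient
  proportional to \<open>d - d'\<close>, so it has one solution, which is an element of
  \<open>C_delta_crit\<close>.\<close>

lemma spo_eigenvalue_nonres:
  fixes u v :: "nat \<times> 'n set"
  assumes \<delta>: "\<delta> = mu - lam" "\<delta> \<notin> C_delta_crit (1 - n)" and uv: "heisw u < heisw v"
  shows "spo_eigenvalue n (2 * lam) (2 * mu) u \<noteq> spo_eigenvalue n (2 * lam) (2 * mu) v"
proof
  assume eq: "spo_eigenvalue n (2 * lam) (2 * mu) u = spo_eigenvalue n (2 * lam) (2 * mu) v"
  obtain c K where v: "v = (c, K)" by force
  obtain c' K' where u: "u = (c', K')" by force
  define k k' d d' where "k = c + card K" and "k' = c' + card K'" and "d = real (heisw v) / 2" and "d' = real (heisw u) / 2"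
  \<comment> \<open>Order and Heisenberg order determine the index: \<open>k\<close> is
    \<open>c + card K\<close> and \<open>2 * d\<close> is \<open>2 * c + card K\<close>. The bounds
    on \<open>k\<close> in the critical set come from \<open>c\<close> and \<open>card K\<close>
    being nonnegative.\<close>
  have c: "real c = 2 * d - real k" "real c' = 2 * d' - real k'"
    by (simp_all add: d_def d'_def k_def k'_def u v add_divide_distrib)
  have dd: "d' < d" using uv by (simp add: d_def d'_def)
  have "4 * (d - d') * \<delta> = (real k - real k') * (2 * (real k + real k') + (1 - n) - 1) - 4 * (real k * d - real k' * d')
        + 2 * (d - d') * (2 * d + 2 * d' + 1)"
    using eq unfolding spo_eigenvalue_spo_eigenvalue2 u v fst_conv ordw_pair k_def[symmetric] k'_def[symmetric] spo_eigenvalue2_def al_def c \<delta>(1)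
    by (simp add: field_simps)
  then have "\<delta> = ((real k - real k') * (2 * (real k + real k') + (1 - n) - 1) - 4 * (real k * d - real k' * d')
        + 2 * (d - d') * (2 * d + 2 * d' + 1)) / (4 * (d - d'))"
    using dd by (simp add: field_simps)
  moreover have "d \<in> half_nats" "d' \<in> half_nats" unfolding half_nats_def d_def d'_def by blast+
  moreover have "d' \<le> real k'" "real k' \<le> 2 * d'" "d \<le> real k" "real k \<le> 2 * d"
    by (simp_all add: d_def d'_def k_def k'_def u v)
  ultimately have "\<delta> \<in> C_delta_crit (1 - n)" unfolding C_delta_crit_def using dd by blast
  with \<delta>(2) show False by simp
qed

lemma I_delta_nonzero:
  assumes "\<delta> \<notin> I_delta" "a < c" shows "real c - \<delta> - real a / 2 \<noteq> 0"
proof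
  assume "real c - \<delta> - real a / 2 = 0"
  then have "\<delta> = (2 * real_of_int (int c) - real_of_int (int a)) / 2" by simp
  \<comment> \<open>The union bound \<open>d\<close> of \<open>I_delta\<close> is taken to be the
    degree \<open>c\<close> itself; \<open>a < c\<close> then gives the bound on the second
    parameter.\<close>
  moreover have "0 \<le> int a \<and> int a \<le> 2 * int c - 1 \<and> 0 \<le> int c \<and> int c \<le> int c" using assms(2) by auto
  ultimately have "\<delta> \<in> I_delta" unfolding I_delta_def by blast
  with assms(1) show False by simp
qed

theorem theorem4p12:
  fixes n :: nat and m lam mu \<delta> :: real
    and Q :: "'n::{finite,linorder} symb \<Rightarrow> 'n sfun \<Rightarrow> 'n sfun"
  assumes "n = CARD('n)" and "n \<ge> 3" and "m = 1 - real n" and "\<delta> = mu - lam"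
    and "\<delta> \<notin> C_delta_crit m" and "\<delta> \<notin> I_delta \<union> C_pgl m"
    and "Q = Q_sl lam mu \<circ> SQ \<delta>"
  shows "fine_quantization lam mu Q \<and> (\<forall>Q'. fine_quantization lam mu Q' \<longrightarrow> Q' = Q)"
proof -
  let ?l = "2 * lam" and ?l' = "2 * mu"
  have n2: "CARD('n) \<noteq> 2" using assms(1,2) by simp
  have m: "m = 1 - real CARD('n)" using assms(1,3) by simp
  have pgl: "\<delta> \<notin> C_pgl (1 - real CARD('n))" using assms(6) m by simp
  have crit: "\<delta> \<notin> C_delta_crit (1 - real CARD('n))" using assms(5) m by simp
  have nz: "real c - (mu - lam) - real a / 2 \<noteq> 0" if "a < c" for c a
    using I_delta_nonzero[of \<delta> a c] assms(4,6) that by simp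
  note g = spo_eigenvalue_nonres[OF assms(4) crit]
  have Q: "Q = (\<lambda>S. app (fine_map lam mu S))"
    unfolding assms(7) Q_sl_eq[OF n2 assms(4) pgl] by (rule ext) (simp add: fine_map_def assms(4))
  have e: "eigenop heisw (spo_casimir ?l ?l' :: 'n sfun endo endo) (spo_eigenvalue (real CARD('n)) ?l ?l')" by (rule eigenop_spo_casimir)
  have qq: "quantization_map heisw (fine_map lam mu :: 'n symb \<Rightarrow> _)" by (rule quantization_map_fine_map[OF gl_eigenvalue_nonres[OF assms(4) pgl]])
  \<comment> \<open>The map is given by eigenvectors of the Casimir, and each generator commutes
    with the Casimir; nonresonance then forces equivariance.\<close>
  have eq: "equivariant_wrt heisw (fine_map lam mu :: 'n symb \<Rightarrow> _) (mm ?l ?l' i j)" for i j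
    by (rule eigen_equivariant_wrt[OF qq e fine_map_eigen[OF nz] mm_spo_casimir preserves_mm(2) g])
  have C: "equivariant_wrt heisw q (spo_casimir ?l ?l')" if q: "quantization_map heisw q" and "\<And>i j. equivariant_wrt heisw q (mm ?l ?l' i j)" for q :: "'n symb \<Rightarrow> _"
  proof -
    have e: "preserved_equivariant heisw q (mm ?l ?l' i j)" for i j using that preserves_mm by blast
    have "preserved_equivariant heisw q (spo_casimir ?l ?l')" unfolding spo_casimir_def by (intro preserved_equivariant_closed(2,3,5)[OF q] e)
    then show ?thesis by blast
  qed
  have "fine_quantization lam mu Q"
    unfolding fine_quantization_iff[OF n2] using Q qq eq by blast
  moreover have "Q' = Q" if "fine_quantization lam mu Q'" for Q'
  proof -
    obtain q where Q': "Q' = (\<lambda>S. app (q S))" and q: "quantization_map heisw q" "\<And>i j. equivariant_wrt heisw q (mm ?l ?l' i j)"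
      using \<open>fine_quantization lam mu Q'\<close> unfolding fine_quantization_iff[OF n2] by blast
    have "q = fine_map lam mu"
      by (rule quantization_map_unique[OF q(1) C[OF q] qq C[OF qq eq] e]) (rule g)
    then show ?thesis by (simp add: Q' Q)
  qed
  ultimately show ?thesis by blast
qed

end
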